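(* Let $\mathcal{E}_*$ be a Hilbert space and let $\mathcal{H}_K$ be an analytic Hilbert space over $\mathbb{B}^n$. Let $\mathcal{S}$ be a Hilbert space that is contractively embedded in $\mathcal{H}_K\otimes\mathcal{E}_*$. Suppose $M_{z_j}\mathcal{S}\subseteq\mathcal{S}$ for all $j=1,\ldots,n$ (where $M_{z_j}$ acts on $\mathcal{H}_K\otimes\mathcal{E}_*$ as multiplication by $z_j$), set $R_j=M_{z_j}|_{\mathcal{S}}$, and suppose that $(R_1,\ldots,R_n)$ is a row contraction on $\mathcal{S}$. Then $(R_1,\ldots,R_n)$ is a pure row contraction, and there exist a Hilbert space $\mathcal{E}$ and a contractive multiplier $\Theta\in\mathcal{M}(H^2_n\otimes\mathcal{E},\mathcal{H}_K\otimes\mathcal{E}_* )$ such that $\mathcal{S}=\Theta H^2_n(\mathcal{E})=\{\Theta f: f\in H^2_n(\mathcal{E})\}$.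
   Context: $\mathbb{B}^n$ is the open unit ball of $\mathbb{C}^n$. A Hilbert space $\mathcal{S}$ is contractively embedded in a Hilbert space $\mathcal{K}$ if $\mathcal{S}$ is a vector subspace of $\mathcal{K}$ and $\|f\|_{\mathcal{K}}\le\|f\|_{\mathcal{S}}$ for all $f\in\mathcal{S}$. A commuting tuple $T=(T_1,\ldots,T_n)$ on a Hilbert space $\mathcal{L}$ is a row contraction if $\sum_i T_iT_i^*\le I_{\mathcal{L}}$; with $P_T(X)=\sum_i T_iXT_i^*$, it is pure if $P_T^m(I_{\mathcal{L}})\to 0$ in the strong operator topology. Let $K:\mathbb{B}^n\times\mathbb{B}^n\to\mathbb{C}$ be a positive definite kernel, holomorphic in $\mathbf{z}$ and anti-holomorphic in $\mathbf{w}$, with reproducing kernel Hilbert space $\mathcal{H}_K$ of holomorphic functions on $\mathbb{B}^n$. $\mathcal{H}_K$ is called an analytic Hilbert space if the multiplication operators $M_{z_j}$, $(M_{z_j}f)(\mathbf{w})=w_jf(\mathbf{w})$, are bounded on $\mathcal{H}_K$ and $(M_{z_1},\ldots,M_{z_n})$ is a pure row contraction. $\mathcal{H}_K\otimes\mathcal{E}_*$ is identified with the $\mathcal{E}_*$-valued reproducing kernel Hilbert space with kernel $K(\mathbf{z},\mathbf{w})I_{\mathcal{E}_*}$. $H^2_n$ is the Drury–Arveson space (kernel $(1-\sum_i z_i\bar w_i)^{-1}$ on $\mathbb{B}^n$), and $H^2_n(\mathcal{E})=H^2_n\otimes\mathcal{E}$. The multiplier space $\mathcal{M}(H^2_n\otimes\mathcal{E},\mathcal{H}_K\otimes\mathcal{E}_*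 )$ consists of holomorphic $\Theta:\mathbb{B}^n\to\mathcal{B}(\mathcal{E},\mathcal{E}_* )$ with $\Theta f\in\mathcal{H}_K\otimes\mathcal{E}_*$ for all $f\in H^2_n\otimes\mathcal{E}$; the operator $M_\Theta f=\Theta f$ is then bounded, and $\Theta$ is a contractive multiplier if $\|M_\Theta\|\le 1$. *)

theory Defs
  imports "HOL-Analysis.Analysis" "HOL-Library.Function_Algebras"
begin

class cvec = ab_group_add +
  fixes cscale :: "complex \<Rightarrow> 'a \<Rightarrow> 'a"
  assumes cscale_add_right: "cscale a (x + y) = cscale a x + cscale a y"
    and cscale_add_left: "cscale (a + b) x = cscale a x + cscale b x"
    and cscale_cscale: "cscale a (cscale b x) = cscale (a * b) x"
    and cscale_one: "cscale 1 x = x"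

instantiation complex :: cvec
begin
definition cscale_complex :: "complex \<Rightarrow> complex \<Rightarrow> complex" where
  "cscale_complex a x = a * x"
instance by standard (auto simp: cscale_complex_def algebra_simps)
end

instantiation "fun" :: (type, cvec) cvec
begin
definition cscale_fun :: "complex \<Rightarrow> ('a \<Rightarrow> 'b) \<Rightarrow> 'a \<Rightarrow> 'b" where
  "cscale_fun a f = (\<lambda>x. cscale a (f x))"
instance by standard (auto simp: cscale_fun_def cscale_add_right cscale_add_left cscale_cscale cscale_one)
end

definition csubspace :: "'a::cvec set \<Rightarrow> bool" where
  "csubspace H \<longleftrightarrow> 0 \<in> H \<and> (\<forall>x\<in>H. \<forall>y\<in>H. x + y \<in> H) \<and> (\<forall>a. \<forall>x\<in>H. cscale a x \<in> H)"

definition hnorm :: "('a \<Rightarrow> 'a \<Rightarrow> complex) \<Rightarrow> 'a \<Rightarrow> real" where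
  "hnorm ip x = sqrt (Re (ip x x))"

definition hilbert_space :: "'a::cvec set \<Rightarrow> ('a \<Rightarrow> 'a \<Rightarrow> complex) \<Rightarrow> bool" where
  "hilbert_space H ip \<longleftrightarrow>
     csubspace H \<and>
     (\<forall>x\<in>H. \<forall>y\<in>H. \<forall>z\<in>H. ip (x + y) z = ip x z + ip y z) \<and>
     (\<forall>a. \<forall>x\<in>H. \<forall>y\<in>H. ip (cscale a x) y = a * ip x y) \<and>
     (\<forall>x\<in>H. \<forall>y\<in>H. ip y x = cnj (ip x y)) \<and>
     (\<forall>x\<in>H. Re (ip x x) \<ge> 0) \<and>
     (\<forall>x\<in>H. ip x x = 0 \<longrightarrow> x = 0) \<and>
     (\<forall>u. (\<forall>k. u k \<in> H) \<and> (\<forall>\<epsilon>>0. \<exists>N. \<forall>m\<ge>N. \<forall>k\<ge>N. hnorm ip (u m - u k) < \<epsilon>)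
          \<longrightarrow> (\<exists>x\<in>H. (\<lambda>k. hnorm ip (u k - x)) \<longlonglongrightarrow> 0))"

definition bounded_op :: "'a::cvec set \<Rightarrow> ('a \<Rightarrow> 'a \<Rightarrow> complex) \<Rightarrow> 'b::cvec set \<Rightarrow> ('b \<Rightarrow> 'b \<Rightarrow> complex) \<Rightarrow> ('a \<Rightarrow> 'b) \<Rightarrow> bool" where
  "bounded_op H ip H' ip' T \<longleftrightarrow>
     (\<forall>x\<in>H. T x \<in> H') \<and>
     (\<forall>x\<in>H. \<forall>y\<in>H. T (x + y) = T x + T y) \<and>
     (\<forall>a. \<forall>x\<in>H. T (cscale a x) = cscale a (T x)) \<and>
     (\<exists>C. \<forall>x\<in>H. hnorm ip' (T x) \<le> C * hnorm ip x)"

definition adjoint :: "'a set \<Rightarrow> ('a \<Rightarrow> 'a \<Rightarrow> complex) \<Rightarrow> 'b set \<Rightarrow> ('b \<Rightarrow> 'b \<Rightarrow> complex) \<Rightarrow> ('a \<Rightarrow> 'b) \<Rightarrow> 'b \<Rightarrow> 'a" where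
  "adjoint H ip H' ip' T y = (THE x. x \<in> H \<and> (\<forall>u\<in>H. ip' (T u) y = ip u x))"

definition row_contraction :: "'a::cvec set \<Rightarrow> ('a \<Rightarrow> 'a \<Rightarrow> complex) \<Rightarrow> ('i::finite \<Rightarrow> 'a \<Rightarrow> 'a) \<Rightarrow> bool" where
  "row_contraction H ip T \<longleftrightarrow>
     (\<forall>i. bounded_op H ip H ip (T i)) \<and>
     (\<forall>i j. \<forall>x\<in>H. T i (T j x) = T j (T i x)) \<and>
     (\<forall>x\<in>H. Re (ip (\<Sum>i\<in>UNIV. T i (adjoint H ip H ip (T i) x)) x) \<le> Re (ip x x))"

definition P_T :: "'a::cvec set \<Rightarrow> ('a \<Rightarrow> 'a \<Rightarrow> complex) \<Rightarrow> ('i::finite \<Rightarrow> 'a \<Rightarrow> 'a) \<Rightarrow> ('a \<Rightarrow> 'a) \<Rightarrow> 'a \<Rightarrow> 'a" where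
  "P_T H ip T X = (\<lambda>x. \<Sum>i\<in>UNIV. T i (X (adjoint H ip H ip (T i) x)))"

definition pure_row_contraction :: "'a::cvec set \<Rightarrow> ('a \<Rightarrow> 'a \<Rightarrow> complex) \<Rightarrow> ('i::finite \<Rightarrow> 'a \<Rightarrow> 'a) \<Rightarrow> bool" where
  "pure_row_contraction H ip T \<longleftrightarrow>
     row_contraction H ip T \<and>
     (\<forall>x\<in>H. (\<lambda>m. hnorm ip ((P_T H ip T ^^ m) id x)) \<longlonglongrightarrow> 0)"

abbreviation Bn :: "(complex^'n) set" where
  "Bn \<equiv> ball 0 1"

definition cinner_n :: "complex^'n \<Rightarrow> complex^'n \<Rightarrow> complex" where
  "cinner_n z w = (\<Sum>i\<in>UNIV. z $ i * cnj (w $ i))"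

definition holo_on :: "(complex^'n) set \<Rightarrow> (complex^'n \<Rightarrow> complex) \<Rightarrow> bool" where
  "holo_on U f \<longleftrightarrow> (\<forall>z\<in>U. \<exists>L. (\<forall>c v. L (c *s v) = c * L v) \<and> (f has_derivative L) (at z))"

definition pos_kernel :: "'x set \<Rightarrow> ('x \<Rightarrow> 'x \<Rightarrow> complex) \<Rightarrow> bool" where
  "pos_kernel X K \<longleftrightarrow>
     (\<forall>(m::nat) (z::nat \<Rightarrow> 'x) (c::nat \<Rightarrow> complex). (\<forall>i<m. z i \<in> X) \<longrightarrow>
        Im (\<Sum>i<m. \<Sum>j<m. cnj (c i) * c j * K (z i) (z j)) = 0 \<and>
        Re (\<Sum>i<m. \<Sum>j<m. cnj (c i) * c j * K (z i) (z j)) \<ge> 0)"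

definition DA_kernel :: "complex^'n \<Rightarrow> complex^'n \<Rightarrow> complex" where
  "DA_kernel z w = 1 / (1 - cinner_n z w)"

definition kfun :: "'x set \<Rightarrow> ('x \<Rightarrow> 'x \<Rightarrow> complex) \<Rightarrow> 'x \<Rightarrow> 'e::cvec \<Rightarrow> 'x \<Rightarrow> 'e" where
  "kfun X K w e = (\<lambda>z. if z \<in> X then cscale (K z w) e else 0)"

text \<open>(H, ip) is the RKHS (of E-valued functions on X, extended by 0 outside X)
  with kernel K(z,w) I_E, i.e. H_K \<otimes> E.\<close>
definition vrkhs :: "'x set \<Rightarrow> ('x \<Rightarrow> 'x \<Rightarrow> complex) \<Rightarrow> 'e::cvec set \<Rightarrow> ('e \<Rightarrow> 'e \<Rightarrow> complex)
                     \<Rightarrow> ('x \<Rightarrow> 'e) set \<Rightarrow> (('x \<Rightarrow> 'e) \<Rightarrow> ('x \<Rightarrow> 'e) \<Rightarrow> complex) \<Rightarrow> bool" where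
  "vrkhs X K E ipE H ip \<longleftrightarrow>
     hilbert_space H ip \<and>
     (\<forall>f\<in>H. \<forall>z. (z \<in> X \<longrightarrow> f z \<in> E) \<and> (z \<notin> X \<longrightarrow> f z = 0)) \<and>
     (\<forall>w\<in>X. \<forall>e\<in>E. kfun X K w e \<in> H) \<and>
     (\<forall>f\<in>H. \<forall>w\<in>X. \<forall>e\<in>E. ipE (f w) e = ip f (kfun X K w e))"

definition ip_C :: "complex \<Rightarrow> complex \<Rightarrow> complex" where
  "ip_C a b = a * cnj b"

definition Mz :: "'n \<Rightarrow> (complex^'n \<Rightarrow> 'e::cvec) \<Rightarrow> complex^'n \<Rightarrow> 'e" where
  "Mz j f = (\<lambda>z. cscale (z $ j) (f z))"

definition analytic_hilbert_space :: "(complex^'n::finite \<Rightarrow> complex^'n \<Rightarrow> complex)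
     \<Rightarrow> (complex^'n \<Rightarrow> complex) set \<Rightarrow> ((complex^'n \<Rightarrow> complex) \<Rightarrow> (complex^'n \<Rightarrow> complex) \<Rightarrow> complex) \<Rightarrow> bool" where
  "analytic_hilbert_space K H ip \<longleftrightarrow>
     vrkhs Bn K UNIV ip_C H ip \<and>
     (\<forall>j. \<forall>f\<in>H. Mz j f \<in> H) \<and>
     pure_row_contraction H ip (\<lambda>j. Mz j)"

definition mult_op :: "(complex^'n \<Rightarrow> 'f \<Rightarrow> 'e::cvec) \<Rightarrow> (complex^'n \<Rightarrow> 'f) \<Rightarrow> complex^'n \<Rightarrow> 'e" where
  "mult_op \<Theta> f = (\<lambda>z. if z \<in> Bn then \<Theta> z (f z) else 0)"

text \<open>Theta is a contractive multiplier from (HE, ipHE) = H^2_n \<otimes> E to (HK, ipK) = H_K \<otimes> E_*;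
  holomorphy of the B(E,E_*)-valued function is taken in the weak sense.\<close>
definition contractive_multiplier ::
  "'f::cvec set \<Rightarrow> ('f \<Rightarrow> 'f \<Rightarrow> complex) \<Rightarrow> (complex^'n::finite \<Rightarrow> 'f) set \<Rightarrow> ((complex^'n \<Rightarrow> 'f) \<Rightarrow> (complex^'n \<Rightarrow> 'f) \<Rightarrow> complex)
   \<Rightarrow> 'e::cvec set \<Rightarrow> ('e \<Rightarrow> 'e \<Rightarrow> complex) \<Rightarrow> (complex^'n \<Rightarrow> 'e) set \<Rightarrow> ((complex^'n \<Rightarrow> 'e) \<Rightarrow> (complex^'n \<Rightarrow> 'e) \<Rightarrow> complex)
   \<Rightarrow> (complex^'n \<Rightarrow> 'f \<Rightarrow> 'e) \<Rightarrow> bool" where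
  "contractive_multiplier E ipE HE ipHE Es ipEs HK ipK \<Theta> \<longleftrightarrow>
     (\<forall>z\<in>Bn. bounded_op E ipE Es ipEs (\<Theta> z)) \<and>
     (\<forall>e\<in>E. \<forall>e'\<in>Es. holo_on Bn (\<lambda>z. ipEs (\<Theta> z e) e')) \<and>
     (\<forall>f\<in>HE. mult_op \<Theta> f \<in> HK) \<and>
     (\<forall>f\<in>HE. hnorm ipK (mult_op \<Theta> f) \<le> hnorm ipHE f)"

end

theory Submission
  imports Defs "HOL-Complex_Analysis.Complex_Analysis"
begin

text \<open>S is itself a reproducing kernel space; let k(z,w) be its operator-valued kernel. The adjoint of R_j multiplies
  k(.,w)e by the conjugate of w_j. Hence P^m(I) has quadratic form |w|^(2m) |x|^2 at a kernel function x = k(.,w)e, which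
  gives purity by density, and the row contraction inequality says that L(z,w) = (1 - <z,w>) k(z,w) is positive definite. Let E
  be the space with kernel L and Theta(z) the evaluation of E at z. Then k(z,w) = Theta(z) Theta(w)* / (1 - <z,w>), so
  multiplication by Theta is a coisometry of the Drury-Arveson space of E onto S; applied to constants this gives that E is a
  subset of S.

  For Theta to be holomorphic, the elements of H_K \<otimes> E_* must be. They are limits of combinations of kernel
  functions, and these limits are locally uniform once K(z,z) is locally bounded. As K is only separately holomorphic in z
  and the conjugate of w, this is a form of Hartogs' theorem. By Baire there are balls near any given point on which K(z,z) is
  bounded. A bound on radius r around a propagates to any radius below the geometric mean of r and 1 - |a|, hence by
  iteration to all radii below 1 - |a|.\<close>

section \<open>Hilbert spaces on explicit carriers\<close>

text \<open>Since \<open>E\<close> consists of functions with values in \<open>Es\<close>, a product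
  \<open>mult_op \<Theta> h\<close> is the diagonal value \<open>h z z\<close>, and weak holomorphy
  of \<open>\<Theta>\<close> says that \<open>\<lambda>z. ipEs (f z) e\<close> is holomorphic for
  \<open>f\<close> in \<open>E\<close>. The chain \<open>E \<subseteq> S \<subseteq> HKE\<close>
  moves that question to \<open>HKE\<close>. There it is delicate: norm limits are uniform only
  where evaluation is uniformly bounded, and Baire's theorem does not say where its ball lies.

  The geometric mean comes from using a Taylor coefficient functional at \<open>a\<close> twice. Let
  \<open>d\<close> be its Riesz representer for the m-th coefficient. Up to conjugation
  \<open>d w\<close> is a coefficient of \<open>k w\<close>, which is holomorphic on the large ball
  of radius \<rho>, so \<open>d w\<close> is of order \<rho>^(-m). The squared norm of
  \<open>d\<close> is in turn the m-th coefficient of \<open>d\<close> on radii close to r, so it is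
  of order (\<rho> r)^(-m). The Taylor series of \<open>k z\<close> thus converges up to the radius
  sqrt(\<rho> r). The difficulty is that the first estimate has a constant depending on
  \<open>w\<close> in an uncontrolled way; logarithms and area means make it uniform.\<close>

interpretation cv: vector_space cscale
  by unfold_locales (auto simp: cscale_add_right cscale_add_left cscale_cscale cscale_one)

lemma csubspace_zero: "csubspace V \<Longrightarrow> 0 \<in> V"
  and csubspace_add: "csubspace V \<Longrightarrow> x \<in> V \<Longrightarrow> y \<in> V \<Longrightarrow> x + y \<in> V"
  and csubspace_scale: "csubspace V \<Longrightarrow> x \<in> V \<Longrightarrow> cscale a x \<in> V"
  by (auto simp: csubspace_def)

lemma csubspace_minus: "csubspace V \<Longrightarrow> x \<in> V \<Longrightarrow> - x \<in> V"
  using csubspace_scale[of V x "-1"] by simp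

lemma csubspace_diff: "csubspace V \<Longrightarrow> x \<in> V \<Longrightarrow> y \<in> V \<Longrightarrow> x - y \<in> V"
  using csubspace_add[of V x "- y"] csubspace_minus[of V y] by simp

lemma csubspace_sum: "csubspace V \<Longrightarrow> (\<And>i. i \<in> I \<Longrightarrow> f i \<in> V) \<Longrightarrow> sum f I \<in> V"
  by (induction I rule: infinite_finite_induct) (auto intro: csubspace_add csubspace_zero)

text \<open>Definiteness is left out because two forms below may degenerate and still need
  Cauchy-Schwarz and the triangle inequality: the Gram form \<open>B\<close> on formal combinations
  and the forms \<open>ipQ m\<close>.\<close>

locale semi_inner =
  fixes H :: "'a::cvec set" and ip :: "'a \<Rightarrow> 'a \<Rightarrow> complex"
  assumes sub: "csubspace H"
    and ip_add_left: "x \<in> H \<Longrightarrow> y \<in> H \<Longrightarrow> z \<in> H \<Longrightarrow> ip (x + y) z = ip x z + ip y z"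
    and ip_scale_left: "x \<in> H \<Longrightarrow> y \<in> H \<Longrightarrow> ip (cscale a x) y = a * ip x y"
    and herm: "x \<in> H \<Longrightarrow> y \<in> H \<Longrightarrow> ip y x = cnj (ip x y)"
    and nonneg: "x \<in> H \<Longrightarrow> 0 \<le> Re (ip x x)"
begin

lemmas mem = csubspace_zero[OF sub] csubspace_add[OF sub] csubspace_scale[OF sub]
  csubspace_minus[OF sub] csubspace_diff[OF sub] csubspace_sum[OF sub]

lemma ip_add_right: "x \<in> H \<Longrightarrow> y \<in> H \<Longrightarrow> z \<in> H \<Longrightarrow> ip z (x + y) = ip z x + ip z y"
  using herm[of "x + y" z] herm[of x z] herm[of y z] ip_add_left[of x y z] by (simp add: mem)

lemma ip_scale_right: "x \<in> H \<Longrightarrow> y \<in> H \<Longrightarrow> ip y (cscale a x) = cnj a * ip y x"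
  using herm[of "cscale a x" y] herm[of x y] ip_scale_left[of x y a] by (simp add: mem)

lemma ip_zero_left: "x \<in> H \<Longrightarrow> ip 0 x = 0"
  using ip_scale_left[of x x 0] by simp

lemma ip_zero_right: "x \<in> H \<Longrightarrow> ip x 0 = 0"
  using ip_scale_right[of x x 0] by simp

lemma ip_minus_left: "x \<in> H \<Longrightarrow> y \<in> H \<Longrightarrow> ip (- x) y = - ip x y"
  using ip_scale_left[of x y "-1"] by simp

lemma ip_minus_right: "x \<in> H \<Longrightarrow> y \<in> H \<Longrightarrow> ip y (- x) = - ip y x"
  using ip_scale_right[of x y "-1"] by simp

lemma ip_diff_left: "x \<in> H \<Longrightarrow> y \<in> H \<Longrightarrow> z \<in> H \<Longrightarrow> ip (x - y) z = ip x z - ip y z"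
  using ip_add_left[of x "- y" z] by (simp add: mem ip_minus_left)

lemma ip_diff_right: "x \<in> H \<Longrightarrow> y \<in> H \<Longrightarrow> z \<in> H \<Longrightarrow> ip z (x - y) = ip z x - ip z y"
  using ip_add_right[of x "- y" z] by (simp add: mem ip_minus_right)

lemma ip_sum_left: "(\<And>i. i \<in> I \<Longrightarrow> f i \<in> H) \<Longrightarrow> z \<in> H \<Longrightarrow> ip (sum f I) z = (\<Sum>i\<in>I. ip (f i) z)"
  by (induction I rule: infinite_finite_induct) (auto simp: ip_zero_left ip_add_left mem)

lemma ip_sum_right: "(\<And>i. i \<in> I \<Longrightarrow> f i \<in> H) \<Longrightarrow> z \<in> H \<Longrightarrow> ip z (sum f I) = (\<Sum>i\<in>I. ip z (f i))"
  by (induction I rule: infinite_finite_induct) (auto simp: ip_zero_right ip_add_right mem)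

lemma ip_self: "x \<in> H \<Longrightarrow> ip x x = of_real ((hnorm ip x)\<^sup>2)"
  using herm[of x x] nonneg[of x] by (auto simp: hnorm_def complex_eq_iff)

lemma hnorm_sq: "x \<in> H \<Longrightarrow> (hnorm ip x)\<^sup>2 = Re (ip x x)"
  using nonneg[of x] by (simp add: hnorm_def)

lemma hnorm_ge_0 [simp]: "x \<in> H \<Longrightarrow> 0 \<le> hnorm ip x"
  using nonneg by (simp add: hnorm_def)

lemma hnorm_zero: "hnorm ip 0 = 0"
  by (simp add: hnorm_def ip_zero_left mem)

lemma hnorm_scale: "x \<in> H \<Longrightarrow> hnorm ip (cscale a x) = norm a * hnorm ip x"
proof -
  assume x: "x \<in> H"
  have "ip (cscale a x) (cscale a x) = (a * cnj a) * ip x x"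
    using x by (simp add: ip_scale_left ip_scale_right mem)
  also have "\<dots> = of_real ((norm a * hnorm ip x)\<^sup>2)"
    unfolding ip_self[OF x] power_mult_distrib of_real_mult complex_norm_square ..
  finally have "Re (ip (cscale a x) (cscale a x)) = (norm a * hnorm ip x)\<^sup>2"
    by (simp only: Re_complex_of_real)
  then show ?thesis
    using x by (simp add: hnorm_def[of _ "cscale a x"] abs_mult)
qed

lemma hnorm_minus: "x \<in> H \<Longrightarrow> hnorm ip (- x) = hnorm ip x"
  using hnorm_scale[of x "-1"] by simp

lemma hnorm_minus_commute: "x \<in> H \<Longrightarrow> y \<in> H \<Longrightarrow> hnorm ip (x - y) = hnorm ip (y - x)"
  using hnorm_minus[of "x - y"] by (simp add: mem)

lemma cauchy_schwarz:
  assumes x: "x \<in> H" and y: "y \<in> H"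
  shows "norm (ip x y) \<le> hnorm ip x * hnorm ip y"
proof -
  define a b c where "a = (hnorm ip x)\<^sup>2" and "b = (hnorm ip y)\<^sup>2" and "c = ip x y"
  have *: "a - 2 * s * (norm c)\<^sup>2 + s\<^sup>2 * (norm c)\<^sup>2 * b \<ge> 0" for s :: real
  proof -
    let ?t = "of_real s * c"
    have "ip (x - cscale ?t y) (x - cscale ?t y)
        = ip x x - cnj ?t * ip x y - ?t * ip y x + ?t * cnj ?t * ip y y"
      using x y by (simp add: mem ip_diff_left ip_diff_right ip_scale_left ip_scale_right algebra_simps)
    also have "\<dots> = of_real a - 2 * of_real s * (c * cnj c) + of_real (s\<^sup>2) * (c * cnj c) * of_real b"
      using x y by (simp add: ip_self a_def b_def herm[OF x y] c_def power2_eq_square algebra_simps)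
    also have "\<dots> = of_real (a - 2 * s * (norm c)\<^sup>2 + s\<^sup>2 * (norm c)\<^sup>2 * b)"
      by (simp flip: complex_norm_square)
    finally show ?thesis
      using nonneg[of "x - cscale ?t y"] x y by (simp add: mem)
  qed
  have "(norm c)\<^sup>2 \<le> a * b"
  proof (cases "b = 0")
    case True
    have "(norm c)\<^sup>2 = 0"
    proof (rule ccontr)
      assume n: "(norm c)\<^sup>2 \<noteq> 0"
      \<comment> \<open>With \<open>b = 0\<close> the quadratic is affine in \<open>s\<close>, and
        the chosen \<open>s\<close> gives it the value \<open>- a - 2\<close>.\<close>
      have "a \<ge> 0" by (simp add: a_def)
      then show False
        using *[of "(a + 1) / (norm c)\<^sup>2"] True n by simp
    qed
    then show ?thesis using True by simp
  next
    case False
    then have b: "b > 0" by (simp add: b_def)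
    have "a - 2 * (1/b) * (norm c)\<^sup>2 + (1/b)\<^sup>2 * (norm c)\<^sup>2 * b = a - (norm c)\<^sup>2 / b"
      using b by (simp add: power2_eq_square field_simps)
    then have "a - (norm c)\<^sup>2 / b \<ge> 0" using *[of "1/b"] by simp
    then show ?thesis using b by (simp add: field_simps)
  qed
  then have "(norm c)\<^sup>2 \<le> (hnorm ip x * hnorm ip y)\<^sup>2"
    by (simp add: a_def b_def power_mult_distrib)
  then show ?thesis
    unfolding c_def by (rule power2_le_imp_le) (use x y in simp)
qed

lemma hnorm_add_sq:
  assumes "x \<in> H" "y \<in> H"
  shows "(hnorm ip (x + y))\<^sup>2 = (hnorm ip x)\<^sup>2 + 2 * Re (ip x y) + (hnorm ip y)\<^sup>2"
  using assms by (simp add: hnorm_sq mem ip_add_left ip_add_right herm[of x y])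

lemma hnorm_diff_sq:
  assumes "x \<in> H" "y \<in> H"
  shows "(hnorm ip (x - y))\<^sup>2 = (hnorm ip x)\<^sup>2 - 2 * Re (ip x y) + (hnorm ip y)\<^sup>2"
  using assms by (simp add: hnorm_sq mem ip_diff_left ip_diff_right herm[of x y])

lemma hnorm_triangle:
  assumes "x \<in> H" "y \<in> H"
  shows "hnorm ip (x + y) \<le> hnorm ip x + hnorm ip y"
proof (rule power2_le_imp_le)
  have "Re (ip x y) \<le> hnorm ip x * hnorm ip y"
    using cauchy_schwarz[OF assms] complex_Re_le_cmod order_trans by blast
  then show "(hnorm ip (x + y))\<^sup>2 \<le> (hnorm ip x + hnorm ip y)\<^sup>2"
    using assms by (simp add: hnorm_add_sq power2_sum)
qed (use assms in auto)

lemma hnorm_triangle_diff: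
  assumes "x \<in> H" "y \<in> H" "z \<in> H"
  shows "hnorm ip (x - z) \<le> hnorm ip (x - y) + hnorm ip (y - z)"
  using hnorm_triangle[of "x - y" "y - z"] assms by (simp add: mem)

lemma hnorm_sum_le:
  "(\<And>i. i \<in> I \<Longrightarrow> f i \<in> H) \<Longrightarrow> hnorm ip (sum f I) \<le> (\<Sum>i\<in>I. hnorm ip (f i))"
proof (induction I rule: infinite_finite_induct)
  case (insert i I)
  then show ?case
    using hnorm_triangle[of "f i" "sum f I"] by (simp add: mem)
qed (auto simp: hnorm_zero)

lemma approx_seq:
  assumes "\<And>w. w \<in> W \<Longrightarrow> p w \<in> H" "g \<in> H"
    and appr: "\<And>\<epsilon>. \<epsilon> > 0 \<Longrightarrow> \<exists>w\<in>W. hnorm ip (p w - g) < \<epsilon>"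
  shows "\<exists>u. (\<forall>n::nat. u n \<in> W) \<and> (\<lambda>n. hnorm ip (p (u n) - g)) \<longlonglongrightarrow> 0"
proof -
  have "\<forall>n. \<exists>w\<in>W. hnorm ip (p w - g) < inverse (real (Suc n))" using appr by simp
  then obtain u where u: "\<And>n. u n \<in> W" "\<And>n. hnorm ip (p (u n) - g) < inverse (real (Suc n))"
    by metis
  have "norm (hnorm ip (p (u n) - g)) \<le> inverse (real (Suc n))" for n
    using hnorm_ge_0[OF mem(5)[OF assms(1)[OF u(1)] assms(2)], of n] less_imp_le[OF u(2)[of n]]
    by (simp only: real_norm_def abs_of_nonneg)
  then have "(\<lambda>n. hnorm ip (p (u n) - g)) \<longlonglongrightarrow> 0"
    by (intro Lim_null_comparison[OF _ LIMSEQ_inverse_real_of_nat] always_eventually allI)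
  with u(1) show ?thesis by blast
qed

end

locale hilbert = semi_inner +
  assumes definite: "x \<in> H \<Longrightarrow> ip x x = 0 \<Longrightarrow> x = 0"
    and complete: "(\<And>k. u k \<in> H) \<Longrightarrow>
      (\<And>\<epsilon>. \<epsilon> > 0 \<Longrightarrow> \<exists>N. \<forall>m\<ge>N. \<forall>k\<ge>N. hnorm ip (u m - u k) < \<epsilon>) \<Longrightarrow>
      \<exists>x\<in>H. (\<lambda>k. hnorm ip (u k - x)) \<longlonglongrightarrow> 0"

lemma hilbert_space_iff: "hilbert_space H ip \<longleftrightarrow> hilbert H ip"
proof
  assume h: "hilbert_space H ip"
  note hs = h[unfolded hilbert_space_def]
  note hs2 = hs[THEN conjunct2] note hs3 = hs2[THEN conjunct2] note hs4 = hs3[THEN conjunct2]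
  note hs5 = hs4[THEN conjunct2] note hs6 = hs5[THEN conjunct2]
  show "hilbert H ip"
  proof
    show "csubspace H" by (rule hs[THEN conjunct1])
  qed (rule hs2[THEN conjunct1, rule_format] hs3[THEN conjunct1, rule_format]
      hs4[THEN conjunct1, rule_format] hs5[THEN conjunct1, rule_format] hs6[THEN conjunct1, rule_format]
      hs6[THEN conjunct2, rule_format]; blast)+
next
  assume "hilbert H ip"
  then interpret hilbert H ip .
  show "hilbert_space H ip"
    unfolding hilbert_space_def
    by (intro conjI ballI allI impI; (elim conjE)?)
      (simp_all add: sub ip_add_left ip_scale_left herm[symmetric] nonneg definite complete)
qed

context hilbert
begin

lemma eqI_left:
  assumes "x \<in> H" "y \<in> H" "\<And>z. z \<in> H \<Longrightarrow> ip x z = ip y z"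
  shows "x = y"
  using definite[of "x - y"] assms by (simp add: mem ip_diff_left)

lemma eqI_right:
  assumes "x \<in> H" "y \<in> H" "\<And>z. z \<in> H \<Longrightarrow> ip z x = ip z y"
  shows "x = y"
  using definite[of "x - y"] assms by (simp add: mem ip_diff_right)

lemma tendsto_ip_right:
  assumes "\<And>k. u k \<in> H" "x \<in> H" "y \<in> H" and lim: "(\<lambda>k. hnorm ip (u k - x)) \<longlonglongrightarrow> 0"
  shows "(\<lambda>k. ip y (u k)) \<longlonglongrightarrow> ip y x"
proof -
  have "(\<lambda>k. hnorm ip y * hnorm ip (u k - x)) \<longlonglongrightarrow> 0"
    using tendsto_mult_right_zero[OF lim] .
  then have "(\<lambda>k. ip y (u k) - ip y x) \<longlonglongrightarrow> 0"
  proof (rule Lim_null_comparison[rotated])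
    show "\<forall>\<^sub>F k in sequentially. norm (ip y (u k) - ip y x) \<le> hnorm ip y * hnorm ip (u k - x)"
      using cauchy_schwarz[of y "u _ - x"] assms(1-3) by (simp add: ip_diff_right mem)
  qed
  then show ?thesis by (simp add: LIM_zero_iff)
qed

text \<open>Minimising \<open>\<parallel>p w\<parallel>\<^sup>2 - 2 Re (t w)\<close> over a subspace that need not be closed gives Riesz' theorem, adjoints, density of
  kernel functions and the transfer between spaces with equal Gram matrices at once.\<close>

lemma functional_representation:
  fixes p :: "'w::cvec \<Rightarrow> 'a" and t :: "'w \<Rightarrow> complex"
  assumes W: "csubspace W"
    and p: "\<And>w. w \<in> W \<Longrightarrow> p w \<in> H"
    and p_add: "\<And>w w'. w \<in> W \<Longrightarrow> w' \<in> W \<Longrightarrow> p (w + w') = p w + p w'"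
    and p_scale: "\<And>w a. w \<in> W \<Longrightarrow> p (cscale a w) = cscale a (p w)"
    and t_add: "\<And>w w'. w \<in> W \<Longrightarrow> w' \<in> W \<Longrightarrow> t (w + w') = t w + t w'"
    and t_scale: "\<And>w a. w \<in> W \<Longrightarrow> t (cscale a w) = a * t w"
    and bound: "\<And>w. w \<in> W \<Longrightarrow> norm (t w) \<le> C * hnorm ip (p w)"
  obtains g where "g \<in> H" "\<And>w. w \<in> W \<Longrightarrow> ip (p w) g = t w" "hnorm ip g \<le> \<bar>C\<bar>"
    "\<And>\<epsilon>. \<epsilon> > 0 \<Longrightarrow> \<exists>w\<in>W. hnorm ip (p w - g) < \<epsilon>"
proof -
  define J where "J w = (hnorm ip (p w))\<^sup>2 - 2 * Re (t w)" for w
  have J_lower: "J w \<ge> - C\<^sup>2" if "w \<in> W" for w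
  proof -
    have "Re (t w) \<le> C * hnorm ip (p w)"
      by (rule order_trans[OF complex_Re_le_cmod bound[OF that]])
    moreover have "0 \<le> (hnorm ip (p w) - C)\<^sup>2" by simp
    ultimately show ?thesis by (simp add: J_def power2_diff algebra_simps)
  qed
  define I where "I = (INF w\<in>W. J w)"
  have bdd: "bdd_below (J ` W)" using J_lower by (auto intro!: bdd_belowI[of _ "- C\<^sup>2"])
  have I_le: "I \<le> J w" if "w \<in> W" for w
    unfolding I_def by (rule cINF_lower[OF bdd that])
  have "\<exists>w\<in>W. J w < I + 1 / real (Suc k)" for k
  proof -
    have "W \<noteq> {}" using csubspace_zero[OF W] by auto
    then show ?thesis
      using cINF_less_iff[OF _ bdd, of "I + 1 / real (Suc k)"] by (auto simp: I_def)
  qed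
  then obtain w where w: "\<And>k. w k \<in> W" and Jw: "\<And>k. J (w k) < I + 1 / real (Suc k)"
    by metis
  \<comment> \<open>Parallelogram law: at the midpoint \<open>m\<close> the linear terms cancel, and
    the left side equals \<open>2 * J v + 2 * J v' - 4 * J m\<close>, where
    \<open>J m \<ge> I\<close>.\<close>
  have par: "(hnorm ip (p v - p v'))\<^sup>2 \<le> 2 * (J v - I) + 2 * (J v' - I)" if v: "v \<in> W" "v' \<in> W" for v v'
  proof -
    define m where "m = cscale (1/2) (v + v')"
    have m: "m \<in> W" unfolding m_def using v W by (auto intro: csubspace_add csubspace_scale)
    have pm: "p m = cscale (1/2) (p v + p v')"
      unfolding m_def using v W by (simp add: p_add p_scale csubspace_add)
    have "Re (t m) = (Re (t v) + Re (t v')) / 2"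
      unfolding m_def using v W by (simp add: t_add t_scale csubspace_add)
    moreover have "(hnorm ip (p m))\<^sup>2 = (hnorm ip (p v + p v'))\<^sup>2 / 4"
      unfolding pm using v by (simp add: hnorm_scale p mem power_mult_distrib norm_divide power_divide)
    ultimately show ?thesis
      using I_le[OF m] hnorm_add_sq[OF p[OF v(1)] p[OF v(2)]] hnorm_diff_sq[OF p[OF v(1)] p[OF v(2)]]
      by (simp add: J_def field_simps)
  qed
  have cauchy: "\<exists>N. \<forall>m\<ge>N. \<forall>k\<ge>N. hnorm ip (p (w m) - p (w k)) < e" if e: "e > 0" for e
  proof -
    obtain N where N: "inverse (real (Suc N)) < e\<^sup>2 / 4"
      using reals_Archimedean[of "e\<^sup>2 / 4"] e by auto
    have "hnorm ip (p (w m) - p (w k)) < e" if mk: "m \<ge> N" "k \<ge> N" for m k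
    proof (rule power2_less_imp_less)
      have le: "1 / real (Suc i) \<le> inverse (real (Suc N))" if "i \<ge> N" for i
        using that unfolding inverse_eq_divide by (intro divide_left_mono) auto
      show "(hnorm ip (p (w m) - p (w k)))\<^sup>2 < e\<^sup>2"
      proof -
        have "J (w m) - I < e\<^sup>2 / 4" "J (w k) - I < e\<^sup>2 / 4"
          using Jw[of m] Jw[of k] N le[OF mk(1)] le[OF mk(2)] by argo+
        then have "2 * (J (w m) - I) + 2 * (J (w k) - I) < 2 * (e\<^sup>2 / 4) + 2 * (e\<^sup>2 / 4)"
          by (intro add_strict_mono) auto
        then have "2 * (J (w m) - I) + 2 * (J (w k) - I) < e\<^sup>2" by simp
        with par[OF w[of m] w[of k]] show ?thesis by (rule le_less_trans)
      qed
    qed (use e in simp)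
    then show ?thesis by blast
  qed
  obtain g where g: "g \<in> H" and lim: "(\<lambda>k. hnorm ip (p (w k) - g)) \<longlonglongrightarrow> 0"
    using complete[of "\<lambda>k. p (w k)"] cauchy p[OF w] by blast
  have eq: "ip (p v) g = t v" if v: "v \<in> W" for v
  proof -
    define e where "e = ip (p v) g - t v"
    \<comment> \<open>First variation of \<open>J\<close> in the direction \<open>v\<close>. The
      minimising sequence itself is perturbed, because the limit \<open>g\<close> need not have the
      form \<open>p w\<close>; the error \<open>1 / real (Suc k)\<close> disappears in the
      limit.\<close>
    have ineq: "0 \<le> (norm c)\<^sup>2 * (hnorm ip (p v))\<^sup>2 + 2 * Re (c * e)" for c
    proof -
      have step: "- (1 / real (Suc k)) \<le> (norm c)\<^sup>2 * (hnorm ip (p v))\<^sup>2 + 2 * Re (c * (ip (p v) (p (w k)) - t v))" for k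
      proof -
        have m: "cscale c v + w k \<in> W" using v w W by (auto intro: csubspace_add csubspace_scale)
        have "p (cscale c v + w k) = cscale c (p v) + p (w k)"
          using v w W by (simp add: p_add p_scale csubspace_scale)
        then have "(hnorm ip (p (cscale c v + w k)))\<^sup>2 =
            (norm c)\<^sup>2 * (hnorm ip (p v))\<^sup>2 + 2 * Re (c * ip (p v) (p (w k))) + (hnorm ip (p (w k)))\<^sup>2"
          using v w by (simp only: hnorm_add_sq p mem hnorm_scale ip_scale_left power_mult_distrib)
        moreover have "t (cscale c v + w k) = c * t v + t (w k)"
          using v w W by (simp add: t_add t_scale csubspace_scale)
        ultimately show ?thesis
          using I_le[OF m] Jw[of k] by (simp add: J_def algebra_simps)
      qed
      have "(\<lambda>k. ip (p v) (p (w k))) \<longlonglongrightarrow> ip (p v) g"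
        by (rule tendsto_ip_right) (use p w v g lim in auto)
      then have "(\<lambda>k. (norm c)\<^sup>2 * (hnorm ip (p v))\<^sup>2 + 2 * Re (c * (ip (p v) (p (w k)) - t v)))
          \<longlonglongrightarrow> (norm c)\<^sup>2 * (hnorm ip (p v))\<^sup>2 + 2 * Re (c * e)"
        unfolding e_def by (intro tendsto_intros)
      moreover have "(\<lambda>k. - (1 / real (Suc k))) \<longlonglongrightarrow> 0"
        using tendsto_minus[OF LIMSEQ_Suc[OF lim_1_over_n]] by simp
      ultimately show ?thesis
        by (rule tendsto_le[OF sequentially_bot]) (use step in auto)
    qed
    have "e = 0"
    proof (rule ccontr)
      assume "e \<noteq> 0"
      \<comment> \<open>The test value \<open>c = - cnj e / b\<close> makes the right side of
        \<open>ineq\<close> negative. Adding 1 keeps \<open>b\<close> positive even if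
        \<open>p v\<close> is zero.\<close>
      define b where "b = (hnorm ip (p v))\<^sup>2 + 1"
      have b: "b > 0" by (simp add: b_def add_nonneg_pos)
      have "- of_real (1 / b) * cnj e * e = of_real (- (norm e)\<^sup>2 / b)"
        using complex_norm_square[of e] by (simp add: field_simps)
      then have "Re (- of_real (1 / b) * cnj e * e) = - (norm e)\<^sup>2 / b"
        by (simp only: Re_complex_of_real)
      moreover have "(norm (- of_real (1 / b) * cnj e))\<^sup>2 = (norm e)\<^sup>2 / b\<^sup>2"
        by (simp add: norm_mult power_divide norm_divide)
      ultimately have "0 \<le> (norm e)\<^sup>2 / b\<^sup>2 * (b - 1) + 2 * (- (norm e)\<^sup>2 / b)"
        using ineq[of "- of_real (1 / b) * cnj e"] unfolding b_def by (simp only:) simp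
      then have "0 \<le> b\<^sup>2 * ((norm e)\<^sup>2 / b\<^sup>2 * (b - 1) + 2 * (- (norm e)\<^sup>2 / b))"
        using b by simp
      also have "\<dots> = (norm e)\<^sup>2 * (- b - 1)"
        using b by (simp add: field_simps power2_eq_square)
      also have "\<dots> < 0"
        using b \<open>e \<noteq> 0\<close> by (intro mult_pos_neg) auto
      finally show False by simp
    qed
    then show ?thesis by (simp add: e_def)
  qed
  have appr: "\<exists>w\<in>W. hnorm ip (p w - g) < \<epsilon>" if "\<epsilon> > 0" for \<epsilon>
    using order_tendstoD(2)[OF lim that] w by (auto simp: eventually_sequentially)
  \<comment> \<open>The squared norm of \<open>g\<close> is the limit of
    \<open>ip g (p (w k))\<close>, whose modulus is that of \<open>t (w k)\<close>. The absolute
    value is taken because \<open>bound\<close> allows a negative \<open>C\<close> when every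
    \<open>p w\<close> is zero.\<close>
  have "(hnorm ip g)\<^sup>2 \<le> \<bar>C\<bar> * hnorm ip g"
  proof -
    have l1: "(\<lambda>k. ip g (p (w k))) \<longlonglongrightarrow> ip g g"
      by (rule tendsto_ip_right) (use p w g lim in auto)
    have l2: "(\<lambda>k. \<bar>C\<bar> * (hnorm ip g + hnorm ip (p (w k) - g))) \<longlonglongrightarrow> \<bar>C\<bar> * (hnorm ip g + 0)"
      using lim by (intro tendsto_intros)
    have "norm (ip g g) \<le> \<bar>C\<bar> * (hnorm ip g + 0)"
    proof (rule tendsto_le[OF sequentially_bot l2 tendsto_norm[OF l1]], rule always_eventually, rule allI)
      fix k
      have "norm (ip g (p (w k))) = norm (t (w k))"
        using herm[of "p (w k)" g] p[OF w[of k]] g eq[OF w[of k]] by simp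
      also have "\<dots> \<le> C * hnorm ip (p (w k))" by (rule bound[OF w])
      also have "\<dots> \<le> \<bar>C\<bar> * hnorm ip (p (w k))"
        using p[OF w[of k]] by (intro mult_right_mono) auto
      also have "\<dots> \<le> \<bar>C\<bar> * (hnorm ip g + hnorm ip (p (w k) - g))"
        using hnorm_triangle[of "p (w k) - g" g] p[OF w[of k]] g by (intro mult_left_mono) (auto simp: mem)
      finally show "norm (ip g (p (w k))) \<le> \<bar>C\<bar> * (hnorm ip g + hnorm ip (p (w k) - g))" .
    qed
    then show ?thesis using g by (simp add: ip_self norm_power)
  qed
  then have "hnorm ip g \<le> \<bar>C\<bar>"
    using g by (cases "hnorm ip g = 0") (auto simp: power2_eq_square dest: mult_right_le_imp_le)
  with g eq appr show ?thesis using that by blast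
qed

text \<open>Riesz' theorem for the functional \<open>\<lambda>u. ip' (T u) y\<close>. It gives the
  definite description in \<open>adjoint\<close> a meaning.\<close>

lemma adjoint_exists:
  assumes "hilbert_space H' ip'" and T: "bounded_op H ip H' ip' T" and y: "y \<in> H'"
  shows "adjoint H ip H' ip' T y \<in> H"
    and "u \<in> H \<Longrightarrow> ip' (T u) y = ip u (adjoint H ip H' ip' T y)"
proof -
  interpret h': hilbert H' ip' using assms(1) by (simp add: hilbert_space_iff)
  obtain C where C: "\<And>x. x \<in> H \<Longrightarrow> hnorm ip' (T x) \<le> C * hnorm ip x"
    using T unfolding bounded_op_def by blast
  have TH: "T x \<in> H'" if "x \<in> H" for x using T that by (auto simp: bounded_op_def)
  obtain g where g: "g \<in> H" and eq: "\<And>u. u \<in> H \<Longrightarrow> ip u g = ip' (T u) y"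
  proof (rule functional_representation[OF sub, of "\<lambda>x. x" "\<lambda>u. ip' (T u) y" "C * hnorm ip' y"])
    fix w assume w: "w \<in> H"
    have "norm (ip' (T w) y) \<le> hnorm ip' (T w) * hnorm ip' y"
      by (rule h'.cauchy_schwarz) (use TH w y in auto)
    also have "\<dots> \<le> C * hnorm ip w * hnorm ip' y"
      using C[OF w] y by (intro mult_right_mono) auto
    finally show "norm (ip' (T w) y) \<le> C * hnorm ip' y * hnorm ip w" by (simp add: algebra_simps)
  qed (use T y in \<open>auto simp: bounded_op_def h'.ip_add_left h'.ip_scale_left\<close>)
  have "adjoint H ip H' ip' T y = g"
    unfolding adjoint_def by (rule the_equality) (use g eq eqI_right in auto)
  then show "adjoint H ip H' ip' T y \<in> H"
    and "u \<in> H \<Longrightarrow> ip' (T u) y = ip u (adjoint H ip H' ip' T y)"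
    using g eq by auto
qed

end

section \<open>Reproducing kernel spaces of operator-valued kernels\<close>

definition supp :: "('x \<Rightarrow> 'e::zero) \<Rightarrow> 'x set" where
  "supp \<phi> = {z. \<phi> z \<noteq> 0}"

text \<open>The coefficient families of finite combinations of kernel functions. Working with
  coefficients instead of the combinations makes linear maps well defined even when the kernel
  functions are linearly dependent.\<close>

definition Fin :: "'x set \<Rightarrow> 'e::cvec set \<Rightarrow> ('x \<Rightarrow> 'e) set" where
  "Fin X E = {\<phi>. finite (supp \<phi>) \<and> supp \<phi> \<subseteq> X \<and> (\<forall>z. \<phi> z \<in> E)}"

definition fsum :: "('x \<Rightarrow> 'e::zero \<Rightarrow> 'b::comm_monoid_add) \<Rightarrow> ('x \<Rightarrow> 'e) \<Rightarrow> 'b" where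
  "fsum g \<phi> = (\<Sum>z\<in>supp \<phi>. g z (\<phi> z))"

definition delta :: "'x \<Rightarrow> 'e::zero \<Rightarrow> 'x \<Rightarrow> 'e" where
  "delta z e = (\<lambda>x. if x = z then e else 0)"

lemma csubspace_Fin:
  assumes "csubspace E" shows "csubspace (Fin X E)"
  unfolding csubspace_def
proof (intro conjI ballI allI)
  show "0 \<in> Fin X E"
    using assms by (simp add: Fin_def supp_def csubspace_zero)
next
  fix \<phi> \<psi> assume "\<phi> \<in> Fin X E" "\<psi> \<in> Fin X E"
  moreover have "supp (\<phi> + \<psi>) \<subseteq> supp \<phi> \<union> supp \<psi>" by (auto simp: supp_def)
  ultimately show "\<phi> + \<psi> \<in> Fin X E"
    using assms by (auto simp: Fin_def csubspace_add intro: finite_subset)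
next
  fix a \<phi> assume "\<phi> \<in> Fin X E"
  moreover have "supp (cscale a \<phi>) \<subseteq> supp \<phi>" by (auto simp: supp_def cscale_fun_def)
  ultimately show "cscale a \<phi> \<in> Fin X E"
    using assms by (auto simp: Fin_def csubspace_scale cscale_fun_def intro: finite_subset)
qed

lemma delta_Fin: "csubspace E \<Longrightarrow> z \<in> X \<Longrightarrow> e \<in> E \<Longrightarrow> delta z e \<in> Fin X E"
proof -
  assume "csubspace E" "z \<in> X" "e \<in> E"
  moreover have "supp (delta z e) \<subseteq> {z}" by (auto simp: supp_def delta_def)
  ultimately show ?thesis
    using csubspace_zero[of E] finite_subset by (auto simp: Fin_def delta_def)
qed

lemma fsum_superset:
  assumes "finite A" "supp \<phi> \<subseteq> A" "\<And>z. z \<in> A \<Longrightarrow> g z 0 = 0"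
  shows "fsum g \<phi> = (\<Sum>z\<in>A. g z (\<phi> z))"
  unfolding fsum_def
  by (rule sum.mono_neutral_left) (use assms in \<open>auto simp: supp_def\<close>)

lemma fsum_delta: "g z 0 = 0 \<Longrightarrow> fsum g (delta z e) = g z e"
  by (subst fsum_superset[of "{z}"]) (auto simp: supp_def delta_def)

lemma fsum_add:
  fixes g :: "'x \<Rightarrow> 'e::cvec \<Rightarrow> 'b::ab_group_add"
  assumes E: "csubspace E" and \<phi>: "\<phi> \<in> Fin X E" "\<psi> \<in> Fin X E"
    and g: "\<And>z e e'. z \<in> X \<Longrightarrow> e \<in> E \<Longrightarrow> e' \<in> E \<Longrightarrow> g z (e + e') = g z e + g z e'"
  shows "fsum g (\<phi> + \<psi>) = fsum g \<phi> + fsum g \<psi>"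
proof -
  let ?A = "supp \<phi> \<union> supp \<psi>"
  have A: "finite ?A" "?A \<subseteq> X" using \<phi> by (auto simp: Fin_def)
  have g0: "g z 0 = 0" if "z \<in> ?A" for z
    using g[of z 0 0] that A csubspace_zero[OF E] by auto
  have "fsum g (\<phi> + \<psi>) = (\<Sum>z\<in>?A. g z ((\<phi> + \<psi>) z))"
    by (rule fsum_superset) (use A g0 in \<open>auto simp: supp_def\<close>)
  also have "\<dots> = (\<Sum>z\<in>?A. g z (\<phi> z) + g z (\<psi> z))"
    by (rule sum.cong) (use A \<phi> g in \<open>auto simp: Fin_def\<close>)
  also have "\<dots> = (\<Sum>z\<in>?A. g z (\<phi> z)) + (\<Sum>z\<in>?A. g z (\<psi> z))"
    by (rule sum.distrib)
  also have "(\<Sum>z\<in>?A. g z (\<phi> z)) = fsum g \<phi>"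
    by (rule fsum_superset[symmetric]) (use A g0 in auto)
  also have "(\<Sum>z\<in>?A. g z (\<psi> z)) = fsum g \<psi>"
    by (rule fsum_superset[symmetric]) (use A g0 in auto)
  finally show ?thesis .
qed

lemma fsum_scale:
  fixes g :: "'x \<Rightarrow> 'e::cvec \<Rightarrow> 'b::ab_group_add"
  assumes E: "csubspace E" and \<phi>: "\<phi> \<in> Fin X E"
    and g: "\<And>z e. z \<in> X \<Longrightarrow> e \<in> E \<Longrightarrow> g z (cscale a e) = h (g z e)"
    and g0: "\<And>z. z \<in> X \<Longrightarrow> g z 0 = 0"
    and h: "h 0 = 0" "\<And>x y. h (x + y) = h x + h y"
  shows "fsum g (cscale a \<phi>) = h (fsum g \<phi>)"
proof -
  have A: "finite (supp \<phi>)" "supp \<phi> \<subseteq> X" using \<phi> by (auto simp: Fin_def)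
  have h_sum: "h (sum f B) = (\<Sum>z\<in>B. h (f z))" for f :: "'x \<Rightarrow> 'b" and B
    by (induction B rule: infinite_finite_induct) (auto simp: h)
  have "fsum g (cscale a \<phi>) = (\<Sum>z\<in>supp \<phi>. g z ((cscale a \<phi>) z))"
    by (rule fsum_superset) (use A g0 in \<open>auto simp: supp_def cscale_fun_def\<close>)
  also have "\<dots> = (\<Sum>z\<in>supp \<phi>. h (g z (\<phi> z)))"
    by (rule sum.cong) (use A \<phi> g in \<open>auto simp: Fin_def cscale_fun_def\<close>)
  finally show ?thesis by (simp add: fsum_def h_sum)
qed

lemma fsum_in:
  assumes "csubspace V" "\<phi> \<in> Fin X E" "\<And>z e. z \<in> X \<Longrightarrow> e \<in> E \<Longrightarrow> g z e \<in> V"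
  shows "fsum g \<phi> \<in> V"
  unfolding fsum_def by (rule csubspace_sum[OF assms(1)]) (use assms(2,3) in \<open>auto simp: Fin_def\<close>)

section \<open>Cauchy sequences in a semi-inner product space\<close>

context semi_inner
begin

definition cau :: "(nat \<Rightarrow> 'a) \<Rightarrow> bool" where
  "cau u \<longleftrightarrow> (\<forall>n. u n \<in> H) \<and> (\<forall>\<epsilon>>0. \<exists>N. \<forall>m\<ge>N. \<forall>n\<ge>N. hnorm ip (u m - u n) < \<epsilon>)"

lemma cau_mem: "cau u \<Longrightarrow> u n \<in> H"
  by (simp add: cau_def)

lemma cauD: "cau u \<Longrightarrow> \<epsilon> > 0 \<Longrightarrow> \<exists>N. \<forall>m\<ge>N. \<forall>n\<ge>N. hnorm ip (u m - u n) < \<epsilon>"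
  by (simp add: cau_def)

lemma cau_const: "x \<in> H \<Longrightarrow> cau (\<lambda>_. x)"
  by (simp add: cau_def hnorm_zero)

lemma cau_add:
  assumes u: "cau u" and v: "cau v" shows "cau (\<lambda>n. u n + v n)"
  unfolding cau_def
proof (intro conjI allI impI)
  show "u n + v n \<in> H" for n using assms by (simp add: cau_mem mem)
  fix \<epsilon> :: real assume e: "\<epsilon> > 0"
  obtain M N where M: "\<And>m n. m \<ge> M \<Longrightarrow> n \<ge> M \<Longrightarrow> hnorm ip (u m - u n) < \<epsilon> / 2"
    and N: "\<And>m n. m \<ge> N \<Longrightarrow> n \<ge> N \<Longrightarrow> hnorm ip (v m - v n) < \<epsilon> / 2"
    using cauD[OF u, of "\<epsilon> / 2"] cauD[OF v, of "\<epsilon> / 2"] e by (metis half_gt_zero)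
  have "hnorm ip (u m + v m - (u n + v n)) < \<epsilon>" if "m \<ge> max M N" "n \<ge> max M N" for m n
  proof -
    have "u m + v m - (u n + v n) = (u m - u n) + (v m - v n)" by simp
    then have "hnorm ip (u m + v m - (u n + v n)) \<le> hnorm ip (u m - u n) + hnorm ip (v m - v n)"
      using hnorm_triangle[of "u m - u n" "v m - v n"] assms by (simp only: cau_mem mem)
    also have "\<dots> < \<epsilon>" using M[of m n] N[of m n] that by simp
    finally show ?thesis .
  qed
  then show "\<exists>N. \<forall>m\<ge>N. \<forall>n\<ge>N. hnorm ip (u m + v m - (u n + v n)) < \<epsilon>" by blast
qed

lemma cau_scale:
  assumes u: "cau u" shows "cau (\<lambda>n. cscale a (u n))"
  unfolding cau_def
proof (intro conjI allI impI)
  show "cscale a (u n) \<in> H" for n using assms by (simp add: cau_mem mem)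
  fix \<epsilon> :: real assume e: "\<epsilon> > 0"
  obtain N where N: "\<And>m n. m \<ge> N \<Longrightarrow> n \<ge> N \<Longrightarrow> hnorm ip (u m - u n) < \<epsilon> / (norm a + 1)"
    using cauD[OF u, of "\<epsilon> / (norm a + 1)"] e
    by (metis add_nonneg_pos divide_pos_pos norm_ge_zero zero_less_one)
  have "hnorm ip (cscale a (u m) - cscale a (u n)) < \<epsilon>" if "m \<ge> N" "n \<ge> N" for m n
  proof -
    have "hnorm ip (cscale a (u m) - cscale a (u n)) = norm a * hnorm ip (u m - u n)"
      using assms by (simp add: hnorm_scale cau_mem mem flip: cv.scale_right_diff_distrib)
    also have "\<dots> \<le> (norm a + 1) * hnorm ip (u m - u n)"
      using assms by (intro mult_right_mono) (auto simp: cau_mem mem)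
    also have "\<dots> < (norm a + 1) * (\<epsilon> / (norm a + 1))"
      using N[OF that] by (intro mult_strict_left_mono) (auto simp: add_nonneg_pos)
    also have "\<dots> = \<epsilon>"
      using norm_ge_zero[of a] by (simp add: add_nonneg_eq_0_iff)
    finally show ?thesis .
  qed
  then show "\<exists>N. \<forall>m\<ge>N. \<forall>n\<ge>N. hnorm ip (cscale a (u m) - cscale a (u n)) < \<epsilon>" by blast
qed

lemma cau_bounded:
  assumes u: "cau u"
  obtains C where "C > 0" "\<And>n. hnorm ip (u n) \<le> C"
proof -
  obtain N where N: "\<And>m n. m \<ge> N \<Longrightarrow> n \<ge> N \<Longrightarrow> hnorm ip (u m - u n) < 1"
    using cauD[OF u, of 1] by auto
  define C where "C = Max ((\<lambda>n. hnorm ip (u n)) ` {..N}) + 1"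
  have C: "hnorm ip (u n) \<le> C - 1" if "n \<le> N" for n
    unfolding C_def using that by simp
  have "hnorm ip (u n) \<le> C" for n
  proof (cases "n \<le> N")
    case False
    have "hnorm ip (u n) \<le> hnorm ip (u n - u N) + hnorm ip (u N)"
      using hnorm_triangle[of "u n - u N" "u N"] u by (simp add: cau_mem mem)
    then show ?thesis using N[of n N] C[of N] False by simp
  qed (use C[of n] in simp)
  moreover have "C > 0" using C[of 0] hnorm_ge_0[OF cau_mem[OF u], of 0] by simp
  ultimately show thesis using that by blast
qed

lemma cau_ip_convergent:
  assumes u: "cau u" and v: "cau v"
  shows "convergent (\<lambda>n. ip (u n) (v n))"
proof -
  obtain C D where C: "C > 0" "\<And>n. hnorm ip (u n) \<le> C" and D: "D > 0" "\<And>n. hnorm ip (v n) \<le> D"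
    using cau_bounded[OF u] cau_bounded[OF v] by metis
  have "Cauchy (\<lambda>n. ip (u n) (v n))"
  proof (rule CauchyI)
    fix \<epsilon> :: real assume e: "\<epsilon> > 0"
    obtain M where M: "\<And>m n. m \<ge> M \<Longrightarrow> n \<ge> M \<Longrightarrow> hnorm ip (u m - u n) < \<epsilon> / (2 * D)"
      using cauD[OF u, of "\<epsilon> / (2 * D)"] e D(1) by auto
    obtain N where N: "\<And>m n. m \<ge> N \<Longrightarrow> n \<ge> N \<Longrightarrow> hnorm ip (v m - v n) < \<epsilon> / (2 * C)"
      using cauD[OF v, of "\<epsilon> / (2 * C)"] e C(1) by auto
    have "norm (ip (u m) (v m) - ip (u n) (v n)) < \<epsilon>" if "m \<ge> max M N" "n \<ge> max M N" for m n
    proof -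
      have "ip (u m) (v m) - ip (u n) (v n) = ip (u m - u n) (v m) + ip (u n) (v m - v n)"
        using u v by (simp add: ip_diff_left ip_diff_right cau_mem mem)
      then have "norm (ip (u m) (v m) - ip (u n) (v n))
          \<le> norm (ip (u m - u n) (v m)) + norm (ip (u n) (v m - v n))"
        by (simp add: norm_triangle_ineq)
      also have "\<dots> \<le> hnorm ip (u m - u n) * hnorm ip (v m) + hnorm ip (u n) * hnorm ip (v m - v n)"
        using u v by (intro add_mono cauchy_schwarz) (auto simp: cau_mem mem)
      also have "\<dots> \<le> hnorm ip (u m - u n) * D + C * hnorm ip (v m - v n)"
        using u v C D by (intro add_mono mult_mono) (auto simp: cau_mem mem)
      also have "\<dots> < \<epsilon> / (2 * D) * D + C * (\<epsilon> / (2 * C))"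
        using M[of m n] N[of m n] that C(1) D(1)
        by (intro add_strict_mono mult_strict_left_mono mult_strict_right_mono) auto
      also have "\<dots> = \<epsilon>" using C(1) D(1) by (simp add: field_simps)
      finally show ?thesis .
    qed
    then show "\<exists>M. \<forall>m\<ge>M. \<forall>n\<ge>M. norm (ip (u m) (v m) - ip (u n) (v n)) < \<epsilon>" by blast
  qed
  then show ?thesis by (simp add: Cauchy_convergent_iff)
qed

lemma tendsto_0_ip_left:
  assumes u: "\<And>n. u n \<in> H" "(\<lambda>n. hnorm ip (u n)) \<longlonglongrightarrow> 0" and v: "cau v"
  shows "(\<lambda>n. ip (u n) (v n)) \<longlonglongrightarrow> 0"
proof -
  obtain D where D: "\<And>n. hnorm ip (v n) \<le> D"
    using cau_bounded[OF v] by metis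
  have "(\<lambda>n. hnorm ip (u n) * D) \<longlonglongrightarrow> 0"
    using tendsto_mult_left_zero[OF u(2)] .
  moreover have "norm (ip (u n) (v n)) \<le> hnorm ip (u n) * D" for n
  proof -
    have "norm (ip (u n) (v n)) \<le> hnorm ip (u n) * hnorm ip (v n)"
      using u v by (intro cauchy_schwarz) (auto simp: cau_mem)
    also have "\<dots> \<le> hnorm ip (u n) * D" using D u by (intro mult_left_mono) auto
    finally show ?thesis .
  qed
  ultimately show ?thesis
    by (intro Lim_null_comparison[of "\<lambda>n. ip (u n) (v n)"] always_eventually) auto
qed

lemma tendsto_0_ip_right:
  assumes u: "\<And>n. u n \<in> H" "(\<lambda>n. hnorm ip (u n)) \<longlonglongrightarrow> 0" and v: "cau v"
  shows "(\<lambda>n. ip (v n) (u n)) \<longlonglongrightarrow> 0"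
proof -
  have "(\<lambda>n. cnj (ip (u n) (v n))) \<longlonglongrightarrow> cnj 0"
    by (intro tendsto_intros tendsto_0_ip_left assms)
  moreover have "cnj (ip (u n) (v n)) = ip (v n) (u n)" for n
    using herm[of "u n" "v n"] u v by (simp add: cau_mem)
  ultimately show ?thesis by simp
qed

text \<open>A Cauchy sequence is almost constant: in
  \<open>ip (u n) (u n) = ip (u n) (u N) + ip (u n) (u n - u N)\<close> the first term vanishes by
  weak convergence, and the second is small by boundedness and the choice of \<open>N\<close>. This
  is what makes a completion a space of functions: an element that vanishes at every point has norm
  zero.\<close>

lemma cau_weak_null:
  assumes u: "cau u" and null: "\<And>x. x \<in> H \<Longrightarrow> (\<lambda>n. ip (u n) x) \<longlonglongrightarrow> 0"
  shows "(\<lambda>n. hnorm ip (u n)) \<longlonglongrightarrow> 0"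
proof (rule LIMSEQ_I)
  fix r :: real assume r: "r > 0"
  obtain C where C: "C > 0" "\<And>n. hnorm ip (u n) \<le> C" using cau_bounded[OF u] by metis
  define e where "e = r\<^sup>2 / 2"
  have e: "e > 0" using r by (simp add: e_def)
  obtain N where N: "\<And>m n. m \<ge> N \<Longrightarrow> n \<ge> N \<Longrightarrow> hnorm ip (u m - u n) < e / C"
    using cauD[OF u, of "e / C"] e C(1) by auto
  obtain M where M: "\<And>n. n \<ge> M \<Longrightarrow> norm (ip (u n) (u N)) < e"
    using LIMSEQ_D[OF null[OF cau_mem[OF u, of N]] e] by auto
  have "norm (hnorm ip (u n) - 0) < r" if n: "n \<ge> max M N" for n
  proof -
    have "ip (u n) (u n) = ip (u n) (u N) + ip (u n) (u n - u N)"
      using u by (simp add: ip_diff_right cau_mem mem)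
    then have "(hnorm ip (u n))\<^sup>2 = Re (ip (u n) (u N)) + Re (ip (u n) (u n - u N))"
      using hnorm_sq[OF cau_mem[OF u, of n]] by simp
    also have "\<dots> \<le> norm (ip (u n) (u N)) + norm (ip (u n) (u n - u N))"
      by (intro add_mono complex_Re_le_cmod)
    also have "norm (ip (u n) (u n - u N)) \<le> hnorm ip (u n) * hnorm ip (u n - u N)"
      using u by (intro cauchy_schwarz) (auto simp: cau_mem mem)
    also have "\<dots> \<le> C * hnorm ip (u n - u N)"
      using C(2) u by (intro mult_right_mono) (auto simp: cau_mem mem)
    also have "\<dots> \<le> C * (e / C)"
      using N[of n N] n C(1) by (intro mult_left_mono) auto
    also have "\<dots> = e" using C(1) by simp
    also have "norm (ip (u n) (u N)) + e < r\<^sup>2"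
      using M[of n] n by (simp add: e_def)
    finally have "(hnorm ip (u n))\<^sup>2 < r\<^sup>2" by simp
    then have "hnorm ip (u n) < r" by (rule power2_less_imp_less) (use r in simp)
    then show ?thesis using u by (simp add: cau_mem)
  qed
  then show "\<exists>no. \<forall>n\<ge>no. norm (hnorm ip (u n) - 0) < r" by blast
qed

end

text \<open>Boundedness of the operators is required only on the diagonal and as a quadratic form;
  with positivity this already bounds evaluation at each point, see \<open>J_bound\<close>.\<close>

locale op_kernel = E: hilbert E ipE
  for E :: "'e::cvec set" and ipE +
  fixes X :: "'x set" and k :: "'x \<Rightarrow> 'x \<Rightarrow> 'e \<Rightarrow> 'e"
  assumes k_in: "z \<in> X \<Longrightarrow> w \<in> X \<Longrightarrow> e \<in> E \<Longrightarrow> k z w e \<in> E"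
    and k_add: "z \<in> X \<Longrightarrow> w \<in> X \<Longrightarrow> e \<in> E \<Longrightarrow> e' \<in> E \<Longrightarrow> k z w (e + e') = k z w e + k z w e'"
    and k_scale: "z \<in> X \<Longrightarrow> w \<in> X \<Longrightarrow> e \<in> E \<Longrightarrow> k z w (cscale a e) = cscale a (k z w e)"
    and k_herm: "z \<in> X \<Longrightarrow> w \<in> X \<Longrightarrow> e \<in> E \<Longrightarrow> e' \<in> E \<Longrightarrow> ipE (k z w e) e' = ipE e (k w z e')"
    and k_psd: "\<phi> \<in> Fin X E \<Longrightarrow> 0 \<le> Re (fsum (\<lambda>z. ipE (fsum (k z) \<phi>)) \<phi>)"
    and k_bound: "z \<in> X \<Longrightarrow> \<exists>M. \<forall>e\<in>E. Re (ipE (k z z e) e) \<le> M * (hnorm ipE e)\<^sup>2"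
begin

definition J :: "('x \<Rightarrow> 'e) \<Rightarrow> 'x \<Rightarrow> 'e" where
  "J \<phi> = (\<lambda>z. if z \<in> X then fsum (k z) \<phi> else 0)"

text \<open>The inner product that \<open>J \<phi>\<close> and \<open>J \<psi>\<close> are to have
  in the space under construction. It may be degenerate on coefficients.\<close>

definition B :: "('x \<Rightarrow> 'e) \<Rightarrow> ('x \<Rightarrow> 'e) \<Rightarrow> complex" where
  "B \<phi> \<psi> = fsum (\<lambda>z. ipE (J \<phi> z)) \<psi>"

lemma k_zero: "z \<in> X \<Longrightarrow> w \<in> X \<Longrightarrow> k z w 0 = 0"
  using k_scale[of z w 0 0] E.mem by simp

lemma J_in: "\<phi> \<in> Fin X E \<Longrightarrow> J \<phi> z \<in> E"
  unfolding J_def using fsum_in[OF E.sub, of \<phi> X E "k z"] k_in E.mem(1) by auto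

lemma J_add: "\<phi> \<in> Fin X E \<Longrightarrow> \<psi> \<in> Fin X E \<Longrightarrow> J (\<phi> + \<psi>) z = J \<phi> z + J \<psi> z"
  unfolding J_def using fsum_add[OF E.sub, of \<phi> X \<psi> "k z"] k_add by auto

lemma J_scale: "\<phi> \<in> Fin X E \<Longrightarrow> J (cscale a \<phi>) z = cscale a (J \<phi> z)"
  unfolding J_def using fsum_scale[OF E.sub, of \<phi> X "k z" a "cscale a"] k_scale k_zero
  by (auto simp: cv.scale_right_distrib)

lemma J_delta: "w \<in> X \<Longrightarrow> z \<in> X \<Longrightarrow> J (delta w e) z = k z w e"
  unfolding J_def by (simp add: fsum_delta k_zero)

lemma B_delta: "\<phi> \<in> Fin X E \<Longrightarrow> B \<phi> (delta z e) = ipE (J \<phi> z) e"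
  unfolding B_def by (rule fsum_delta) (simp add: E.ip_zero_right J_in)

lemma B_semi_inner: "semi_inner (Fin X E) B"
proof
  show "csubspace (Fin X E)" by (rule csubspace_Fin[OF E.sub])
  show "B (x + y) z = B x z + B y z" if "x \<in> Fin X E" "y \<in> Fin X E" "z \<in> Fin X E" for x y z
  proof -
    have "B (x + y) z = (\<Sum>w\<in>supp z. ipE (J x w) (z w) + ipE (J y w) (z w))"
      unfolding B_def fsum_def
      by (rule sum.cong) (use that in \<open>auto simp: J_add E.ip_add_left J_in Fin_def[of X E]\<close>)
    then show ?thesis by (simp add: B_def fsum_def sum.distrib)
  qed
  show "B (cscale a x) y = a * B x y" if "x \<in> Fin X E" "y \<in> Fin X E" for x y a
  proof -
    have "B (cscale a x) y = (\<Sum>w\<in>supp y. a * ipE (J x w) (y w))"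
      unfolding B_def fsum_def
      by (rule sum.cong) (use that in \<open>auto simp: J_scale E.ip_scale_left J_in Fin_def[of X E]\<close>)
    then show ?thesis by (simp add: B_def fsum_def sum_distrib_left)
  qed
  have B_eq: "B x y = (\<Sum>z\<in>supp y. \<Sum>w\<in>supp x. ipE (k z w (x w)) (y z))"
    if "x \<in> Fin X E" "y \<in> Fin X E" for x y
    unfolding B_def fsum_def
  proof (rule sum.cong)
    fix z assume "z \<in> supp y"
    with that have z: "z \<in> X" "y z \<in> E" and x: "\<And>w. w \<in> supp x \<Longrightarrow> w \<in> X" "\<And>w. x w \<in> E"
      by (auto simp: Fin_def)
    show "ipE (J x z) (y z) = (\<Sum>w\<in>supp x. ipE (k z w (x w)) (y z))"
      using z x by (simp add: J_def fsum_def E.ip_sum_left k_in)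
  qed simp
  show "B y x = cnj (B x y)" if xy: "x \<in> Fin X E" "y \<in> Fin X E" for x y
  proof -
    have "B y x = (\<Sum>w\<in>supp y. \<Sum>z\<in>supp x. ipE (k z w (y w)) (x z))"
      unfolding B_eq[OF xy(2,1)] by (rule sum.swap)
    also have "\<dots> = (\<Sum>w\<in>supp y. \<Sum>z\<in>supp x. cnj (ipE (k w z (x z)) (y w)))"
    proof (intro sum.cong refl)
      fix w z assume "w \<in> supp y" "z \<in> supp x"
      with xy have *: "w \<in> X" "z \<in> X" "y w \<in> E" "x z \<in> E" by (auto simp: Fin_def)
      show "ipE (k z w (y w)) (x z) = cnj (ipE (k w z (x z)) (y w))"
        using * by (simp add: k_herm E.herm[of "k w z (x z)"] k_in)
    qed
    finally show ?thesis by (simp add: B_eq[OF xy])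
  qed
  show "0 \<le> Re (B x x)" if "x \<in> Fin X E" for x
  proof -
    have "B x x = fsum (\<lambda>z. ipE (fsum (k z) x)) x"
      unfolding B_def fsum_def[of _ x] by (rule sum.cong) (use that in \<open>auto simp: J_def fsum_def Fin_def\<close>)
    then show ?thesis using k_psd[OF that] by simp
  qed
qed

sublocale F: semi_inner "Fin X E" B
  by (rule B_semi_inner)

lemma delta_in: "z \<in> X \<Longrightarrow> e \<in> E \<Longrightarrow> delta z e \<in> Fin X E"
  by (rule delta_Fin[OF E.sub])

text \<open>Pair \<open>\<phi>\<close> with the point mass at \<open>z\<close> carrying the value
  \<open>J \<phi> z\<close> itself: \<open>B\<close> then returns the squared norm of that value,
  and Cauchy-Schwarz leaves one factor to cancel.\<close>

lemma J_bound:
  assumes z: "z \<in> X"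
  obtains M where "M > 0" "\<And>\<phi>. \<phi> \<in> Fin X E \<Longrightarrow> hnorm ipE (J \<phi> z) \<le> M * hnorm B \<phi>"
proof -
  obtain M where M: "\<And>e. e \<in> E \<Longrightarrow> Re (ipE (k z z e) e) \<le> M * (hnorm ipE e)\<^sup>2"
    using k_bound[OF z] by blast
  \<comment> \<open>The summand 1 makes the constant strictly positive, so that it can serve as a
    divisor later.\<close>
  define C where "C = sqrt \<bar>M\<bar> + 1"
  have C: "C > 0" by (simp add: C_def add_nonneg_pos)
  have d: "hnorm B (delta z e) \<le> C * hnorm ipE e" if "e \<in> E" for e
  proof (rule power2_le_imp_le)
    have "(hnorm B (delta z e))\<^sup>2 \<le> M * (hnorm ipE e)\<^sup>2"
      using M[OF that] by (simp add: F.hnorm_sq delta_in that z B_delta J_delta)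
    also have "\<dots> \<le> (C * hnorm ipE e)\<^sup>2"
    proof -
      have "M \<le> (sqrt \<bar>M\<bar>)\<^sup>2" by simp
      also have "\<dots> \<le> C\<^sup>2" unfolding C_def by (intro power_mono) auto
      finally show ?thesis by (simp add: power_mult_distrib mult_right_mono)
    qed
    finally show "(hnorm B (delta z e))\<^sup>2 \<le> (C * hnorm ipE e)\<^sup>2" .
  qed (use C that in simp)
  have "hnorm ipE (J \<phi> z) \<le> C * hnorm B \<phi>" if \<phi>: "\<phi> \<in> Fin X E" for \<phi>
  proof (cases "hnorm ipE (J \<phi> z) = 0")
    case False
    then have pos: "hnorm ipE (J \<phi> z) > 0" using E.hnorm_ge_0[OF J_in[OF \<phi>], of z] by linarith
    have "(hnorm ipE (J \<phi> z))\<^sup>2 = Re (B \<phi> (delta z (J \<phi> z)))"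
      using \<phi> by (simp add: B_delta E.hnorm_sq J_in)
    also have "\<dots> \<le> hnorm B \<phi> * hnorm B (delta z (J \<phi> z))"
      using F.cauchy_schwarz[OF \<phi> delta_in[OF z J_in[OF \<phi>, of z]]] complex_Re_le_cmod order_trans by blast
    also have "\<dots> \<le> hnorm B \<phi> * (C * hnorm ipE (J \<phi> z))"
      using d[OF J_in[OF \<phi>]] \<phi> by (intro mult_left_mono) auto
    finally have "hnorm ipE (J \<phi> z) * hnorm ipE (J \<phi> z) \<le> (C * hnorm B \<phi>) * hnorm ipE (J \<phi> z)"
      by (simp add: power2_eq_square algebra_simps)
    then show ?thesis using pos by (rule mult_right_le_imp_le)
  qed (use C \<phi> in simp)
  with C show thesis using that by blast
qed

text \<open>The completion without equivalence classes: an element is a function, together with some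
  Cauchy sequence of coefficients whose functions converge to it weakly at each point.\<close>

definition rep :: "(nat \<Rightarrow> 'x \<Rightarrow> 'e) \<Rightarrow> ('x \<Rightarrow> 'e) \<Rightarrow> bool" where
  "rep u f \<longleftrightarrow> F.cau u \<and> (\<forall>z. (z \<in> X \<longrightarrow> f z \<in> E) \<and> (z \<notin> X \<longrightarrow> f z = 0)) \<and>
    (\<forall>z\<in>X. \<forall>e\<in>E. (\<lambda>n. ipE (J (u n) z) e) \<longlonglongrightarrow> ipE (f z) e)"

definition RK :: "('x \<Rightarrow> 'e) set" where
  "RK = {f. \<exists>u. rep u f}"

text \<open>The representing sequences are picked arbitrarily; \<open>ipRK_tendsto\<close> shows
  that the limit does not depend on them.\<close>

definition ipRK :: "('x \<Rightarrow> 'e) \<Rightarrow> ('x \<Rightarrow> 'e) \<Rightarrow> complex" where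
  "ipRK f g = lim (\<lambda>n. B ((SOME u. rep u f) n) ((SOME u. rep u g) n))"

lemma rep_cau: "rep u f \<Longrightarrow> F.cau u"
  by (simp add: rep_def)

lemma rep_tendsto: "rep u f \<Longrightarrow> z \<in> X \<Longrightarrow> e \<in> E \<Longrightarrow> (\<lambda>n. ipE (J (u n) z) e) \<longlonglongrightarrow> ipE (f z) e"
  by (simp add: rep_def)

lemma rep_range: "rep u f \<Longrightarrow> f z \<in> E" "rep u f \<Longrightarrow> z \<notin> X \<Longrightarrow> f z = 0"
  using E.mem(1) unfolding rep_def by metis+

lemma rep_add:
  assumes u: "rep u f" and v: "rep v g" shows "rep (\<lambda>n. u n + v n) (f + g)"
  unfolding rep_def
proof (intro conjI allI impI ballI)
  show "F.cau (\<lambda>n. u n + v n)" using assms by (simp add: F.cau_add rep_cau)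
  show "(f + g) z \<in> E" for z using u v by (simp add: E.mem rep_range)
  show "(f + g) z = 0" if "z \<notin> X" for z using u v that by (simp add: rep_range)
  fix z e assume ze: "z \<in> X" "e \<in> E"
  have "ipE (J (u n + v n) z) e = ipE (J (u n) z) e + ipE (J (v n) z) e" for n
    using u v ze by (simp add: rep_cau F.cau_mem J_add E.ip_add_left J_in)
  moreover have "ipE ((f + g) z) e = ipE (f z) e + ipE (g z) e"
    using u v ze by (simp add: E.ip_add_left rep_range)
  ultimately show "(\<lambda>n. ipE (J (u n + v n) z) e) \<longlonglongrightarrow> ipE ((f + g) z) e"
    using tendsto_add[OF rep_tendsto[OF u ze] rep_tendsto[OF v ze]] by simp
qed

lemma rep_scale:
  assumes u: "rep u f" shows "rep (\<lambda>n. cscale a (u n)) (cscale a f)"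
  unfolding rep_def
proof (intro conjI allI impI ballI)
  show "F.cau (\<lambda>n. cscale a (u n))" using assms by (simp add: F.cau_scale rep_cau)
  show "cscale a f z \<in> E" for z using u by (simp add: cscale_fun_def E.mem rep_range)
  show "cscale a f z = 0" if "z \<notin> X" for z using u that by (simp add: cscale_fun_def rep_range)
  fix z e assume ze: "z \<in> X" "e \<in> E"
  have "ipE (J (cscale a (u n)) z) e = a * ipE (J (u n) z) e" for n
    using u ze by (simp add: rep_cau F.cau_mem J_scale E.ip_scale_left J_in)
  moreover have "ipE (cscale a f z) e = a * ipE (f z) e"
    using u ze by (simp add: cscale_fun_def E.ip_scale_left rep_range)
  ultimately show "(\<lambda>n. ipE (J (cscale a (u n)) z) e) \<longlonglongrightarrow> ipE (cscale a f z) e"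
    using tendsto_mult_left[OF rep_tendsto[OF u ze], of a] by simp
qed

lemma rep_diff:
  assumes u: "rep u f" and v: "rep v g" shows "rep (\<lambda>n. u n - v n) (f - g)"
  using rep_add[OF u rep_scale[OF v, of "-1"]] by simp

lemma rep_const:
  assumes "\<phi> \<in> Fin X E" shows "rep (\<lambda>_. \<phi>) (J \<phi>)"
  unfolding rep_def using assms J_in[OF assms]
  by (auto simp: F.cau_const) (simp add: J_def)

lemma rep_weak:
  assumes u: "rep u f" and \<psi>: "\<psi> \<in> Fin X E"
  shows "(\<lambda>n. B (u n) \<psi>) \<longlonglongrightarrow> fsum (\<lambda>z. ipE (f z)) \<psi>"
  unfolding B_def fsum_def
  by (rule tendsto_sum, rule rep_tendsto[OF u]) (use \<psi> in \<open>auto simp: Fin_def\<close>)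

text \<open>The difference of the two sequences represents the zero function, so it is weakly null
  against every coefficient family, and \<open>cau_weak_null\<close> turns this into norm
  convergence.\<close>

lemma rep_unique:
  assumes u: "rep u f" and v: "rep v f"
  shows "(\<lambda>n. hnorm B (u n - v n)) \<longlonglongrightarrow> 0"
proof (rule F.cau_weak_null)
  have d: "rep (\<lambda>n. u n - v n) 0" using rep_diff[OF u v] by simp
  then show "F.cau (\<lambda>n. u n - v n)" by (rule rep_cau)
  fix \<psi> assume \<psi>: "\<psi> \<in> Fin X E"
  have "fsum (\<lambda>z. ipE ((0::'x \<Rightarrow> 'e) z)) \<psi> = 0"
    unfolding fsum_def using \<psi> by (intro sum.neutral) (auto simp: Fin_def E.ip_zero_left)
  then show "(\<lambda>n. B (u n - v n) \<psi>) \<longlonglongrightarrow> 0"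
    using rep_weak[OF d \<psi>] by simp
qed

lemma ipRK_tendsto:
  assumes u: "rep u f" and v: "rep v g"
  shows "(\<lambda>n. B (u n) (v n)) \<longlonglongrightarrow> ipRK f g"
proof -
  define u' v' where "u' = (SOME u. rep u f)" and "v' = (SOME u. rep u g)"
  have u': "rep u' f" and v': "rep v' g" unfolding u'_def v'_def
    using someI[of "\<lambda>u. rep u f", OF u] someI[of "\<lambda>u. rep u g", OF v] .
  have m: "u n \<in> Fin X E" "v n \<in> Fin X E" "u' n \<in> Fin X E" "v' n \<in> Fin X E" for n
    using u v u' v' by (auto simp: rep_cau F.cau_mem)
  have "(\<lambda>n. B (u' n) (v' n)) \<longlonglongrightarrow> ipRK f g"
    using F.cau_ip_convergent[OF rep_cau[OF u'] rep_cau[OF v']]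
    by (simp add: ipRK_def u'_def v'_def convergent_LIMSEQ_iff)
  moreover have "(\<lambda>n. B (u n - u' n) (v n)) \<longlonglongrightarrow> 0"
    by (rule F.tendsto_0_ip_left) (use m rep_unique[OF u u'] rep_cau[OF v] F.mem in auto)
  moreover have "(\<lambda>n. B (u' n) (v n - v' n)) \<longlonglongrightarrow> 0"
    by (rule F.tendsto_0_ip_right) (use m rep_unique[OF v v'] rep_cau[OF u'] F.mem in auto)
  ultimately have "(\<lambda>n. B (u' n) (v' n) + B (u n - u' n) (v n) + B (u' n) (v n - v' n)) \<longlonglongrightarrow> ipRK f g + 0 + 0"
    by (intro tendsto_add)
  moreover have "B (u' n) (v' n) + B (u n - u' n) (v n) + B (u' n) (v n - v' n) = B (u n) (v n)" for n
    using m by (simp add: F.ip_diff_left F.ip_diff_right)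
  ultimately show ?thesis by simp
qed

text \<open>Evaluation is bounded by \<open>J_bound\<close>, so the values at each point form a norm
  Cauchy sequence in the complete space \<open>E\<close>.\<close>

lemma cau_rep:
  assumes u: "F.cau u" shows "\<exists>f. rep u f"
proof -
  have "\<exists>y\<in>E. (\<lambda>n. hnorm ipE (J (u n) z - y)) \<longlonglongrightarrow> 0" if z: "z \<in> X" for z
  proof (rule E.complete)
    show "J (u n) z \<in> E" for n by (rule J_in[OF F.cau_mem[OF u]])
    fix \<epsilon> :: real assume e: "\<epsilon> > 0"
    obtain M where M: "M > 0" "\<And>\<phi>. \<phi> \<in> Fin X E \<Longrightarrow> hnorm ipE (J \<phi> z) \<le> M * hnorm B \<phi>"
      using J_bound[OF z] by blast
    obtain N where N: "\<And>m n. m \<ge> N \<Longrightarrow> n \<ge> N \<Longrightarrow> hnorm B (u m - u n) < \<epsilon> / M"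
      using F.cauD[OF u, of "\<epsilon> / M"] e M(1) by auto
    have "hnorm ipE (J (u m) z - J (u n) z) < \<epsilon>" if "m \<ge> N" "n \<ge> N" for m n
    proof -
      have "J (u m) z = J (u m - u n) z + J (u n) z"
        using J_add[of "u m - u n" "u n" z] F.cau_mem[OF u] F.mem by simp
      then have "hnorm ipE (J (u m) z - J (u n) z) = hnorm ipE (J (u m - u n) z)" by simp
      also have "\<dots> \<le> M * hnorm B (u m - u n)"
        using F.cau_mem[OF u] F.mem by (intro M(2)) auto
      also have "\<dots> < M * (\<epsilon> / M)" using N[OF that] M(1) by (intro mult_strict_left_mono)
      finally show ?thesis using M(1) by simp
    qed
    then show "\<exists>N. \<forall>m\<ge>N. \<forall>n\<ge>N. hnorm ipE (J (u m) z - J (u n) z) < \<epsilon>" by blast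
  qed
  then obtain f where f: "\<And>z. z \<in> X \<Longrightarrow> f z \<in> E" "\<And>z. z \<in> X \<Longrightarrow> (\<lambda>n. hnorm ipE (J (u n) z - f z)) \<longlonglongrightarrow> 0"
    by metis
  have "rep u (\<lambda>z. if z \<in> X then f z else 0)"
    unfolding rep_def
  proof (intro conjI allI impI ballI)
    fix z e assume ze: "z \<in> X" "e \<in> E"
    have "(\<lambda>n. cnj (ipE e (J (u n) z))) \<longlonglongrightarrow> cnj (ipE e (f z))"
      by (intro tendsto_cnj E.tendsto_ip_right) (use ze f J_in[OF F.cau_mem[OF u]] in auto)
    moreover have "cnj (ipE e y) = ipE y e" if "y \<in> E" for y
      using E.herm[OF ze(2) that] by simp
    ultimately show "(\<lambda>n. ipE (J (u n) z) e) \<longlonglongrightarrow> ipE (if z \<in> X then f z else 0) e"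
      using ze f J_in[OF F.cau_mem[OF u]] by simp
  qed (use u f in auto)
  then show ?thesis by blast
qed

lemma RK_E: "f \<in> RK \<Longrightarrow> \<exists>u. rep u f" and RK_I: "rep u f \<Longrightarrow> f \<in> RK"
  by (auto simp: RK_def)

lemma RK_semi_inner: "semi_inner RK ipRK"
proof
  show "csubspace RK"
    unfolding csubspace_def
  proof (intro conjI ballI allI)
    have "J 0 = (0::'x \<Rightarrow> 'e)" by (auto simp: J_def fsum_def supp_def fun_eq_iff)
    then show "0 \<in> RK" using RK_I[OF rep_const[OF F.mem(1)]] by simp
  qed (auto simp: RK_def intro: rep_add rep_scale)
  show "ipRK (x + y) z = ipRK x z + ipRK y z" if xyz: "x \<in> RK" "y \<in> RK" "z \<in> RK" for x y z
  proof -
    obtain u v w where r: "rep u x" "rep v y" "rep w z" using xyz RK_E by meson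
    have m: "u n \<in> Fin X E" "v n \<in> Fin X E" "w n \<in> Fin X E" for n
      using r by (auto simp: rep_cau F.cau_mem)
    show ?thesis
      using LIMSEQ_unique[OF ipRK_tendsto[OF rep_add[OF r(1,2)] r(3)]]
        tendsto_add[OF ipRK_tendsto[OF r(1,3)] ipRK_tendsto[OF r(2,3)]] m
      by (simp add: F.ip_add_left)
  qed
  show "ipRK (cscale a x) y = a * ipRK x y" if xy: "x \<in> RK" "y \<in> RK" for x y a
  proof -
    obtain u v where r: "rep u x" "rep v y" using xy RK_E by meson
    have m: "u n \<in> Fin X E" "v n \<in> Fin X E" for n
      using r by (auto simp: rep_cau F.cau_mem)
    show ?thesis
      using LIMSEQ_unique[OF ipRK_tendsto[OF rep_scale[OF r(1), of a] r(2)]]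
        tendsto_mult_left[OF ipRK_tendsto[OF r], of a] m
      by (simp add: F.ip_scale_left)
  qed
  show "ipRK y x = cnj (ipRK x y)" if xy: "x \<in> RK" "y \<in> RK" for x y
  proof -
    obtain u v where r: "rep u x" "rep v y" using xy RK_E by meson
    have m: "u n \<in> Fin X E" "v n \<in> Fin X E" for n
      using r by (auto simp: rep_cau F.cau_mem)
    have "(\<lambda>n. cnj (B (u n) (v n))) \<longlonglongrightarrow> cnj (ipRK x y)"
      by (intro tendsto_cnj ipRK_tendsto r)
    then have "(\<lambda>n. B (v n) (u n)) \<longlonglongrightarrow> cnj (ipRK x y)"
      using F.herm[OF m(1,2)] by simp
    then show ?thesis
      by (rule LIMSEQ_unique[OF ipRK_tendsto[OF r(2,1)]])
  qed
  show "0 \<le> Re (ipRK x x)" if x: "x \<in> RK" for x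
  proof -
    obtain u where r: "rep u x" using x RK_E by meson
    show ?thesis
      by (rule tendsto_lowerbound[OF tendsto_Re[OF ipRK_tendsto[OF r r]]])
        (use F.nonneg[OF F.cau_mem[OF rep_cau[OF r]]] in auto)
  qed
qed

sublocale R: semi_inner RK ipRK
  by (rule RK_semi_inner)

lemma hnorm_RK_tendsto: "rep u f \<Longrightarrow> (\<lambda>n. hnorm B (u n)) \<longlonglongrightarrow> hnorm ipRK f"
  unfolding hnorm_def by (intro tendsto_real_sqrt tendsto_Re ipRK_tendsto)

lemma hnorm_RK_J: "\<phi> \<in> Fin X E \<Longrightarrow> hnorm ipRK (J \<phi>) = hnorm B \<phi>"
  using LIMSEQ_unique[OF hnorm_RK_tendsto[OF rep_const] tendsto_const] .

lemma J_RK: "\<phi> \<in> Fin X E \<Longrightarrow> J \<phi> \<in> RK"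
  by (rule RK_I[OF rep_const])

lemma RK_reproducing:
  assumes f: "f \<in> RK" and w: "w \<in> X" and e: "e \<in> E"
  shows "ipRK f (J (delta w e)) = ipE (f w) e"
proof -
  obtain u where u: "rep u f" using RK_E[OF f] by blast
  have "(\<lambda>n. B (u n) (delta w e)) \<longlonglongrightarrow> ipRK f (J (delta w e))"
    by (rule ipRK_tendsto[OF u rep_const[OF delta_in[OF w e]]])
  moreover have "(\<lambda>n. B (u n) (delta w e)) \<longlonglongrightarrow> ipE (f w) e"
    using rep_tendsto[OF u w e] F.cau_mem[OF rep_cau[OF u]] by (simp add: B_delta)
  ultimately show ?thesis by (rule LIMSEQ_unique)
qed

lemma RK_approx:
  assumes f: "f \<in> RK" and e: "\<epsilon> > 0"
  shows "\<exists>\<phi>\<in>Fin X E. hnorm ipRK (f - J \<phi>) < \<epsilon>"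
proof -
  obtain u where u: "rep u f" using RK_E[OF f] by blast
  have m: "u n \<in> Fin X E" for n using F.cau_mem[OF rep_cau[OF u]] .
  obtain N where N: "\<And>m n. m \<ge> N \<Longrightarrow> n \<ge> N \<Longrightarrow> hnorm B (u m - u n) < \<epsilon> / 2"
    using F.cauD[OF rep_cau[OF u], of "\<epsilon> / 2"] e by auto
  have "(\<lambda>n. hnorm B (u n - u N)) \<longlonglongrightarrow> hnorm ipRK (f - J (u N))"
    by (rule hnorm_RK_tendsto[OF rep_diff[OF u rep_const[OF m]]])
  then have "hnorm ipRK (f - J (u N)) \<le> \<epsilon> / 2"
    by (rule tendsto_upperbound) (use N[of _ N] in \<open>auto intro!: eventually_sequentiallyI[of N] less_imp_le\<close>)
  then show ?thesis using e m by (intro bexI[of _ "u N"]) auto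
qed

lemma RK_hilbert: "hilbert RK ipRK"
proof
  fix f assume f: "f \<in> RK" and 0: "ipRK f f = 0"
  have "f z = 0" for z
  proof (cases "z \<in> X")
    case True
    have fz: "f z \<in> E" using RK_E[OF f] rep_range by blast
    have "hnorm ipRK f = 0" using 0 by (simp add: hnorm_def)
    then have "ipRK f (J (delta z (f z))) = 0"
      using R.cauchy_schwarz[OF f J_RK[OF delta_in[OF True fz]]] by simp
    then show ?thesis using RK_reproducing[OF f True fz] E.definite[OF fz] by simp
  qed (use RK_E[OF f] rep_range in blast)
  then show "f = 0" by (simp add: fun_eq_iff)
next
  fix g :: "nat \<Rightarrow> 'x \<Rightarrow> 'e"
  assume g: "\<And>n. g n \<in> RK"
    and cauchy: "\<And>\<epsilon>. \<epsilon> > 0 \<Longrightarrow> \<exists>N. \<forall>m\<ge>N. \<forall>k\<ge>N. hnorm ipRK (g m - g k) < \<epsilon>"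
  \<comment> \<open>Completeness by density: each \<open>g n\<close> is replaced by a combination
    \<open>J (u n)\<close> at distance below \<open>1 / (n + 1)\<close>. The coefficients
    \<open>u\<close> are then Cauchy themselves and represent the limit.\<close>
  have "\<exists>\<phi>\<in>Fin X E. hnorm ipRK (g n - J \<phi>) < inverse (real (Suc n))" for n
    by (rule RK_approx[OF g]) simp
  then obtain u where u: "\<And>n. u n \<in> Fin X E" and gu: "\<And>n. hnorm ipRK (g n - J (u n)) < inverse (real (Suc n))"
    by metis
  have J_diff: "J (u m - u n) = J (u m) - J (u n)" for m n
    using J_add[of "u m - u n" "u n"] u F.mem by (simp add: fun_eq_iff algebra_simps)
  have "F.cau u"
    unfolding F.cau_def
  proof (intro conjI allI impI u)
    fix \<epsilon> :: real assume e: "\<epsilon> > 0"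
    obtain N where N: "\<And>m n. m \<ge> N \<Longrightarrow> n \<ge> N \<Longrightarrow> hnorm ipRK (g m - g n) < \<epsilon> / 3"
      using cauchy[of "\<epsilon> / 3"] e by auto
    obtain M where M: "inverse (real (Suc M)) < \<epsilon> / 3"
      using reals_Archimedean[of "\<epsilon> / 3"] e by auto
    have "hnorm B (u m - u n) < \<epsilon>" if mn: "m \<ge> max M N" "n \<ge> max M N" for m n
    proof -
      have i: "hnorm ipRK (g l - J (u l)) < \<epsilon> / 3" if "l \<ge> M" for l
      proof -
        have "inverse (real (Suc l)) \<le> inverse (real (Suc M))"
          using that by (intro le_imp_inverse_le) auto
        then show ?thesis using gu[of l] M by linarith
      qed
      have "hnorm B (u m - u n) = hnorm ipRK (J (u m) - J (u n))"
        using u F.mem by (simp add: hnorm_RK_J flip: J_diff)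
      also have "\<dots> \<le> hnorm ipRK (J (u m) - g m) + hnorm ipRK (g m - J (u n))"
        by (rule R.hnorm_triangle_diff) (use u g J_RK in auto)
      also have "hnorm ipRK (g m - J (u n)) \<le> hnorm ipRK (g m - g n) + hnorm ipRK (g n - J (u n))"
        by (rule R.hnorm_triangle_diff) (use u g J_RK in auto)
      also have "hnorm ipRK (J (u m) - g m) = hnorm ipRK (g m - J (u m))"
        by (rule R.hnorm_minus_commute) (use u g J_RK in auto)
      finally show ?thesis using i[of m] i[of n] N[of m n] mn by linarith
    qed
    then show "\<exists>N. \<forall>m\<ge>N. \<forall>n\<ge>N. hnorm B (u m - u n) < \<epsilon>" by blast
  qed
  then obtain f where f: "rep u f" using cau_rep by blast
  have fR: "f \<in> RK" by (rule RK_I[OF f])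
  have "(\<lambda>n. hnorm ipRK (g n - f)) \<longlonglongrightarrow> 0"
  proof (rule LIMSEQ_I)
    fix \<epsilon> :: real assume e: "\<epsilon> > 0"
    obtain N where N: "\<And>m n. m \<ge> N \<Longrightarrow> n \<ge> N \<Longrightarrow> hnorm B (u m - u n) < \<epsilon> / 3"
      using F.cauD[OF rep_cau[OF f], of "\<epsilon> / 3"] e by auto
    obtain M where M: "inverse (real (Suc M)) < \<epsilon> / 3"
      using reals_Archimedean[of "\<epsilon> / 3"] e by auto
    have "norm (hnorm ipRK (g n - f) - 0) < \<epsilon>" if n: "n \<ge> max M N" for n
    proof -
      have "inverse (real (Suc n)) \<le> inverse (real (Suc M))"
        using n by (intro le_imp_inverse_le) auto
      then have i: "hnorm ipRK (g n - J (u n)) < \<epsilon> / 3" using gu[of n] M by linarith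
      have "(\<lambda>m. hnorm B (u m - u n)) \<longlonglongrightarrow> hnorm ipRK (f - J (u n))"
        by (rule hnorm_RK_tendsto[OF rep_diff[OF f rep_const[OF u]]])
      then have "hnorm ipRK (f - J (u n)) \<le> \<epsilon> / 3"
        by (rule tendsto_upperbound)
          (use N[of _ n] n in \<open>auto intro!: eventually_sequentiallyI[of N] less_imp_le\<close>)
      moreover have "hnorm ipRK (g n - f) \<le> hnorm ipRK (g n - J (u n)) + hnorm ipRK (J (u n) - f)"
        by (rule R.hnorm_triangle_diff) (use u g J_RK fR in auto)
      moreover have "hnorm ipRK (J (u n) - f) = hnorm ipRK (f - J (u n))"
        by (rule R.hnorm_minus_commute) (use u fR J_RK in auto)
      moreover have "hnorm ipRK (g n - f) \<ge> 0"
        using R.mem(5)[OF g fR] by simp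
      ultimately show ?thesis using i e by simp
    qed
    then show "\<exists>no. \<forall>n\<ge>no. norm (hnorm ipRK (g n - f) - 0) < \<epsilon>" by blast
  qed
  with fR show "\<exists>f\<in>RK. (\<lambda>n. hnorm ipRK (g n - f)) \<longlonglongrightarrow> 0" by blast
qed

theorem moore_aronszajn:
  "\<exists>H ip. hilbert H ip \<and>
    (\<forall>f\<in>H. \<forall>z. (z \<in> X \<longrightarrow> f z \<in> E) \<and> (z \<notin> X \<longrightarrow> f z = 0)) \<and>
    (\<forall>w\<in>X. \<forall>e\<in>E. (\<lambda>z. if z \<in> X then k z w e else 0) \<in> H) \<and>
    (\<forall>f\<in>H. \<forall>w\<in>X. \<forall>e\<in>E. ipE (f w) e = ip f (\<lambda>z. if z \<in> X then k z w e else 0))"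
proof (intro exI[of _ RK] exI[of _ ipRK] conjI ballI allI impI)
  have J: "J (delta w e) = (\<lambda>z. if z \<in> X then k z w e else 0)" if "w \<in> X" for w e
    using that J_delta[OF that] by (auto simp: J_def fun_eq_iff)
  show "hilbert RK ipRK" by (rule RK_hilbert)
  show "f z \<in> E" if "f \<in> RK" for f z using RK_E[OF that] rep_range by blast
  show "f z = 0" if "f \<in> RK" "z \<notin> X" for f z using RK_E[OF that(1)] rep_range that(2) by blast
  show "(\<lambda>z. if z \<in> X then k z w e else 0) \<in> RK" if "w \<in> X" "e \<in> E" for w e
    using J_RK[OF delta_in[OF that]] J[OF that(1)] by simp
  show "ipE (f w) e = ipRK f (\<lambda>z. if z \<in> X then k z w e else 0)" if "f \<in> RK" "w \<in> X" "e \<in> E" for f w e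
    using RK_reproducing[OF that] J[OF that(2)] by simp
qed

end

section \<open>Row contractions of coordinate multiplications\<close>

text \<open>The evaluation bound \<open>c\<close> is a parameter so that one function serves both
  for \<open>HKE\<close> and for \<open>S\<close>, which inherits it through the contractive
  embedding.\<close>

locale eval_space = S: hilbert S ipS + Es: hilbert Es ipEs
  for S :: "('x \<Rightarrow> 'e::cvec) set" and ipS and Es :: "'e set" and ipEs +
  fixes X :: "'x set" and c :: "'x \<Rightarrow> real"
  assumes S_range: "f \<in> S \<Longrightarrow> z \<in> X \<Longrightarrow> f z \<in> Es" "f \<in> S \<Longrightarrow> z \<notin> X \<Longrightarrow> f z = 0"
    and eval: "f \<in> S \<Longrightarrow> z \<in> X \<Longrightarrow> e \<in> Es \<Longrightarrow> norm (ipEs (f z) e) \<le> c z * hnorm ipEs e * hnorm ipS f"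
    and c_nonneg: "z \<in> X \<Longrightarrow> 0 \<le> c z"
begin

definition rker where "rker w e = (THE g. g \<in> S \<and> (\<forall>f\<in>S. ipS f g = ipEs (f w) e))"

lemma rker_props:
  assumes w: "w \<in> X" and e: "e \<in> Es"
  shows "rker w e \<in> S" "\<And>f. f \<in> S \<Longrightarrow> ipS f (rker w e) = ipEs (f w) e" "hnorm ipS (rker w e) \<le> c w * hnorm ipEs e"
proof -
  obtain g where g: "g \<in> S" "\<And>f. f \<in> S \<Longrightarrow> ipS f g = ipEs (f w) e" "hnorm ipS g \<le> \<bar>c w * hnorm ipEs e\<bar>"
  proof (rule S.functional_representation[OF S.sub, of "\<lambda>f. f" "\<lambda>f. ipEs (f w) e" "c w * hnorm ipEs e"])
    show "norm (ipEs (f w) e) \<le> c w * hnorm ipEs e * hnorm ipS f" if "f \<in> S" for f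
      by (rule eval[OF that w e])
  qed (use w e S_range(1) in \<open>auto simp: Es.ip_add_left Es.ip_scale_left cscale_fun_def\<close>)
  have "rker w e = g"
    unfolding rker_def by (rule the_equality) (use g S.eqI_right in auto)
  then show "rker w e \<in> S" "\<And>f. f \<in> S \<Longrightarrow> ipS f (rker w e) = ipEs (f w) e" "hnorm ipS (rker w e) \<le> c w * hnorm ipEs e"
    using g c_nonneg[OF w] e by auto
qed

lemma rker_eqI:
  assumes "w \<in> X" "e \<in> Es" "g \<in> S" "\<And>f. f \<in> S \<Longrightarrow> ipS f g = ipEs (f w) e"
  shows "rker w e = g"
  by (rule S.eqI_right) (use assms rker_props in auto)

lemma rker_add: "w \<in> X \<Longrightarrow> e \<in> Es \<Longrightarrow> e' \<in> Es \<Longrightarrow> rker w (e + e') = rker w e + rker w e'"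
  by (rule rker_eqI) (auto simp: Es.mem S.mem rker_props S.ip_add_right Es.ip_add_right S_range)

lemma rker_scale: "w \<in> X \<Longrightarrow> e \<in> Es \<Longrightarrow> rker w (cscale a e) = cscale a (rker w e)"
  by (rule rker_eqI) (auto simp: Es.mem S.mem rker_props S.ip_scale_right Es.ip_scale_right S_range)

lemma rker_zero: "w \<in> X \<Longrightarrow> rker w 0 = 0"
  using rker_scale[of w 0 0] Es.mem(1) by simp

lemma rker_swap:
  assumes "w \<in> X" "z \<in> X" "e \<in> Es" "e' \<in> Es"
  shows "ipS (rker w e) (rker z e') = ipEs (rker w e z) e'"
  using assms by (simp add: rker_props)

lemma fun_eqI:
  assumes x: "x \<in> S" "y \<in> S" and eq: "\<And>z e. z \<in> X \<Longrightarrow> e \<in> Es \<Longrightarrow> ipEs (x z) e = ipEs (y z) e"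
  shows "x = y"
proof
  fix z show "x z = y z"
    using Es.eqI_left[OF S_range(1)[OF x(1)] S_range(1)[OF x(2)], of z] eq[of z]
      S_range(2)[OF x(1), of z] S_range(2)[OF x(2), of z]
    by (cases "z \<in> X") auto
qed

definition comb where "comb \<phi> = fsum rker \<phi>"

lemma comb_in: "\<phi> \<in> Fin X Es \<Longrightarrow> comb \<phi> \<in> S"
  unfolding comb_def by (rule fsum_in[OF S.sub]) (auto simp: rker_props)

lemma comb_add: "\<phi> \<in> Fin X Es \<Longrightarrow> \<psi> \<in> Fin X Es \<Longrightarrow> comb (\<phi> + \<psi>) = comb \<phi> + comb \<psi>"
  unfolding comb_def by (rule fsum_add[OF Es.sub]) (auto simp: rker_add)

lemma comb_scale: "\<phi> \<in> Fin X Es \<Longrightarrow> comb (cscale a \<phi>) = cscale a (comb \<phi>)"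
  unfolding comb_def by (rule fsum_scale[OF Es.sub]) ((assumption | erule (1) rker_scale | erule rker_zero | rule cv.scale_zero_right cv.scale_right_distrib)+)

lemma comb_delta: "z \<in> X \<Longrightarrow> comb (delta z e) = rker z e"
  unfolding comb_def by (rule fsum_delta) (rule rker_zero)

text \<open>Represent the functional \<open>\<lambda>\<phi>. ipS (comb \<phi>) x\<close>. The
  representer is by construction a limit of combinations, and it agrees with \<open>x\<close>
  against all kernel functions, hence pointwise.\<close>

lemma comb_dense:
  assumes x: "x \<in> S" and e: "\<epsilon> > 0"
  shows "\<exists>\<phi>\<in>Fin X Es. hnorm ipS (comb \<phi> - x) < \<epsilon>"
proof -
  obtain g where g: "g \<in> S" "\<And>\<phi>. \<phi> \<in> Fin X Es \<Longrightarrow> ipS (comb \<phi>) g = ipS (comb \<phi>) x"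
    "\<And>\<epsilon>. \<epsilon> > 0 \<Longrightarrow> \<exists>\<phi>\<in>Fin X Es. hnorm ipS (comb \<phi> - g) < \<epsilon>"
  proof (rule S.functional_representation[OF csubspace_Fin[OF Es.sub, of X], of comb "\<lambda>\<phi>. ipS (comb \<phi>) x" "hnorm ipS x"])
    show "norm (ipS (comb \<phi>) x) \<le> hnorm ipS x * hnorm ipS (comb \<phi>)" if "\<phi> \<in> Fin X Es" for \<phi>
      using S.cauchy_schwarz[OF comb_in[OF that] x] by (simp add: mult.commute)
  qed (use x in \<open>auto simp: comb_in comb_add comb_scale S.ip_add_left S.ip_scale_left\<close>)
  have "g = x"
  proof (rule fun_eqI[OF g(1) x])
    fix z e assume ze: "z \<in> X" "e \<in> Es"
    have "ipS (rker z e) g = ipS (rker z e) x"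
      using g(2)[OF delta_Fin[OF Es.sub ze]] comb_delta[OF ze(1)] by simp
    then have "ipS g (rker z e) = ipS x (rker z e)"
      using S.herm[of "rker z e" g] S.herm[of "rker z e" x] rker_props(1)[OF ze] g(1) x by simp
    then show "ipEs (g z) e = ipEs (x z) e" using rker_props(2)[OF ze] g(1) x by simp
  qed
  with g(3) e show ?thesis by simp
qed

end

section \<open>The inner product of the ball and the Drury-Arveson kernel\<close>

lemma norm_sq_eq_sum: "(norm (w :: complex^'n))\<^sup>2 = (\<Sum>i\<in>UNIV. (norm (w $ i))\<^sup>2)"
  by (simp add: norm_vec_def L2_set_def sum_nonneg)

lemma cinner_n_self: "cinner_n w w = of_real ((norm w)\<^sup>2)"
  unfolding norm_sq_eq_sum cinner_n_def of_real_sum complex_norm_square ..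

lemma cinner_n_cnj: "cnj (cinner_n z w) = cinner_n w z"
  by (simp add: cinner_n_def mult.commute)

lemma norm_cinner_n_le: "norm (cinner_n z w) \<le> norm z * norm w"
proof -
  have "norm (cinner_n z w) \<le> (\<Sum>i\<in>UNIV. \<bar>norm (z $ i)\<bar> * \<bar>norm (w $ i)\<bar>)"
    unfolding cinner_n_def by (rule sum_norm_le) (simp add: norm_mult)
  also have "\<dots> \<le> L2_set (\<lambda>i. norm (z $ i)) UNIV * L2_set (\<lambda>i. norm (w $ i)) UNIV"
    by (rule L2_set_mult_ineq)
  finally show ?thesis by (simp add: norm_vec_def)
qed

lemma norm_cinner_n_less_1:
  assumes "z \<in> Bn" "w \<in> Bn" shows "norm (cinner_n z w) < 1"
proof -
  have "norm z * norm w < 1 * 1"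
    using assms by (intro mult_strict_mono) auto
  then show ?thesis using norm_cinner_n_le[of z w] by simp
qed

context semi_inner
begin

lemma ip_sum_sum:
  assumes "\<And>i. i \<in> I \<Longrightarrow> f i \<in> H" "\<And>j. j \<in> J \<Longrightarrow> g j \<in> H"
  shows "ip (sum f I) (sum g J) = (\<Sum>j\<in>J. \<Sum>i\<in>I. ip (f i) (g j))"
  using assms by (simp add: ip_sum_right ip_sum_left mem)

end

context hilbert
begin

text \<open>The Drury-Arveson kernel is a sum of powers of the inner product; one factor is split off at a time.\<close>

lemma cinner_n_power_psd:
  fixes \<phi> :: "complex^'n \<Rightarrow> 'a"
  assumes "\<And>w. w \<in> F \<Longrightarrow> \<phi> w \<in> H"
  shows "0 \<le> Re (\<Sum>z\<in>F. \<Sum>w\<in>F. cinner_n z w ^ m * ip (\<phi> w) (\<phi> z))"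
  using assms
proof (induction m arbitrary: \<phi>)
  case 0
  have "(\<Sum>z\<in>F. \<Sum>w\<in>F. ip (\<phi> w) (\<phi> z)) = ip (sum \<phi> F) (sum \<phi> F)"
    using 0 by (simp add: ip_sum_left ip_sum_right mem)
  then show ?case using nonneg[OF mem(6)[of F \<phi>]] 0 by simp
next
  case (Suc m)
  let ?g = "\<lambda>z w i. cinner_n z w ^ m * ip (cscale (cnj (w $ i)) (\<phi> w)) (cscale (cnj (z $ i)) (\<phi> z))"
  have "(\<Sum>z\<in>F. \<Sum>w\<in>F. cinner_n z w ^ Suc m * ip (\<phi> w) (\<phi> z))
      = (\<Sum>z\<in>F. \<Sum>w\<in>F. \<Sum>i\<in>UNIV. ?g z w i)"
  proof (intro sum.cong refl)
    fix z w assume zw: "z \<in> F" "w \<in> F"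
    have "(\<Sum>i\<in>UNIV. ?g z w i)
        = (\<Sum>i\<in>UNIV. z $ i * cnj (w $ i) * (cinner_n z w ^ m * ip (\<phi> w) (\<phi> z)))"
      using Suc.prems zw by (intro sum.cong) (simp_all add: ip_scale_left ip_scale_right mem)
    also have "\<dots> = cinner_n z w * (cinner_n z w ^ m * ip (\<phi> w) (\<phi> z))"
      by (simp add: cinner_n_def sum_distrib_right)
    finally show "cinner_n z w ^ Suc m * ip (\<phi> w) (\<phi> z)
        = (\<Sum>i\<in>UNIV. ?g z w i)"
      by simp
  qed
  also have "\<dots> = (\<Sum>z\<in>F. \<Sum>i\<in>UNIV. \<Sum>w\<in>F. ?g z w i)"
    by (intro sum.cong refl) (rule sum.swap)
  also have "\<dots> = (\<Sum>i\<in>UNIV. \<Sum>z\<in>F. \<Sum>w\<in>F. ?g z w i)"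
    by (rule sum.swap)
  finally have eq: "(\<Sum>z\<in>F. \<Sum>w\<in>F. cinner_n z w ^ Suc m * ip (\<phi> w) (\<phi> z)) = \<dots>" .
  show ?case
    unfolding eq Re_sum[of _ UNIV]
    by (rule sum_nonneg) (use Suc.IH[of "\<lambda>w. cscale (cnj (w $ _)) (\<phi> w)"] Suc.prems in \<open>simp add: mem\<close>)
qed

lemma DA_psd:
  fixes \<phi> :: "complex^'n \<Rightarrow> 'a"
  assumes F: "finite F" "F \<subseteq> Bn" and \<phi>: "\<And>w. w \<in> F \<Longrightarrow> \<phi> w \<in> H"
  shows "0 \<le> Re (\<Sum>z\<in>F. \<Sum>w\<in>F. DA_kernel z w * ip (\<phi> w) (\<phi> z))"
proof -
  have "(\<lambda>m. (\<Sum>z\<in>F. \<Sum>w\<in>F. cinner_n z w ^ m * ip (\<phi> w) (\<phi> z)))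
      sums (\<Sum>z\<in>F. \<Sum>w\<in>F. DA_kernel z w * ip (\<phi> w) (\<phi> z))"
  proof (intro sums_sum sums_mult2)
    fix z w assume "z \<in> F" "w \<in> F"
    then have "norm (cinner_n z w) < 1" using F norm_cinner_n_less_1 by blast
    then show "(\<lambda>m. cinner_n z w ^ m) sums DA_kernel z w"
      unfolding DA_kernel_def by (rule geometric_sums)
  qed
  then have S: "(\<lambda>m. Re (\<Sum>z\<in>F. \<Sum>w\<in>F. cinner_n z w ^ m * ip (\<phi> w) (\<phi> z)))
      sums Re (\<Sum>z\<in>F. \<Sum>w\<in>F. DA_kernel z w * ip (\<phi> w) (\<phi> z))"
    by (rule sums_Re)
  show ?thesis
    by (rule sums_le[OF _ sums_zero S]) (rule cinner_n_power_psd[OF \<phi>])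
qed

lemma DA_space_exists:
  "\<exists>HE ipHE. vrkhs Bn (DA_kernel :: complex^'n \<Rightarrow> complex^'n \<Rightarrow> complex) H ip HE ipHE"
proof -
  interpret K: op_kernel H ip Bn "\<lambda>z w. cscale (DA_kernel z (w :: complex^'n))"
  proof
    show "ip (cscale (DA_kernel z w) e) e' = ip e (cscale (DA_kernel w z) e')"
      if "e \<in> H" "e' \<in> H" for z w :: "complex^'n" and e e'
      using that by (simp add: ip_scale_left ip_scale_right DA_kernel_def cinner_n_cnj)
    show "0 \<le> Re (fsum (\<lambda>z. ip (fsum (\<lambda>w. cscale (DA_kernel z w)) \<phi>)) \<phi>)" if \<phi>: "\<phi> \<in> Fin Bn H" for \<phi> :: "complex^'n \<Rightarrow> 'a"
    proof -
      have "fsum (\<lambda>z. ip (fsum (\<lambda>w. cscale (DA_kernel z w)) \<phi>)) \<phi>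
          = (\<Sum>z\<in>supp \<phi>. \<Sum>w\<in>supp \<phi>. DA_kernel z w * ip (\<phi> w) (\<phi> z))"
        using \<phi> by (simp add: fsum_def ip_sum_left mem ip_scale_left Fin_def)
      then show ?thesis using DA_psd[of "supp \<phi>" \<phi>] \<phi> by (simp add: Fin_def)
    qed
    show "\<exists>M. \<forall>e\<in>H. Re (ip (cscale (DA_kernel z z) e) e) \<le> M * (hnorm ip e)\<^sup>2" for z :: "complex^'n"
      by (intro exI[of _ "Re (DA_kernel z z)"]) (simp add: ip_scale_left ip_self)
  qed (auto simp: mem cv.scale_right_distrib mult.commute)
  show ?thesis
    unfolding vrkhs_def hilbert_space_iff kfun_def by (rule K.moore_aronszajn)
qed

end

section \<open>Purity of the restricted multiplication tuple\<close>

locale row_space = eval_space S ipS Es ipEs "Bn :: (complex^'n::finite) set" c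
  for S :: "(complex^'n \<Rightarrow> 'e::cvec) set" and ipS and Es :: "'e set" and ipEs and c +
  assumes row: "row_contraction S ipS (\<lambda>j. Mz j)"
begin

abbreviation Radj where "Radj i \<equiv> adjoint S ipS S ipS (Mz i)"

lemma Mz_bounded: "bounded_op S ipS S ipS (Mz i)"
  using row by (simp add: row_contraction_def)

lemma Mz_in: "f \<in> S \<Longrightarrow> Mz i f \<in> S"
  using Mz_bounded by (simp add: bounded_op_def)

lemma Mz_add: "Mz i (f + g) = Mz i f + Mz i (g :: complex^'n \<Rightarrow> 'e)"
  by (simp add: Mz_def fun_eq_iff cv.scale_right_distrib)

lemma Mz_scale: "Mz i (cscale a f) = cscale a (Mz i (f :: complex^'n \<Rightarrow> 'e))"
  by (simp add: Mz_def fun_eq_iff cscale_fun_def mult.commute)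

lemma S_hilb: "hilbert_space S ipS"
  by (simp add: hilbert_space_iff S.hilbert_axioms)

lemma Radj_in: "y \<in> S \<Longrightarrow> Radj i y \<in> S"
  by (rule S.adjoint_exists(1)[OF S_hilb Mz_bounded])

lemma Radj_eq: "u \<in> S \<Longrightarrow> y \<in> S \<Longrightarrow> ipS (Mz i u) y = ipS u (Radj i y)"
  by (rule S.adjoint_exists(2)[OF S_hilb Mz_bounded])

lemma Radj_eqI: "y \<in> S \<Longrightarrow> g \<in> S \<Longrightarrow> (\<And>u. u \<in> S \<Longrightarrow> ipS (Mz i u) y = ipS u g) \<Longrightarrow> Radj i y = g"
  by (rule S.eqI_right) (auto simp: Radj_in Radj_eq)

lemma Radj_add: "x \<in> S \<Longrightarrow> y \<in> S \<Longrightarrow> Radj i (x + y) = Radj i x + Radj i y"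
  by (rule Radj_eqI) (auto simp: S.mem S.ip_add_right Radj_in Radj_eq Mz_in)

lemma Radj_scale: "x \<in> S \<Longrightarrow> Radj i (cscale a x) = cscale a (Radj i x)"
  by (rule Radj_eqI) (auto simp: S.mem S.ip_scale_right Radj_in Radj_eq Mz_in)

lemma Radj_zero: "Radj i 0 = 0"
  using Radj_scale[OF S.mem(1), of i 0] by simp

lemma Radj_sum: "(\<And>j. j \<in> J \<Longrightarrow> f j \<in> S) \<Longrightarrow> Radj i (sum f J) = (\<Sum>j\<in>J. Radj i (f j))"
  by (induction J rule: infinite_finite_induct) (auto simp: Radj_zero Radj_add S.mem)

lemma Radj_rker:
  assumes w: "w \<in> Bn" and e: "e \<in> Es"
  shows "Radj i (rker w e) = cscale (cnj (w $ i)) (rker w e)"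
proof (rule Radj_eqI)
  fix u assume u: "u \<in> S"
  have "ipS (Mz i u) (rker w e) = w $ i * ipEs (u w) e"
    using w e u S_range(1) by (simp add: rker_props Mz_in) (simp add: Mz_def Es.ip_scale_left)
  then show "ipS (Mz i u) (rker w e) = ipS u (cscale (cnj (w $ i)) (rker w e))"
    using w e u by (simp add: S.ip_scale_right rker_props)
qed (use w e in \<open>auto simp: rker_props S.mem\<close>)

lemma row_ineq:
  assumes x: "x \<in> S" shows "(\<Sum>i\<in>UNIV. (hnorm ipS (Radj i x))\<^sup>2) \<le> (hnorm ipS x)\<^sup>2"
proof -
  have "ipS (\<Sum>i\<in>UNIV. Mz i (Radj i x)) x = (\<Sum>i\<in>UNIV. ipS (Radj i x) (Radj i x))"
    using x by (simp add: S.ip_sum_left Mz_in Radj_in Radj_eq)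
  moreover have "Re (ipS (\<Sum>i\<in>UNIV. Mz i (Radj i x)) x) \<le> Re (ipS x x)"
    using row x by (simp add: row_contraction_def)
  ultimately show ?thesis using x by (simp add: S.hnorm_sq Radj_in)
qed

definition Q where "Q m = (P_T S ipS (\<lambda>j. Mz j) ^^ m) id"

lemma Q_0: "Q 0 x = x"
  by (simp add: Q_def)

lemma Q_Suc: "Q (Suc m) x = (\<Sum>i\<in>UNIV. Mz i (Q m (Radj i x)))"
  by (simp add: Q_def P_T_def)

lemma Q_in: "x \<in> S \<Longrightarrow> Q m x \<in> S"
  by (induction m arbitrary: x) (auto simp: Q_0 Q_Suc Mz_in Radj_in S.mem)

lemma ip_Q_Suc: "x \<in> S \<Longrightarrow> y \<in> S \<Longrightarrow> ipS (Q (Suc m) x) y = (\<Sum>i\<in>UNIV. ipS (Q m (Radj i x)) (Radj i y))"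
  by (simp add: Q_Suc S.ip_sum_left Mz_in Q_in Radj_in Radj_eq)

lemma Q_add: "x \<in> S \<Longrightarrow> y \<in> S \<Longrightarrow> Q m (x + y) = Q m x + Q m y"
  by (induction m arbitrary: x y) (auto simp: Q_0 Q_Suc Radj_add Radj_in Mz_add sum.distrib)

lemma Q_scale: "x \<in> S \<Longrightarrow> Q m (cscale a x) = cscale a (Q m x)"
  by (induction m arbitrary: x) (auto simp: Q_0 Q_Suc Radj_scale Radj_in Mz_scale cv.scale_sum_right)

lemma Q_herm: "x \<in> S \<Longrightarrow> y \<in> S \<Longrightarrow> ipS (Q m y) x = cnj (ipS (Q m x) y)"
proof (induction m arbitrary: x y)
  case 0
  then show ?case using S.herm[of x y] by (simp add: Q_0)
next
  case (Suc m)
  then show ?case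
    by (simp only: ip_Q_Suc cnj_sum) (intro sum.cong refl Suc.IH Radj_in)
qed

lemma Q_nonneg: "x \<in> S \<Longrightarrow> 0 \<le> Re (ipS (Q m x) x)"
  by (induction m arbitrary: x) (auto simp: Q_0 S.nonneg ip_Q_Suc Radj_in intro!: sum_nonneg)

lemma Q_le: "x \<in> S \<Longrightarrow> Re (ipS (Q m x) x) \<le> (hnorm ipS x)\<^sup>2"
proof (induction m arbitrary: x)
  case 0
  then show ?case by (simp add: Q_0 S.hnorm_sq)
next
  case (Suc m)
  have "Re (ipS (Q (Suc m) x) x) \<le> (\<Sum>i\<in>UNIV. (hnorm ipS (Radj i x))\<^sup>2)"
    using Suc by (simp add: ip_Q_Suc Radj_in sum_mono)
  then show ?case using row_ineq[OF Suc.prems] by simp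
qed

text \<open>Since \<open>Q m\<close> is positive, its quadratic form is a semi-inner product. Its
  seminorm takes the place of the norm of the square root of \<open>Q m\<close> applied to
  \<open>x\<close>.\<close>

abbreviation ipQ where "ipQ m \<equiv> (\<lambda>x y. ipS (Q m x) y)"

lemma Q_semi_inner: "semi_inner S (ipQ m)"
  by unfold_locales
    (auto simp: S.sub Q_add Q_in S.ip_add_left Q_scale S.ip_scale_left Q_nonneg intro: Q_herm)

lemma Q_norm_le: "x \<in> S \<Longrightarrow> hnorm (ipQ m) x \<le> hnorm ipS x"
  using Q_le[of x m] S.hnorm_sq[of x] by (simp add: hnorm_def)

text \<open>This is the operator inequality \<open>Q\<^sup>2 \<le> Q\<close> for a positive
  contraction, obtained from Cauchy-Schwarz for \<open>ipQ m\<close> at \<open>x\<close> and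
  \<open>Q m x\<close>. It upgrades convergence of the quadratic forms to strong
  convergence.\<close>

lemma norm_Q_le:
  assumes x: "x \<in> S" shows "hnorm ipS (Q m x) \<le> hnorm (ipQ m) x"
proof -
  interpret q: semi_inner S "ipQ m" by (rule Q_semi_inner)
  have "(hnorm ipS (Q m x))\<^sup>2 = norm (ipQ m x (Q m x))"
    using Q_in[OF x] by (simp add: S.ip_self norm_power)
  also have "\<dots> \<le> hnorm (ipQ m) x * hnorm (ipQ m) (Q m x)"
    by (rule q.cauchy_schwarz[OF x Q_in[OF x]])
  also have "\<dots> \<le> hnorm (ipQ m) x * hnorm ipS (Q m x)"
    by (intro mult_left_mono Q_norm_le Q_in q.hnorm_ge_0 x)
  finally show ?thesis
    using S.hnorm_ge_0[OF Q_in[OF x, of m]] q.hnorm_ge_0[OF x]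
    by (cases "hnorm ipS (Q m x) = 0") (auto simp: power2_eq_square dest: mult_right_le_imp_le)
qed

lemma Q_norm_rker:
  assumes w: "w \<in> Bn" and e: "e \<in> Es"
  shows "hnorm (ipQ m) (rker w e) = norm w ^ m * hnorm ipS (rker w e)"
proof -
  have rker: "rker w e \<in> S" by (rule rker_props(1)[OF w e])
  have "ipS (Q m (rker w e)) (rker w e) = of_real ((norm w ^ m * hnorm ipS (rker w e))\<^sup>2)"
  proof (induction m)
    case (Suc m)
    have "ipS (Q (Suc m) (rker w e)) (rker w e) = (\<Sum>i\<in>UNIV. w $ i * cnj (w $ i) * ipS (Q m (rker w e)) (rker w e))"
      using rker by (simp add: ip_Q_Suc Radj_rker[OF w e] Q_scale S.ip_scale_left S.ip_scale_right Q_in S.mem)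
        (simp add: mult_ac)
    also have "\<dots> = of_real ((norm w)\<^sup>2) * ipS (Q m (rker w e)) (rker w e)"
      by (simp only: cinner_n_self[symmetric] cinner_n_def sum_distrib_right)
    finally show ?case by (simp add: Suc power_mult_distrib power2_eq_square)
  qed (simp add: Q_0 S.ip_self rker)
  then show ?thesis
    using rker by (simp add: hnorm_def[of "ipQ m"] real_sqrt_abs abs_mult)
qed

text \<open>Density suffices because the bound \<open>Q_norm_le\<close> is uniform in
  \<open>m\<close>. On a fixed finite combination the seminorm decays since each of its points has
  norm below 1.\<close>

lemma Q_norm_tendsto_0:
  assumes x: "x \<in> S" shows "(\<lambda>m. hnorm (ipQ m) x) \<longlonglongrightarrow> 0"
proof (rule LIMSEQ_I)
  fix \<epsilon> :: real assume \<epsilon>: "\<epsilon> > 0"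
  have q: "semi_inner S (ipQ m)" for m by (rule Q_semi_inner)
  obtain \<phi> where \<phi>: "\<phi> \<in> Fin Bn Es" "hnorm ipS (comb \<phi> - x) < \<epsilon> / 2"
    using comb_dense[OF x, of "\<epsilon> / 2"] \<epsilon> by auto
  have mem: "rker w (\<phi> w) \<in> S" "w \<in> Bn" "\<phi> w \<in> Es" if "w \<in> supp \<phi>" for w
    using that \<phi>(1) rker_props(1) by (auto simp: Fin_def)
  have "(\<lambda>m. \<Sum>w\<in>supp \<phi>. norm w ^ m * hnorm ipS (rker w (\<phi> w))) \<longlonglongrightarrow> (\<Sum>w\<in>supp \<phi>. 0 * hnorm ipS (rker w (\<phi> w)))"
    by (intro tendsto_intros LIMSEQ_power_zero) (use mem(2) in auto)
  then have "\<forall>\<^sub>F m in sequentially. (\<Sum>w\<in>supp \<phi>. norm w ^ m * hnorm ipS (rker w (\<phi> w))) < \<epsilon> / 2"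
    using \<epsilon> by (intro order_tendstoD(2)) auto
  then obtain N where N: "\<And>m. m \<ge> N \<Longrightarrow> (\<Sum>w\<in>supp \<phi>. norm w ^ m * hnorm ipS (rker w (\<phi> w))) < \<epsilon> / 2"
    by (auto simp: eventually_sequentially)
  have "norm (hnorm (ipQ m) x - 0) < \<epsilon>" if m: "m \<ge> N" for m
  proof -
    have d: "x - comb \<phi> \<in> S" by (rule S.mem(5)[OF x comb_in[OF \<phi>(1)]])
    have "hnorm (ipQ m) x \<le> hnorm (ipQ m) (comb \<phi>) + hnorm (ipQ m) (x - comb \<phi>)"
      using semi_inner.hnorm_triangle[OF q comb_in[OF \<phi>(1)] d] by simp
    also have "hnorm (ipQ m) (x - comb \<phi>) \<le> hnorm ipS (x - comb \<phi>)" by (rule Q_norm_le[OF d])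
    also have "\<dots> = hnorm ipS (comb \<phi> - x)" by (rule S.hnorm_minus_commute[OF x comb_in[OF \<phi>(1)]])
    also have "hnorm (ipQ m) (comb \<phi>) \<le> (\<Sum>w\<in>supp \<phi>. hnorm (ipQ m) (rker w (\<phi> w)))"
      unfolding comb_def fsum_def by (rule semi_inner.hnorm_sum_le[OF q]) (rule mem)
    also have "\<dots> = (\<Sum>w\<in>supp \<phi>. norm w ^ m * hnorm ipS (rker w (\<phi> w)))"
      by (intro sum.cong refl Q_norm_rker mem)
    finally show ?thesis
      using N[OF m] \<phi>(2) semi_inner.hnorm_ge_0[OF q x, of m] unfolding real_norm_def by linarith
  qed
  then show "\<exists>no. \<forall>m\<ge>no. norm (hnorm (ipQ m) x - 0) < \<epsilon>" by blast
qed

theorem pure: "pure_row_contraction S ipS (\<lambda>j. Mz j)"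
  unfolding pure_row_contraction_def
proof (intro conjI ballI row)
  fix x assume x: "x \<in> S"
  have "(\<lambda>m. hnorm ipS (Q m x)) \<longlonglongrightarrow> 0"
    by (rule Lim_null_comparison[OF always_eventually Q_norm_tendsto_0[OF x]])
      (use norm_Q_le[OF x] Q_in[OF x] in simp)
  then show "(\<lambda>m. hnorm ipS ((P_T S ipS (\<lambda>j. Mz j) ^^ m) id x)) \<longlonglongrightarrow> 0"
    by (simp add: Q_def)
qed

section \<open>The defect kernel and the multiplier\<close>

definition kD where "kD z w e = cscale (1 - cinner_n z w) (rker w e z)"

lemma kD_ip:
  assumes "z \<in> Bn" "w \<in> Bn" "e \<in> Es" "e' \<in> Es"
  shows "ipEs (kD z w e) e' = (1 - cinner_n z w) * ipS (rker w e) (rker z e')"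
  using assms S_range(1)[OF rker_props(1)] by (simp add: kD_def Es.ip_scale_left rker_swap)

lemma kD_bound:
  assumes z: "z \<in> Bn" and e: "e \<in> Es"
  shows "Re (ipEs (kD z z e) e) \<le> (c z)\<^sup>2 * (hnorm ipEs e)\<^sup>2"
proof -
  have "ipEs (kD z z e) e = of_real ((1 - (norm z)\<^sup>2) * (hnorm ipS (rker z e))\<^sup>2)"
    using z e by (simp only: kD_ip cinner_n_self S.ip_self rker_props of_real_mult of_real_diff of_real_1)
  then have "Re (ipEs (kD z z e) e) = (1 - (norm z)\<^sup>2) * (hnorm ipS (rker z e))\<^sup>2"
    by (simp only: Re_complex_of_real)
  also have "\<dots> \<le> 1 * (hnorm ipS (rker z e))\<^sup>2"
    by (intro mult_right_mono) auto
  also have "\<dots> \<le> (c z * hnorm ipEs e)\<^sup>2"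
    using rker_props(1,3)[OF z e] by (simp add: power_mono)
  finally show ?thesis by (simp add: power_mult_distrib)
qed

text \<open>For \<open>x = comb \<phi>\<close> the form equals the squared norm of \<open>x\<close>
  minus the sum of the squared norms of the \<open>Radj i x\<close>, because \<open>Radj i\<close>
  only multiplies the summand at \<open>w\<close> by \<open>cnj (w $ i)\<close>. This difference is
  nonnegative by \<open>row_ineq\<close>.\<close>

lemma kD_psd:
  assumes \<phi>: "\<phi> \<in> Fin Bn Es"
  shows "0 \<le> Re (fsum (\<lambda>z. ipEs (fsum (kD z) \<phi>)) \<phi>)"
proof -
  define x where "x w = rker w (\<phi> w)" for w
  have mem: "w \<in> Bn" "\<phi> w \<in> Es" "x w \<in> S" if "w \<in> supp \<phi>" for w
    using that \<phi> rker_props(1) by (auto simp: Fin_def x_def)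
  have kD_in: "kD z w (\<phi> w) \<in> Es" if "z \<in> supp \<phi>" "w \<in> supp \<phi>" for z w
    using mem[OF that(1)] mem[OF that(2)] by (simp add: kD_def Es.mem S_range(1) flip: x_def)
  have px: "comb \<phi> = sum x (supp \<phi>)" by (simp add: comb_def fsum_def x_def)
  have ip_p: "ipS (comb \<phi>) (comb \<phi>) = (\<Sum>z\<in>supp \<phi>. \<Sum>w\<in>supp \<phi>. ipS (x w) (x z))"
    unfolding px by (rule S.ip_sum_sum) (simp_all add: mem)
  have Radj_p: "Radj i (comb \<phi>) = (\<Sum>w\<in>supp \<phi>. cscale (cnj (w $ i)) (x w))" for i
    unfolding px by (subst Radj_sum) (use mem in \<open>auto simp: x_def Radj_rker\<close>)
  have ip_R: "ipS (Radj i (comb \<phi>)) (Radj i (comb \<phi>))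
      = (\<Sum>z\<in>supp \<phi>. \<Sum>w\<in>supp \<phi>. z $ i * cnj (w $ i) * ipS (x w) (x z))" for i
    unfolding Radj_p using mem
    by (subst S.ip_sum_sum) (auto simp: S.mem S.ip_scale_left S.ip_scale_right mult_ac intro!: sum.cong)
  have "fsum (\<lambda>z. ipEs (fsum (kD z) \<phi>)) \<phi>
      = (\<Sum>z\<in>supp \<phi>. \<Sum>w\<in>supp \<phi>. (1 - cinner_n z w) * ipS (x w) (x z))"
    using mem kD_in by (simp add: fsum_def Es.ip_sum_left kD_ip x_def)
  also have "\<dots> = ipS (comb \<phi>) (comb \<phi>) - (\<Sum>z\<in>supp \<phi>. \<Sum>w\<in>supp \<phi>. \<Sum>i\<in>UNIV. z $ i * cnj (w $ i) * ipS (x w) (x z))"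
    unfolding ip_p by (simp add: left_diff_distrib sum_subtractf cinner_n_def sum_distrib_right)
  also have "(\<Sum>z\<in>supp \<phi>. \<Sum>w\<in>supp \<phi>. \<Sum>i\<in>UNIV. z $ i * cnj (w $ i) * ipS (x w) (x z))
      = (\<Sum>z\<in>supp \<phi>. \<Sum>i\<in>UNIV. \<Sum>w\<in>supp \<phi>. z $ i * cnj (w $ i) * ipS (x w) (x z))"
    by (intro sum.cong refl) (rule sum.swap)
  also have "\<dots> = (\<Sum>i\<in>UNIV. ipS (Radj i (comb \<phi>)) (Radj i (comb \<phi>)))"
    unfolding ip_R by (rule sum.swap)
  finally show ?thesis
    using row_ineq[OF comb_in[OF \<phi>]] comb_in[OF \<phi>] by (simp add: S.hnorm_sq Radj_in)
qed

sublocale D: op_kernel Es ipEs Bn kD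
proof
  fix z w :: "complex^'n" and e assume zw: "z \<in> Bn" "w \<in> Bn" "e \<in> Es"
  have sz: "rker w e z \<in> Es" by (rule S_range(1)[OF rker_props(1)]) (use zw in auto)
  show "kD z w e \<in> Es" using sz by (simp add: kD_def Es.mem)
  show "kD z w (e + e') = kD z w e + kD z w e'" if "e' \<in> Es" for e'
    using zw that by (simp add: kD_def rker_add cv.scale_right_distrib)
  show "kD z w (cscale a e) = cscale a (kD z w e)" for a
    using zw by (simp add: kD_def rker_scale cscale_fun_def mult.commute)
  show "ipEs (kD z w e) e' = ipEs e (kD w z e')" if e': "e' \<in> Es" for e'
  proof -
    have "kD w z e' \<in> Es"
      using S_range(1)[OF rker_props(1)] zw e' by (simp add: kD_def Es.mem)
    then have "ipEs e (kD w z e') = cnj (ipEs (kD w z e') e)" by (rule Es.herm[OF _ zw(3)])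
    also have "\<dots> = cnj (1 - cinner_n w z) * cnj (ipS (rker z e') (rker w e))"
      using zw e' by (simp add: kD_ip)
    also have "\<dots> = (1 - cinner_n z w) * ipS (rker w e) (rker z e')"
      using S.herm[OF rker_props(1)[OF zw(1) e'] rker_props(1)[OF zw(2,3)]] by (simp add: cinner_n_cnj)
    finally show ?thesis using zw e' by (simp add: kD_ip)
  qed
qed (use kD_psd kD_bound in auto)

text \<open>The coisometry and its adjoint are never built as operators. The families
  \<open>rker w e\<close> in \<open>S\<close> and \<open>v w e\<close> in \<open>HE\<close> have
  equal Gram matrices, so pairing with an element of one space is a bounded functional on
  combinations in the other. \<open>functional_representation\<close> then carries elements in both
  directions, and \<open>match\<close> identifies the correspondence with multiplication by
  \<open>\<Theta>\<close>.\<close>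

theorem model:
  obtains E :: "(complex^'n \<Rightarrow> 'e) set" and ipE HE ipHE where
    "hilbert_space E ipE" "vrkhs Bn DA_kernel E ipE HE ipHE" "E \<subseteq> S"
    "\<And>z. z \<in> Bn \<Longrightarrow> bounded_op E ipE Es ipEs (\<lambda>f. f z)"
    "\<And>f. f \<in> HE \<Longrightarrow> hnorm ipS (mult_op (\<lambda>z f. f z) f) \<le> hnorm ipHE f"
    "S = mult_op (\<lambda>z f. f z) ` HE"
proof -
  define kE where "kE w e = (\<lambda>z. if z \<in> Bn then kD z w e else 0)" for w e
  have "\<exists>E ipE. hilbert E ipE \<and>
      (\<forall>f\<in>E. \<forall>z. (z \<in> Bn \<longrightarrow> f z \<in> Es) \<and> (z \<notin> Bn \<longrightarrow> f z = 0)) \<and>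
      (\<forall>w\<in>Bn. \<forall>e\<in>Es. kE w e \<in> E) \<and>
      (\<forall>f\<in>E. \<forall>w\<in>Bn. \<forall>e\<in>Es. ipEs (f w) e = ipE f (kE w e))"
    unfolding kE_def by (rule D.moore_aronszajn)
  then obtain E ipE where E: "hilbert E ipE"
    and E1: "\<forall>f\<in>E. \<forall>z. (z \<in> Bn \<longrightarrow> f z \<in> Es) \<and> (z \<notin> Bn \<longrightarrow> f z = 0)"
    and E2: "\<forall>w\<in>Bn. \<forall>e\<in>Es. kE w e \<in> E"
    and E3: "\<forall>f\<in>E. \<forall>w\<in>Bn. \<forall>e\<in>Es. ipEs (f w) e = ipE f (kE w e)"
    by (elim exE conjE) (rule that)
  have E_range: "\<And>f z. f \<in> E \<Longrightarrow> z \<in> Bn \<Longrightarrow> f z \<in> Es" "\<And>f z. f \<in> E \<Longrightarrow> z \<notin> Bn \<Longrightarrow> f z = 0"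
    and kE_in: "\<And>w e. w \<in> Bn \<Longrightarrow> e \<in> Es \<Longrightarrow> kE w e \<in> E"
    and E_rep: "\<And>f w e. f \<in> E \<Longrightarrow> w \<in> Bn \<Longrightarrow> e \<in> Es \<Longrightarrow> ipEs (f w) e = ipE f (kE w e)"
    using E1 E2 E3 by blast+
  interpret E: hilbert E ipE by (rule E)
  obtain HE ipHE where HE: "vrkhs Bn (DA_kernel :: complex^'n \<Rightarrow> complex^'n \<Rightarrow> complex) E ipE HE ipHE"
    using E.DA_space_exists by blast
  interpret HE: hilbert HE ipHE
    using HE by (simp add: vrkhs_def hilbert_space_iff)
  have HE_range: "f z \<in> E" if "f \<in> HE" "z \<in> Bn" for f z
    using HE that by (simp add: vrkhs_def)
  \<comment> \<open>The vector representing \<open>\<lambda>h. ipEs (h w w) e\<close>, that is, the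
    image of \<open>rker w e\<close> under the adjoint of multiplication by
    \<open>\<Theta>\<close>.\<close>
  define v where "v w e = kfun Bn DA_kernel w (kE w e)" for w e
  have v_in: "v w e \<in> HE" if "w \<in> Bn" "e \<in> Es" for w e
    using HE that kE_in by (simp add: vrkhs_def v_def)
  have HE_rep: "ipHE f (v z e) = ipEs (f z z) e" if "f \<in> HE" "z \<in> Bn" "e \<in> Es" for f z e
    using HE that kE_in[OF that(2,3)] E_rep[OF HE_range[OF that(1,2)] that(2,3)]
    by (simp add: vrkhs_def v_def)
  have kE_add: "kE w (e + e') = kE w e + kE w e'" if "w \<in> Bn" "e \<in> Es" "e' \<in> Es" for w e e'
    using that by (auto simp: kE_def fun_eq_iff D.k_add)
  have kE_scale: "kE w (cscale a e) = cscale a (kE w e)" if "w \<in> Bn" "e \<in> Es" for w e a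
    using that by (auto simp: kE_def fun_eq_iff D.k_scale cscale_fun_def)
  have v_add: "v w (e + e') = v w e + v w e'" if "w \<in> Bn" "e \<in> Es" "e' \<in> Es" for w e e'
    using that by (auto simp: v_def kfun_def fun_eq_iff kE_add cv.scale_right_distrib)
  have v_scale: "v w (cscale a e) = cscale a (v w e)" if "w \<in> Bn" "e \<in> Es" for w e a
    using that by (auto simp: v_def kfun_def fun_eq_iff kE_scale cscale_fun_def mult.commute)
  have v_zero: "v w 0 = 0" if "w \<in> Bn" for w
    using v_scale[OF that Es.mem(1), of 0] by simp
  have gram: "ipHE (v w e) (v z e') = ipS (rker w e) (rker z e')"
    if we: "w \<in> Bn" "e \<in> Es" and ze: "z \<in> Bn" "e' \<in> Es" for w e z e'
  proof -
    have ne: "1 - cinner_n z w \<noteq> 0"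
      using norm_cinner_n_less_1[OF ze(1) we(1)] by (metis eq_iff_diff_eq_0 less_irrefl norm_one)
    \<comment> \<open>The Drury-Arveson factor cancels the factor \<open>1 - cinner_n z w\<close> of
      the defect kernel.\<close>
    have "v w e z z = cscale (DA_kernel z w) (kD z w e)"
      using we ze by (simp add: v_def kfun_def cscale_fun_def kE_def)
    also have "\<dots> = rker w e z" using ne by (simp add: kD_def DA_kernel_def)
    finally show ?thesis
      using HE_rep[OF v_in[OF we] ze] rker_swap[OF we(1) ze(1) we(2) ze(2)] by simp
  qed
  define pv where "pv \<phi> = fsum v \<phi>" for \<phi>
  have pv_in: "pv \<phi> \<in> HE" if "\<phi> \<in> Fin Bn Es" for \<phi>
    unfolding pv_def by (rule fsum_in[OF HE.sub that]) (rule v_in)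
  have pv_add: "pv (\<phi> + \<psi>) = pv \<phi> + pv \<psi>" if "\<phi> \<in> Fin Bn Es" "\<psi> \<in> Fin Bn Es" for \<phi> \<psi>
    unfolding pv_def by (rule fsum_add[OF Es.sub that]) (rule v_add)
  have pv_scale: "pv (cscale a \<phi>) = cscale a (pv \<phi>)" if "\<phi> \<in> Fin Bn Es" for a \<phi>
    unfolding pv_def by (rule fsum_scale[OF Es.sub that]) ((erule (1) v_scale | erule v_zero | rule cv.scale_zero_right cv.scale_right_distrib)+)
  have pv_delta: "pv (delta z e) = v z e" if "z \<in> Bn" for z e
    unfolding pv_def by (rule fsum_delta) (rule v_zero[OF that])
  have iso: "hnorm ipHE (pv \<phi>) = hnorm ipS (comb \<phi>)" if \<phi>: "\<phi> \<in> Fin Bn Es" for \<phi>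
  proof -
    have mem: "w \<in> Bn" "\<phi> w \<in> Es" if "w \<in> supp \<phi>" for w
      using that \<phi> by (auto simp: Fin_def)
    have "ipHE (pv \<phi>) (pv \<phi>) = (\<Sum>z\<in>supp \<phi>. \<Sum>w\<in>supp \<phi>. ipHE (v w (\<phi> w)) (v z (\<phi> z)))"
      unfolding pv_def fsum_def by (rule HE.ip_sum_sum; rule v_in; rule mem; assumption)
    also have "\<dots> = (\<Sum>z\<in>supp \<phi>. \<Sum>w\<in>supp \<phi>. ipS (rker w (\<phi> w)) (rker z (\<phi> z)))"
      by (intro sum.cong refl gram mem)
    also have "\<dots> = ipS (comb \<phi>) (comb \<phi>)"
      unfolding comb_def fsum_def by (rule S.ip_sum_sum[symmetric]; rule rker_props(1); rule mem; assumption)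
    finally show ?thesis by (simp add: hnorm_def)
  qed
  define \<Theta> where "\<Theta> = (\<lambda>(z :: complex^'n) (f :: complex^'n \<Rightarrow> 'e). f z)"
  have match: "mult_op \<Theta> h = g"
    if g: "g \<in> S" and h: "h \<in> HE" and eq: "\<And>\<phi>. \<phi> \<in> Fin Bn Es \<Longrightarrow> ipS (comb \<phi>) g = ipHE (pv \<phi>) h" for g h
  proof
    fix z show "mult_op \<Theta> h z = g z"
    proof (cases "z \<in> Bn")
      case True
      have "h z z = g z"
      proof (rule Es.eqI_left)
        show "h z z \<in> Es" by (rule E_range(1)[OF HE_range[OF h True] True])
        show "g z \<in> Es" by (rule S_range(1)[OF g True])
        fix e assume e: "e \<in> Es"
        have "ipS (rker z e) g = ipHE (v z e) h"
          using eq[OF delta_Fin[OF Es.sub True e]] comb_delta[OF True] pv_delta[OF True] by simp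
        then have "ipS g (rker z e) = ipHE h (v z e)"
          using S.herm[OF rker_props(1)[OF True e] g] HE.herm[OF v_in[OF True e] h] by simp
        then show "ipEs (h z z) e = ipEs (g z) e"
          using HE_rep[OF h True e] rker_props(2)[OF True e g] by simp
      qed
      then show ?thesis using True by (simp add: mult_op_def \<Theta>_def)
    next
      case False
      then show ?thesis using S_range(2)[OF g] by (simp add: mult_op_def)
    qed
  qed
  have to_S: "mult_op \<Theta> h \<in> S \<and> hnorm ipS (mult_op \<Theta> h) \<le> hnorm ipHE h" if h: "h \<in> HE" for h
  proof -
    obtain g where g: "g \<in> S" "\<And>\<phi>. \<phi> \<in> Fin Bn Es \<Longrightarrow> ipS (comb \<phi>) g = ipHE (pv \<phi>) h"
      "hnorm ipS g \<le> \<bar>hnorm ipHE h\<bar>"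
    proof (rule S.functional_representation[OF csubspace_Fin[OF Es.sub, of Bn], of comb "\<lambda>\<phi>. ipHE (pv \<phi>) h" "hnorm ipHE h"])
      show "norm (ipHE (pv \<phi>) h) \<le> hnorm ipHE h * hnorm ipS (comb \<phi>)" if "\<phi> \<in> Fin Bn Es" for \<phi>
        using HE.cauchy_schwarz[OF pv_in[OF that] h] iso[OF that] by (simp add: mult.commute)
    qed (use h in \<open>auto simp: comb_in comb_add comb_scale pv_in pv_add pv_scale HE.ip_add_left HE.ip_scale_left\<close>)
    then show ?thesis using match[OF g(1) h g(2)] h by simp
  qed
  have onto: "\<exists>h\<in>HE. mult_op \<Theta> h = g" if g: "g \<in> S" for g
  proof -
    obtain h where h: "h \<in> HE" "\<And>\<phi>. \<phi> \<in> Fin Bn Es \<Longrightarrow> ipHE (pv \<phi>) h = ipS (comb \<phi>) g"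
    proof (rule HE.functional_representation[OF csubspace_Fin[OF Es.sub, of Bn], of pv "\<lambda>\<phi>. ipS (comb \<phi>) g" "hnorm ipS g"])
      show "norm (ipS (comb \<phi>) g) \<le> hnorm ipS g * hnorm ipHE (pv \<phi>)" if "\<phi> \<in> Fin Bn Es" for \<phi>
        using S.cauchy_schwarz[OF comb_in[OF that] g] iso[OF that] by (simp add: mult.commute)
    qed (use g in \<open>auto simp: comb_in comb_add comb_scale pv_in pv_add pv_scale S.ip_add_left S.ip_scale_left\<close>)
    then show ?thesis using match[OF g h(1)] by auto
  qed
  show thesis
  proof (rule that[of E ipE HE ipHE])
    show "hilbert_space E ipE" by (simp add: hilbert_space_iff E)
    show "vrkhs Bn DA_kernel E ipE HE ipHE" by (rule HE)
    show "E \<subseteq> S"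
    proof
      fix f assume f: "f \<in> E"
      \<comment> \<open>As \<open>DA_kernel z 0 = 1\<close>, the kernel function at the origin is
        the constant function with value \<open>f\<close> on the ball, and its diagonal is
        \<open>f\<close>.\<close>
      have "kfun Bn (DA_kernel :: complex^'n \<Rightarrow> _) 0 f \<in> HE" using HE f by (simp add: vrkhs_def)
      moreover have "mult_op \<Theta> (kfun Bn DA_kernel 0 f) = f"
        using E_range(2)[OF f] by (auto simp: fun_eq_iff mult_op_def \<Theta>_def kfun_def DA_kernel_def cinner_n_def)
      ultimately show "f \<in> S" using to_S by metis
    qed
    show "bounded_op E ipE Es ipEs (\<lambda>f. f z)" if z: "z \<in> Bn" for z
      unfolding bounded_op_def
    proof (intro conjI ballI allI exI[of _ "c z"])
      fix f assume f: "f \<in> E"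
      show fz: "f z \<in> Es" by (rule E_range(1)[OF f z])
      show "(f + g) z = f z + g z" for g by simp
      show "cscale a f z = cscale a (f z)" for a by (simp add: cscale_fun_def)
      show "hnorm ipEs (f z) \<le> c z * hnorm ipE f"
      proof (cases "hnorm ipEs (f z) = 0")
        case False
        have k: "kE z (f z) \<in> E" by (rule kE_in[OF z fz])
        have "(hnorm ipE (kE z (f z)))\<^sup>2 = Re (ipEs (kD z z (f z)) (f z))"
          using E.hnorm_sq[OF k] E_rep[OF k z fz] z by (simp add: kE_def)
        also have "\<dots> \<le> (c z * hnorm ipEs (f z))\<^sup>2"
          using kD_bound[OF z fz] by (simp add: power_mult_distrib)
        finally have kb: "hnorm ipE (kE z (f z)) \<le> c z * hnorm ipEs (f z)"
          by (rule power2_le_imp_le) (use c_nonneg[OF z] fz in simp)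
        have "(hnorm ipEs (f z))\<^sup>2 = norm (ipE f (kE z (f z)))"
          using E_rep[OF f z fz] Es.ip_self[OF fz] by (metis norm_of_real abs_power2)
        also have "\<dots> \<le> hnorm ipE f * hnorm ipE (kE z (f z))"
          by (rule E.cauchy_schwarz[OF f k])
        also have "\<dots> \<le> hnorm ipE f * (c z * hnorm ipEs (f z))"
          using kb f by (intro mult_left_mono) auto
        finally have "hnorm ipEs (f z) * hnorm ipEs (f z) \<le> (c z * hnorm ipE f) * hnorm ipEs (f z)"
          by (simp add: power2_eq_square mult_ac)
        then show ?thesis
          by (rule mult_right_le_imp_le) (use False Es.hnorm_ge_0[OF fz] in linarith)
      qed (use c_nonneg[OF z] f in simp)
    qed
    show "hnorm ipS (mult_op (\<lambda>z f. f z) f) \<le> hnorm ipHE f" if "f \<in> HE" for f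
      using to_S[OF that] by (simp add: \<Theta>_def)
    show "S = mult_op (\<lambda>z f. f z) ` HE"
    proof
      show "S \<subseteq> mult_op (\<lambda>z f. f z) ` HE" using onto by (force simp: \<Theta>_def)
      show "mult_op (\<lambda>z f. f z) ` HE \<subseteq> S" using to_S by (auto simp: \<Theta>_def)
    qed
  qed
qed

end

section \<open>Area means and logarithms\<close>

lemma nn_integral_lborel_translate:
  fixes f :: "'a::euclidean_space \<Rightarrow> ennreal"
  assumes "f \<in> borel_measurable borel"
  shows "(\<integral>\<^sup>+x. f (c + x) \<partial>lborel) = (\<integral>\<^sup>+x. f x \<partial>lborel)"
proof -
  have "(\<integral>\<^sup>+x. f x \<partial>lborel) = (\<integral>\<^sup>+x. f x \<partial>(distr lborel borel ((+) c)))"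
    by (simp only: lborel_distr_plus)
  also have "\<dots> = (\<integral>\<^sup>+x. f (c + x) \<partial>lborel)"
    by (rule nn_integral_distr) (use assms in simp_all)
  finally show ?thesis ..
qed

lemma nn_integral_lborel_reflect:
  fixes f :: "'a::euclidean_space \<Rightarrow> ennreal"
  assumes f: "f \<in> borel_measurable borel"
  shows "(\<integral>\<^sup>+x. f (c - x) \<partial>lborel) = (\<integral>\<^sup>+x. f x \<partial>lborel)"
proof -
  have "(\<integral>\<^sup>+x. f x \<partial>lborel) = (\<integral>\<^sup>+x. f x \<partial>(distr lborel borel (\<lambda>x. c + (-1) *\<^sub>R x)))"
    using lborel_affine[of "-1" c] by (simp add: density_1)
  also have "\<dots> = (\<integral>\<^sup>+x. f (c - x) \<partial>lborel)"
    by (subst nn_integral_distr) (use f in simp_all)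
  finally show ?thesis ..
qed

text \<open>Uniqueness of translation-invariant measures: integrate \<open>1_A (f x) * 1_U (f x + y)\<close>, with \<open>U\<close> the
  unit ball, over \<open>x\<close> and \<open>y\<close> in both orders.\<close>

lemma lborel_distr_isometry:
  fixes f :: "'a::euclidean_space \<Rightarrow> 'a"
  assumes f: "linear f" and iso: "\<And>x. norm (f x) = norm x"
  shows "distr lborel borel f = lborel"
proof (rule measure_eqI)
  have f_meas [measurable]: "f \<in> borel_measurable borel"
    using f by (intro borel_measurable_continuous_onI linear_continuous_on linear_conv_bounded_linear[THEN iffD1])
  have "inj f"
    using f iso by (simp add: linear_injective_0) (metis norm_eq_zero)
  then obtain g where g: "\<And>y. f (g y) = y"
    using linear_injective_imp_surjective[OF f] by (metis surj_def)
  show "sets (distr lborel borel f) = sets lborel" by simp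
  fix A assume "A \<in> sets (distr lborel borel f)"
  then have A [measurable]: "A \<in> sets borel" by simp
  define U :: "'a set" where "U = ball 0 1"
  have U [measurable]: "U \<in> sets borel" by (simp add: U_def)
  have ind [measurable]: "(indicator A :: 'a \<Rightarrow> ennreal) \<in> borel_measurable borel"
    "(indicator U :: 'a \<Rightarrow> ennreal) \<in> borel_measurable borel"
    using A U by (auto intro: borel_measurable_indicator)
  have fU: "f x \<in> U \<longleftrightarrow> x \<in> U" for x by (simp add: U_def iso)
  have "emeasure (distr lborel borel f) A * emeasure lborel U
      = (\<integral>\<^sup>+x. indicator A (f x) \<partial>lborel) * (\<integral>\<^sup>+y. indicator U y \<partial>lborel)"
    using nn_integral_distr[of f lborel borel "indicator A"] by simp
  also have "\<dots> = (\<integral>\<^sup>+x. \<integral>\<^sup>+y. indicator A (f x) * indicator U (f x + y) \<partial>lborel \<partial>lborel)"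
    by (subst nn_integral_multc[symmetric])
      (simp_all add: nn_integral_cmult nn_integral_lborel_translate[of "indicator U"])
  also have "\<dots> = (\<integral>\<^sup>+y. \<integral>\<^sup>+x. indicator A (f x) * indicator U (f x + y) \<partial>lborel \<partial>lborel)"
    by (rule lborel_pair.Fubini') measurable
  also have "\<dots> = (\<integral>\<^sup>+y. \<integral>\<^sup>+x. indicator A (f x - y) * indicator U (f x) \<partial>lborel \<partial>lborel)"
  proof (rule nn_integral_cong)
    fix y
    \<comment> \<open>Translating \<open>x\<close> by the preimage \<open>g y\<close> of
      \<open>y\<close> moves the shift from \<open>U\<close> to \<open>A\<close>. Afterwards
      \<open>y\<close> occurs only in the factor of \<open>A\<close>, and the inner integral no
      longer sees \<open>f\<close>.\<close>
    have "(\<integral>\<^sup>+x. indicator A (f x - y) * indicator U (f x) \<partial>lborel)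
        = (\<integral>\<^sup>+x. indicator A (f (g y + x) - y) * indicator U (f (g y + x)) \<partial>lborel)"
      by (rule nn_integral_lborel_translate[symmetric]) measurable
    then show "(\<integral>\<^sup>+x. indicator A (f x) * indicator U (f x + y) \<partial>lborel)
        = (\<integral>\<^sup>+x. indicator A (f x - y) * indicator U (f x) \<partial>lborel)"
      by (simp add: linear_add[OF f] g add.commute)
  qed
  also have "\<dots> = (\<integral>\<^sup>+x. \<integral>\<^sup>+y. indicator A (f x - y) * indicator U (f x) \<partial>lborel \<partial>lborel)"
    by (rule lborel_pair.Fubini') measurable
  also have "\<dots> = (\<integral>\<^sup>+x. indicator U x * emeasure lborel A \<partial>lborel)"
  proof (rule nn_integral_cong)
    fix x
    have "(\<integral>\<^sup>+y. indicator A (f x - y) * indicator U (f x) \<partial>lborel)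
        = (\<integral>\<^sup>+y. indicator A (f x - y) \<partial>lborel) * indicator U (f x)"
      by (rule nn_integral_multc) measurable
    also have "(\<integral>\<^sup>+y. indicator A (f x - y) \<partial>lborel) = (\<integral>\<^sup>+y. indicator A y \<partial>lborel)"
      by (rule nn_integral_lborel_reflect) measurable
    finally show "(\<integral>\<^sup>+y. indicator A (f x - y) * indicator U (f x) \<partial>lborel) = indicator U x * emeasure lborel A"
      using fU[of x] by (simp add: mult.commute indicator_eq_0_iff split: split_indicator)
  qed
  also have "\<dots> = emeasure lborel A * emeasure lborel U"
    by (simp add: nn_integral_multc mult.commute)
  finally have eq: "emeasure (distr lborel borel f) A * emeasure lborel U = emeasure lborel A * emeasure lborel U" .
  \<comment> \<open>The ball was chosen because it is invariant under \<open>f\<close> and has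
    finite nonzero measure, so that it can be cancelled.\<close>
  have fin: "emeasure lborel U < \<infinity>"
    unfolding U_def by (rule emeasure_bounded_finite) simp
  have "emeasure lborel U \<noteq> 0"
    unfolding U_def using unit_ball_vol_pos[of "real DIM('a)"] by (simp add: emeasure_ball del: unit_ball_vol_pos)
  then show "emeasure (distr lborel borel f) A = emeasure lborel A"
    using eq fin 
    by (auto simp: mult.commute[of _ "emeasure lborel U"] ennreal_mult_cancel_left)
qed

lemma uniform_limit_bound:
  assumes le: "\<And>n z. z \<in> A \<Longrightarrow> dist (f n z) (g z) \<le> C * \<delta> n" and lim: "\<delta> \<longlonglongrightarrow> (0::real)"
  shows "uniform_limit A f g sequentially"
proof (rule uniform_limitI)
  fix e :: real assume "e > 0"
  then have "\<forall>\<^sub>F n in sequentially. C * \<delta> n < e"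
    using order_tendstoD(2)[OF tendsto_mult_right_zero[OF lim, of C]] by blast
  then show "\<forall>\<^sub>F n in sequentially. \<forall>z\<in>A. dist (f n z) (g z) < e"
    by eventually_elim (use le in \<open>auto intro: le_less_trans\<close>)
qed

lemma norm_cvec_scale: "norm (c *s x) = norm c * norm (x :: complex^'n)"
  by (simp add: norm_vec_def norm_mult L2_set_right_distrib)

lemma bounded_linear_vector_scalar_mult: "bounded_linear (\<lambda>x :: complex^'n. c *s x)"
  by (rule bounded_linear_intro[of _ "norm c"])
    (auto simp: vector_add_ldistrib norm_cvec_scale vec_eq_iff)

lemma bounded_linear_vector_scalar_mult_left: "bounded_linear (\<lambda>l. l *s (x :: complex^'n))"
  by (rule bounded_linear_intro[of _ "norm x"])
    (auto simp: norm_cvec_scale vec_eq_iff algebra_simps)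

text \<open>Multiplication by a unimodular scalar is a real-linear isometry, so it preserves
  Lebesgue measure and the ball.\<close>

lemma integral_cball_rotate:
  fixes F :: "complex^'n \<Rightarrow> real"
  assumes F: "continuous_on (cball 0 s) F" and w: "norm \<omega> = 1"
  shows "(LINT x|lborel. indicator (cball 0 s) x *\<^sub>R F (\<omega> *s x)) = (LINT x|lborel. indicator (cball 0 s) x *\<^sub>R F x)"
proof -
  let ?G = "\<lambda>x. indicator (cball 0 s) x *\<^sub>R F x"
  have G: "?G \<in> borel_measurable borel"
    by (rule borel_measurable_continuous_on_indicator) (use F in auto)
  have lin: "linear (\<lambda>x :: complex^'n. \<omega> *s x)"
    by (rule bounded_linear.linear[OF bounded_linear_vector_scalar_mult])
  have "(LINT x|lborel. ?G x) = (LINT x|distr lborel borel (\<lambda>x. \<omega> *s x). ?G x)"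
    by (subst lborel_distr_isometry[OF lin]) (use w in \<open>simp_all add: norm_cvec_scale\<close>)
  also have "\<dots> = (LINT x|lborel. ?G (\<omega> *s x))"
    by (rule integral_distr)
      (use G in \<open>auto intro!: borel_measurable_continuous_onI linear_continuous_on bounded_linear_vector_scalar_mult\<close>)
  also have "(\<lambda>x. ?G (\<omega> *s x)) = (\<lambda>x. indicator (cball 0 s) x *\<^sub>R F (\<omega> *s x))"
    using w by (auto simp: fun_eq_iff indicator_def norm_cvec_scale)
  finally show ?thesis ..
qed

lemma sum_periodic_shift:
  fixes f :: "nat \<Rightarrow> 'b::ab_group_add"
  assumes "\<And>j. f (j + N) = f j"
  shows "(\<Sum>j<N. f (j + i)) = (\<Sum>j<N. f j)"
proof (induction i)
  case (Suc i)
  have "(\<Sum>j<N. f (j + Suc i)) + f i = (\<Sum>j<Suc N. f (j + i))"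
    by (subst sum.lessThan_Suc_shift) (simp add: add.commute)
  also have "\<dots> = (\<Sum>j<N. f (j + i)) + f i"
    using assms[of i] by (simp add: add.commute)
  finally show ?case using Suc by simp
qed simp

lemma norm_cis_minus_1_le: "norm (cis t - 1) \<le> \<bar>t\<bar>"
  using dist_exp_i_1[of t] abs_sin_x_le_abs_x[of "t / 2"] by (simp add: cis_conv_exp)

text \<open>The product over the rotations by the \<open>N\<close>-th roots of unity turns the arithmetic mean of \<open>F\<close> into a
  maximum modulus estimate, so that no logarithm of \<open>h\<close> (and no discussion of its zeros) is needed.\<close>

lemma log_submean_discrete:
  fixes h :: "complex^'n \<Rightarrow> complex" and F :: "complex^'n \<Rightarrow> real"
  assumes F: "uniformly_continuous_on (cball 0 s) F" and e: "\<epsilon> > 0" and s: "s > 0"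
    and hol: "\<And>x. x \<in> cball 0 s \<Longrightarrow> (\<lambda>l. h (l *s x)) holomorphic_on ball 0 1"
    and cont: "\<And>x. x \<in> cball 0 s \<Longrightarrow> continuous_on (cball 0 1) (\<lambda>l. h (l *s x))"
    and le: "\<And>x. x \<in> cball 0 s \<Longrightarrow> norm (h x) \<le> exp (F x)"
  obtains N where "N > 0"
    "\<And>x. x \<in> cball 0 s \<Longrightarrow> norm (h 0) ^ N \<le> exp ((\<Sum>j<N. F (cis (2 * pi * real j / real N) *s x)) + real N * \<epsilon>)"
proof -
  obtain d where d: "d > 0" "\<And>x y. x \<in> cball 0 s \<Longrightarrow> y \<in> cball 0 s \<Longrightarrow> dist y x < d \<Longrightarrow> dist (F y) (F x) < \<epsilon>"
    using F e unfolding uniformly_continuous_on_def by metis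
  \<comment> \<open>\<open>N\<close> is so large that an arc of angle \<open>2 * pi / N\<close> on a
    circle of radius at most \<open>s\<close> is shorter than the modulus of continuity
    \<open>d\<close>.\<close>
  obtain N :: nat where N: "2 * pi * s / d < real N" using reals_Archimedean2 by blast
  have "0 < 2 * pi * s / d" using d s by simp
  then have N0: "N > 0" using N by (cases N) auto
  have Nd: "2 * pi / real N * s < d" using N N0 d s by (simp add: field_simps)
  define w where "w j = cis (2 * pi * real j / real N)" for j :: nat
  have w_norm: "norm (w j) = 1" for j by (simp add: w_def)
  have w_add: "w (i + j) = w i * w j" for i j
    by (simp add: w_def cis_mult add_divide_distrib distrib_left)
  have w_per: "w (j + N) = w j" for j
    using N0 by (simp add: w_add) (simp add: w_def)
  have "norm (h 0) ^ N \<le> exp ((\<Sum>j<N. F (w j *s x)) + real N * \<epsilon>)" if x: "x \<in> cball 0 s" for x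
  proof -
    have wx: "c *s x \<in> cball 0 s" if "norm c = 1" for c
      using x that by (simp add: norm_cvec_scale)
    define P where "P l = (\<Prod>j<N. h (l *s (w j *s x)))" for l
    have "norm (P 0) \<le> exp ((\<Sum>j<N. F (w j *s x)) + real N * \<epsilon>)"
    proof (rule maximum_modulus_frontier[of P "cball 0 1"])
      show "P holomorphic_on interior (cball 0 1)"
        unfolding P_def interior_cball by (intro holomorphic_intros hol wx w_norm)
      show "continuous_on (closure (cball 0 1)) P"
        unfolding P_def closure_closed[OF closed_cball] by (intro continuous_intros cont wx w_norm)
      fix l :: complex assume "l \<in> frontier (cball 0 1)"
      then have l: "norm l = 1" by simp
      obtain t where t: "0 \<le> t" "t < 2 * pi" "l = cis t"
        using l Arg2pi_eq[of l] Arg2pi_ge_0[of l] Arg2pi_lt_2pi[of l] that[of "Arg2pi l"] by (simp add: cis_conv_exp)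
      \<comment> \<open>The last root of unity at or before \<open>l\<close> on the circle:
        \<open>l = cis t' * w i\<close> with a small remainder angle \<open>t'\<close>. Uniform
        continuity absorbs \<open>t'\<close>, and the index shift by \<open>i\<close> only permutes
        the sum over all roots, so the bound is the same at every boundary point.\<close>
      define i where "i = nat \<lfloor>t * real N / (2 * pi)\<rfloor>"
      have i0: "real i \<le> t * real N / (2 * pi)" "t * real N / (2 * pi) < real i + 1"
        unfolding i_def using t(1) floor_correct[of "t * real N / (2 * pi)"] by (simp_all add: field_simps)
      define t' where "t' = t - 2 * pi * real i / real N"
      have t': "0 \<le> t'" "t' \<le> 2 * pi / real N"
      proof -
        have "real i * (2 * pi) \<le> t * real N" "t * real N \<le> (real i + 1) * (2 * pi)"
          using i0 pi_gt_zero by (simp_all add: pos_le_divide_eq pos_divide_less_eq less_imp_le)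
        then show "0 \<le> t'" "t' \<le> 2 * pi / real N"
          using N0 by (simp_all add: t'_def pos_divide_le_eq pos_le_divide_eq diff_le_eq
              flip: add_divide_distrib) (simp_all add: algebra_simps)
      qed
      have lw: "l = cis t' * w i"
        by (simp add: t w_def cis_mult t'_def)
      have F_le: "F (cis t' *s y) \<le> F y + \<epsilon>" if y: "y \<in> cball 0 s" for y
      proof -
        have "cis t' *s y - y = (cis t' - 1) *s y" by (simp add: vec_eq_iff algebra_simps)
        then have "dist (cis t' *s y) y = norm (cis t' - 1) * norm y"
          by (simp only: dist_norm norm_cvec_scale)
        also have "\<dots> \<le> (2 * pi / real N) * s"
          using norm_cis_minus_1_le[of t'] t' y by (intro mult_mono) auto
        also have "\<dots> < d" by (rule Nd)
        finally have "dist (F (cis t' *s y)) (F y) < \<epsilon>"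
          using y by (intro d(2)) (auto simp: norm_cvec_scale)
        then show ?thesis by (simp add: dist_real_def)
      qed
      have "norm (P l) \<le> (\<Prod>j<N. exp (F (l *s (w j *s x))))"
        unfolding P_def prod_norm[symmetric]
        by (intro prod_mono conjI le norm_ge_zero) (use x l w_norm in \<open>simp add: norm_cvec_scale norm_mult\<close>)
      also have "\<dots> = exp (\<Sum>j<N. F (cis t' *s (w (j + i) *s x)))"
        by (simp add: exp_sum lw vector_smult_assoc w_add mult_ac)
      also have "\<dots> \<le> exp (\<Sum>j<N. F (w (j + i) *s x) + \<epsilon>)"
        unfolding exp_le_cancel_iff by (intro sum_mono F_le wx w_norm)
      also have "(\<Sum>j<N. F (w (j + i) *s x) + \<epsilon>) = (\<Sum>j<N. F (w (j + i) *s x)) + real N * \<epsilon>"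
        by (simp add: sum.distrib)
      also have "(\<Sum>j<N. F (w (j + i) *s x)) = (\<Sum>j<N. F (w j *s x))"
        by (rule sum_periodic_shift[of "\<lambda>j. F (w j *s x)"]) (simp add: w_per)
      finally show "norm (P l) \<le> exp ((\<Sum>j<N. F (w j *s x)) + real N * \<epsilon>)" .
    qed auto
    then show ?thesis by (simp add: P_def norm_power)
  qed
  then show thesis using that N0 by (simp add: w_def)
qed

text \<open>Take logarithms in the discrete estimate and integrate over \<open>x\<close>: by
  rotation invariance all \<open>N\<close> summands have the same integral, and division by
  \<open>N\<close> leaves one of them. The majorant \<open>F\<close> stands for the logarithm of the
  modulus of \<open>h\<close>, but remains finite and continuous at the zeros of
  \<open>h\<close>.\<close>

lemma log_submean:
  fixes h :: "complex^'n \<Rightarrow> complex" and F :: "complex^'n \<Rightarrow> real"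
  assumes F: "continuous_on (cball 0 s) F" and s: "s > 0"
    and hol: "\<And>x. x \<in> cball 0 s \<Longrightarrow> (\<lambda>l. h (l *s x)) holomorphic_on ball 0 1"
    and cont: "\<And>x. x \<in> cball 0 s \<Longrightarrow> continuous_on (cball 0 1) (\<lambda>l. h (l *s x))"
    and le: "\<And>x. x \<in> cball 0 s \<Longrightarrow> norm (h x) \<le> exp (F x)"
    and h0: "h 0 \<noteq> 0"
  shows "ln (norm (h 0)) * measure lborel (cball (0::complex^'n) s) \<le> (LINT x|lborel. indicator (cball 0 s) x *\<^sub>R F x)"
proof (rule field_le_epsilon)
  fix e :: real assume e: "e > 0"
  define V where "V = measure lborel (cball (0::complex^'n) s)"
  define I where "I = (LINT x|lborel. indicator (cball 0 s) x *\<^sub>R F x)"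
  have V: "V \<ge> 0" by (simp add: V_def)
  define \<epsilon> where "\<epsilon> = e / (V + 1)"
  have \<epsilon>: "\<epsilon> > 0" using e V by (simp add: \<epsilon>_def add_nonneg_pos)
  have "uniformly_continuous_on (cball 0 s) F"
    using F by (intro compact_uniformly_continuous) auto
  then obtain N where N: "N > 0"
    and ineq: "\<And>x. x \<in> cball 0 s \<Longrightarrow> norm (h 0) ^ N \<le> exp ((\<Sum>j<N. F (cis (2 * pi * real j / real N) *s x)) + real N * \<epsilon>)"
    using log_submean_discrete[OF _ \<epsilon> s hol cont le] by metis
  define w where "w j = cis (2 * pi * real j / real N)" for j :: nat
  have w_norm: "norm (w j) = 1" for j by (simp add: w_def)
  have int: "integrable lborel (\<lambda>x. indicator (cball 0 s) x *\<^sub>R G x)" if "continuous_on (cball 0 s) G" for G :: "complex^'n \<Rightarrow> real"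
    using borel_integrable_compact[of "cball 0 s" G] that by (simp add: scaleR_conv_of_real if_distrib)
  have Fw: "continuous_on (cball 0 s) (\<lambda>x. F (w j *s x))" for j
    by (rule continuous_on_compose2[OF F])
      (auto intro!: linear_continuous_on bounded_linear_vector_scalar_mult simp: norm_cvec_scale w_norm)
  have pw: "ln (norm (h 0)) * real N \<le> (\<Sum>j<N. F (w j *s x)) + real N * \<epsilon>" if x: "x \<in> cball 0 s" for x
  proof -
    have "ln (norm (h 0) ^ N) \<le> ln (exp ((\<Sum>j<N. F (w j *s x)) + real N * \<epsilon>))"
      unfolding w_def using ineq[OF x] h0 by (intro ln_mono) auto
    then show ?thesis using h0 by (simp add: ln_realpow mult.commute)
  qed
  have "ln (norm (h 0)) * real N * V = (LINT x|lborel. indicator (cball (0::complex^'n) s) x *\<^sub>R (ln (norm (h 0)) * real N))"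
    by (simp add: V_def)
  also have "\<dots> \<le> (LINT x|lborel. indicator (cball 0 s) x *\<^sub>R ((\<Sum>j<N. F (w j *s x)) + real N * \<epsilon>))"
    using pw by (intro integral_mono int continuous_intros Fw) (auto simp: indicator_def)
  also have "\<dots> = (LINT x|lborel. (\<Sum>j<N. indicator (cball 0 s) x *\<^sub>R F (w j *s x)) + indicator (cball 0 s) x *\<^sub>R (real N * \<epsilon>))"
    by (simp add: scaleR_sum_right scaleR_add_right distrib_left sum_distrib_left)
  also have "\<dots> = (\<Sum>j<N. LINT x|lborel. indicator (cball 0 s) x *\<^sub>R F (w j *s x)) + real N * \<epsilon> * V"
  proof -
    have i: "integrable lborel (\<lambda>x. indicator (cball 0 s) x *\<^sub>R F (w j *s x))" for j
      by (rule int[OF Fw])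
    have i': "integrable lborel (\<lambda>x :: complex^'n. indicator (cball 0 s) x *\<^sub>R (real N * \<epsilon>))"
      by (rule int[OF continuous_on_const])
    have c: "(LINT x|lborel. indicator (cball (0::complex^'n) s) x *\<^sub>R (real N * \<epsilon>)) = real N * \<epsilon> * V"
      unfolding V_def by simp
    show ?thesis
      by (subst Bochner_Integration.integral_add[OF Bochner_Integration.integrable_sum[OF i] i'])
        (simp only: Bochner_Integration.integral_sum[OF i] c)
  qed
  also have "(\<Sum>j<N. LINT x|lborel. indicator (cball 0 s) x *\<^sub>R F (w j *s x)) = real N * I"
    by (simp only: integral_cball_rotate[OF F w_norm] I_def) simp
  finally have "real N * (ln (norm (h 0)) * V) \<le> real N * (I + \<epsilon> * V)"
    by (simp add: algebra_simps)
  then have "ln (norm (h 0)) * V \<le> I + \<epsilon> * V" using N by simp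
  also have "\<epsilon> * V \<le> e"
    using e V by (simp add: \<epsilon>_def field_simps add_nonneg_pos)
  finally show "ln (norm (h 0)) * measure lborel (cball (0::complex^'n) s) \<le> (LINT x|lborel. indicator (cball 0 s) x *\<^sub>R F x) + e"
    by (simp add: V_def I_def)
qed

text \<open>The sets where \<open>\<phi>\<close> exceeds \<open>n\<close> are relatively open and
  have empty intersection, so by Baire's theorem one of them is not dense. A ball that avoids it has
  the bound \<open>n\<close>.\<close>

lemma baire_bounded:
  fixes \<phi> :: "'a::euclidean_space \<Rightarrow> real"
  assumes t: "t > 0" and closed: "\<And>N. closed {z \<in> cball z0 t. \<phi> z \<le> N}"
  obtains a r N where "r > 0" "cball a r \<subseteq> cball z0 t" "\<And>z. z \<in> cball a r \<Longrightarrow> \<phi> z \<le> N"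
proof -
  define G where "G n = {z \<in> cball z0 t. \<phi> z > real n}" for n :: nat
  have open_G: "openin (top_of_set (cball z0 t)) (G n)" for n
  proof -
    have "G n = cball z0 t - {z \<in> cball z0 t. \<phi> z \<le> real n}" by (auto simp: G_def)
    moreover have "closedin (top_of_set (cball z0 t)) {z \<in> cball z0 t. \<phi> z \<le> real n}"
      by (intro closed_subset closed) auto
    ultimately show ?thesis by (simp only: openin_diff openin_subtopology_self)
  qed
  have "\<exists>n. \<not> cball z0 t \<subseteq> closure (G n)"
  proof (rule ccontr)
    assume "\<not> ?thesis"
    then have "cball z0 t \<subseteq> closure (\<Inter>(range G))"
      by (intro Baire) (auto simp: open_G)
    then have "closure (\<Inter>(range G)) \<noteq> {}" using t by (metis all_not_in_conv centre_in_cball less_imp_le subsetD)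
    then obtain z where "\<And>n. z \<in> G n" by auto
    then have "\<And>n. \<phi> z > real n" by (simp add: G_def)
    then show False using reals_Archimedean2[of "\<phi> z"] less_asym by blast
  qed
  then obtain n p where p: "p \<in> cball z0 t" "p \<notin> closure (G n)" by blast
  \<comment> \<open>The point \<open>p\<close> may lie on the bounding sphere; it is replaced by a
    nearby interior point \<open>a\<close>, around which a full ball fits.\<close>
  have "cball z0 t \<subseteq> closure (ball z0 t)" using t by simp
  then have "p \<in> closure (ball z0 t)" using p(1) by blast
  moreover have "open (- closure (G n))" by (simp add: open_Compl)
  ultimately obtain a where a: "a \<in> ball z0 t" "a \<in> - closure (G n)"
    using p(2) by (metis ComplI IntE disjoint_iff open_Int_closure_eq_empty)
  then obtain r where r: "r > 0" "cball a r \<subseteq> ball z0 t \<inter> - closure (G n)"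
    by (metis Int_iff closed_closure open_Compl open_Int open_ball open_contains_cball)
  have "\<phi> z \<le> real n" if "z \<in> cball a r" for z
  proof -
    have "z \<in> cball z0 t" "z \<notin> G n" using that r(2) closure_subset by (auto, force)
    then show ?thesis by (simp add: G_def)
  qed
  with r show thesis by (intro that[of r a]) auto
qed

section \<open>Holomorphic functions of several variables\<close>

lemma holo_onE:
  assumes "holo_on U f" "z \<in> U"
  obtains L where "\<And>c v. L (c *s v) = c * L v" "(f has_derivative L) (at z)"
  using assms unfolding holo_on_def by blast

lemma holo_on_continuous: "holo_on U f \<Longrightarrow> continuous_on U f"
  by (meson continuous_at_imp_continuous_on has_derivative_continuous holo_onE)

lemma holo_on_add: "holo_on U f \<Longrightarrow> holo_on U g \<Longrightarrow> holo_on U (\<lambda>z. f z + g z)"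
  unfolding holo_on_def
proof
  fix z assume "\<forall>z\<in>U. \<exists>L. (\<forall>c v. L (c *s v) = c * L v) \<and> (f has_derivative L) (at z)"
    "\<forall>z\<in>U. \<exists>L. (\<forall>c v. L (c *s v) = c * L v) \<and> (g has_derivative L) (at z)" and z: "z \<in> U"
  then obtain L M where "\<And>c v. L (c *s v) = c * L v" "(f has_derivative L) (at z)"
    "\<And>c v. M (c *s v) = c * M v" "(g has_derivative M) (at z)" by metis
  then show "\<exists>L. (\<forall>c v. L (c *s v) = c * L v) \<and> ((\<lambda>z. f z + g z) has_derivative L) (at z)"
    by (intro exI[of _ "\<lambda>v. L v + M v"]) (auto simp: algebra_simps intro: has_derivative_add)
qed

lemma holo_on_cmult: "holo_on U f \<Longrightarrow> holo_on U (\<lambda>z. a * f z)"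
  unfolding holo_on_def
proof
  fix z assume "\<forall>z\<in>U. \<exists>L. (\<forall>c v. L (c *s v) = c * L v) \<and> (f has_derivative L) (at z)" and z: "z \<in> U"
  then obtain L where "\<And>c v. L (c *s v) = c * L v" "(f has_derivative L) (at z)" by metis
  then show "\<exists>L. (\<forall>c v. L (c *s v) = c * L v) \<and> ((\<lambda>z. a * f z) has_derivative L) (at z)"
    by (intro exI[of _ "\<lambda>v. a * L v"]) (auto intro: has_derivative_mult_right)
qed

lemma holo_on_0: "holo_on U (\<lambda>z. 0)"
  unfolding holo_on_def by (auto intro!: exI[of _ "\<lambda>_. 0"])

lemma holo_on_cong:
  assumes "open U" "\<And>z. z \<in> U \<Longrightarrow> f z = g z" "holo_on U f" shows "holo_on U g"
  unfolding holo_on_def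
proof
  fix z assume z: "z \<in> U"
  obtain L where L: "\<And>c v. L (c *s v) = c * L v" "(f has_derivative L) (at z)"
    using holo_onE[OF assms(3) z] by blast
  have "(g has_derivative L) (at z)"
    by (rule has_derivative_transform_within_open[OF L(2) assms(1) z assms(2)])
  with L(1) show "\<exists>L. (\<forall>c v. L (c *s v) = c * L v) \<and> (g has_derivative L) (at z)" by blast
qed

lemma has_derivative_line: "((\<lambda>l. a + l *s v) has_derivative (\<lambda>l. l *s (v :: complex^'n))) (at l within S)"
proof -
  have "((\<lambda>l. l *s v) has_derivative (\<lambda>l. l *s v)) (at l within S)"
    by (rule bounded_linear_imp_has_derivative) (rule bounded_linear_vector_scalar_mult_left)
  then show ?thesis
    using has_derivative_add[OF has_derivative_const[of a], of "\<lambda>l. l *s v" "\<lambda>l. l *s v"] by simp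
qed

lemma holo_on_line_deriv:
  fixes f :: "complex^'n \<Rightarrow> complex"
  assumes "\<And>c v. L (c *s v) = c * L v" "(f has_derivative L) (at (a + l *s v))"
  shows "((\<lambda>l. f (a + l *s v)) has_field_derivative L v) (at l)"
proof -
  have "((\<lambda>l. f (a + l *s v)) has_derivative (\<lambda>l. L (l *s v))) (at l)"
    by (rule has_derivative_compose[OF has_derivative_line assms(2)])
  then show ?thesis
    by (simp add: has_field_derivative_def assms(1) mult.commute[of _ "L v"])
qed

lemma holo_on_line:
  assumes f: "holo_on U f" and S: "\<And>l. l \<in> S \<Longrightarrow> a + l *s v \<in> U"
  shows "(\<lambda>l. f (a + l *s v)) holomorphic_on S"
  unfolding holomorphic_on_def
proof
  fix l assume "l \<in> S"
  then obtain L where "\<And>c v. L (c *s v) = c * L v" "(f has_derivative L) (at (a + l *s v))"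
    using holo_onE[OF f S] by metis
  then show "(\<lambda>l. f (a + l *s v)) field_differentiable at l within S"
    using holo_on_line_deriv[of L f a l v]
    by (auto simp: field_differentiable_def intro: has_field_derivative_at_within)
qed

lemma line_mem_cball: "norm l \<le> 1 \<Longrightarrow> norm x \<le> s \<Longrightarrow> (a :: complex^'n) + l *s x \<in> cball a s"
  using mult_mono[of "norm l" 1 "norm x" s] by (simp add: dist_norm norm_cvec_scale)

text \<open>Cauchy's estimate on the complex line through \<open>x\<close> in the direction of
  \<open>v\<close>, with \<open>v\<close> rescaled to length \<open>t\<close> so that the unit disc
  is mapped into the ball.\<close>

lemma holo_on_deriv_bound:
  assumes f: "holo_on U f" and t: "t > 0" "cball x t \<subseteq> U"
    and B: "\<And>z. z \<in> cball x t \<Longrightarrow> norm (f z) \<le> B"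
    and L: "\<And>c v. L (c *s v) = c * L v" "(f has_derivative L) (at x)"
  shows "norm (L v) \<le> B / t * norm v"
proof (cases "v = 0")
  case True
  then show ?thesis using L(1)[of 0 0] by simp
next
  case False
  define u where "u = of_real (t / norm v) *s v"
  have nu: "norm u = t" using False t by (simp add: u_def norm_cvec_scale norm_divide)
  have mem: "x + l *s u \<in> cball x t" if "norm l \<le> 1" for l
    by (rule line_mem_cball) (use that nu in auto)
  have hol: "(\<lambda>l. f (x + l *s u)) holomorphic_on cball 0 1"
    by (rule holo_on_line[OF f]) (use mem t in auto)
  have "norm ((deriv ^^ 1) (\<lambda>l. f (x + l *s u)) 0) \<le> fact 1 * B / 1 ^ 1"
  proof (rule Cauchy_inequality)
    show "(\<lambda>l. f (x + l *s u)) holomorphic_on ball 0 1"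
      by (rule holomorphic_on_subset[OF hol]) auto
    show "continuous_on (cball 0 1) (\<lambda>l. f (x + l *s u))"
      by (rule holomorphic_on_imp_continuous_on[OF hol])
    show "norm (f (x + l *s u)) \<le> B" if "norm (0 - l) = 1" for l
      by (rule B, rule mem) (use that in simp)
  qed simp
  moreover have "deriv (\<lambda>l. f (x + l *s u)) 0 = L u"
    by (rule DERIV_imp_deriv, rule holo_on_line_deriv) (use L in simp_all)
  ultimately have "t / norm v * norm (L v) \<le> B"
    using t by (simp add: u_def L(1) norm_mult norm_divide)
  then show ?thesis using t False by (simp add: field_simps)
qed

text \<open>Weierstrass' theorem. Every point of the ball of half the radius keeps a distance
  \<open>t / 2\<close> for Cauchy's estimate, so there the derivatives are uniformly Cauchy and the
  limit is differentiable. Complex homogeneity of the derivative passes to the limit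
  pointwise.\<close>

lemma holo_on_uniform_limit:
  fixes f :: "nat \<Rightarrow> complex^'n \<Rightarrow> complex"
  assumes f: "\<And>n. holo_on U (f n)"
    and lim: "\<And>z. z \<in> U \<Longrightarrow> \<exists>t>0. cball z t \<subseteq> U \<and> uniform_limit (cball z t) f g sequentially"
  shows "holo_on U g"
  unfolding holo_on_def
proof
  fix z assume "z \<in> U"
  then obtain t where t: "t > 0" "cball z t \<subseteq> U" "uniform_limit (cball z t) f g sequentially"
    using lim by blast
  have "\<forall>n. \<forall>x\<in>U. \<exists>L. (\<forall>c v. L (c *s v) = c * L v) \<and> (f n has_derivative L) (at x)"
    using f by (simp add: holo_on_def)
  then obtain L where L': "\<forall>n. \<forall>x\<in>U. (\<forall>c v. L n x (c *s v) = c * L n x v) \<and> (f n has_derivative L n x) (at x)"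
    by (subst (asm) bchoice_iff) (subst (asm) choice_iff, blast)
  have L: "\<And>n x c v. x \<in> U \<Longrightarrow> L n x (c *s v) = c * L n x v"
    "\<And>n x. x \<in> U \<Longrightarrow> (f n has_derivative L n x) (at x)"
    using L' by simp_all
  define S where "S = cball z (t / 2)"
  have sub: "cball x (t / 2) \<subseteq> cball z t" if "x \<in> S" for x
  proof
    fix y assume "y \<in> cball x (t / 2)"
    then show "y \<in> cball z t" using that dist_triangle[of z y x] by (simp add: S_def)
  qed
  have SU: "x \<in> U" if "x \<in> S" for x
  proof -
    have "x \<in> cball x (t / 2)" using t by simp
    then show ?thesis using sub[OF that] t(2) by blast
  qed
  have L_diff: "norm (L m x v - L n x v) \<le> e * norm v"
    if x: "x \<in> S" and le: "\<And>y. y \<in> cball z t \<Longrightarrow> norm (f m y - f n y) \<le> e * (t / 2)" for m n x e v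
  proof -
    have "norm (L m x v - L n x v) \<le> e * (t / 2) / (t / 2) * norm v"
    proof (rule holo_on_deriv_bound)
      show "holo_on U (\<lambda>z. f m z - f n z)"
        using holo_on_add[OF f[of m] holo_on_cmult[OF f[of n], of "-1"]] by simp
      show "((\<lambda>z. f m z - f n z) has_derivative (\<lambda>v. L m x v - L n x v)) (at x)"
        by (intro has_derivative_diff L SU x)
      show "cball x (t / 2) \<subseteq> U" using sub[OF x] t by blast
      show "norm (f m y - f n y) \<le> e * (t / 2)" if "y \<in> cball x (t / 2)" for y
        using that sub[OF x] by (intro le) blast
    qed (use t L(1)[OF SU[OF x]] in \<open>auto simp: algebra_simps\<close>)
    then show ?thesis using t by simp
  qed
  have unif: "\<exists>N. \<forall>m\<ge>N. \<forall>n\<ge>N. \<forall>y\<in>cball z t. norm (f m y - f n y) \<le> e" if e: "e > 0" for e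
  proof -
    obtain N where N: "\<And>n y. n \<ge> N \<Longrightarrow> y \<in> cball z t \<Longrightarrow> dist (f n y) (g y) < e / 2"
      using uniform_limitD[OF t(3), of "e / 2"] e unfolding eventually_sequentially
      by (auto simp del: mem_cball)
    have "norm (f m y - f n y) \<le> e" if "m \<ge> N" "n \<ge> N" "y \<in> cball z t" for m n y
      using dist_triangle_half_l[OF N[OF that(1,3)] N[OF that(2,3)]] by (simp add: dist_norm)
    then show ?thesis by blast
  qed
  have unifL: "\<exists>N. \<forall>m\<ge>N. \<forall>n\<ge>N. \<forall>x\<in>S. \<forall>v. norm (L m x v - L n x v) \<le> e * norm v" if e: "e > 0" for e
  proof -
    obtain N where "\<And>m n y. m \<ge> N \<Longrightarrow> n \<ge> N \<Longrightarrow> y \<in> cball z t \<Longrightarrow> norm (f m y - f n y) \<le> e * (t / 2)"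
      using unif[of "e * (t / 2)"] e t(1) by fastforce
    then show ?thesis using L_diff by blast
  qed
  have "convergent (\<lambda>n. L n x v)" if x: "x \<in> S" for x v
  proof -
    have "Cauchy (\<lambda>n. L n x v)"
    proof (rule CauchyI)
      fix e :: real assume e: "e > 0"
      define d where "d = e / (norm v + 1)"
      have d: "d > 0" using e by (simp add: d_def add_nonneg_pos)
      have "d * norm v < e"
        using e by (simp add: d_def divide_less_eq add_nonneg_pos)
      then show "\<exists>M. \<forall>m\<ge>M. \<forall>n\<ge>M. norm (L m x v - L n x v) < e"
        using unifL[OF d] x by (meson le_less_trans)
    qed
    then show ?thesis by (simp add: Cauchy_convergent_iff)
  qed
  then obtain G where G: "\<And>x v. x \<in> S \<Longrightarrow> (\<lambda>n. L n x v) \<longlonglongrightarrow> G x v"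
    unfolding convergent_def by metis
  have zS: "z \<in> S" using t by (simp add: S_def)
  have fg: "(\<lambda>n. f n x) \<longlonglongrightarrow> g x" if "x \<in> S" for x
  proof (rule tendsto_uniform_limitI[OF t(3)])
    have "x \<in> cball x (t / 2)" using t by simp
    then show "x \<in> cball z t" using sub[OF that] by blast
  qed
  have "\<exists>g'. \<forall>x\<in>S. (\<lambda>n. f n x) \<longlonglongrightarrow> g' x \<and> (g' has_derivative G x) (at x within S)"
  proof (rule has_derivative_sequence[where f = f and f' = L and g' = G and ?x0.0 = z and l = "g z"])
    show "convex S" by (simp add: S_def)
    show "(f n has_derivative L n x) (at x within S)" if "x \<in> S" for n x
      by (rule has_derivative_at_withinI[OF L(2)[OF SU[OF that]]])
    fix e :: real assume "e > 0"
    then obtain N where N: "\<And>m n x v. m \<ge> N \<Longrightarrow> n \<ge> N \<Longrightarrow> x \<in> S \<Longrightarrow> norm (L m x v - L n x v) \<le> e * norm v"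
      using unifL[OF \<open>e > 0\<close>] by metis
    have "norm (L n x v - G x v) \<le> e * norm v" if n: "n \<ge> N" and x: "x \<in> S" for n x v
    proof (rule tendsto_upperbound)
      show "(\<lambda>m. norm (L n x v - L m x v)) \<longlonglongrightarrow> norm (L n x v - G x v)"
        by (intro tendsto_intros G x)
      show "\<forall>\<^sub>F m in sequentially. norm (L n x v - L m x v) \<le> e * norm v"
        unfolding eventually_sequentially using N[OF n _ x] by blast
    qed simp
    then show "\<forall>\<^sub>F n in sequentially. \<forall>x\<in>S. \<forall>h. norm (L n x h - G x h) \<le> e * norm h"
      by (auto simp: eventually_sequentially)
  qed (rule zS, rule fg[OF zS])
  then obtain g' where g': "\<And>x. x \<in> S \<Longrightarrow> (\<lambda>n. f n x) \<longlonglongrightarrow> g' x" "\<And>x. x \<in> S \<Longrightarrow> (g' has_derivative G x) (at x within S)"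
    by blast
  have "g' x = g x" if "x \<in> S" for x
    using LIMSEQ_unique[OF g'(1)[OF that] fg[OF that]] .
  then have "(g has_derivative G z) (at z within S)"
    using has_derivative_transform[OF zS _ g'(2)[OF zS]] by metis
  moreover have "at z within S = at z"
    using t by (intro at_within_interior) (simp add: S_def)
  moreover have "G z (c *s v) = c * G z v" for c v
    using LIMSEQ_unique[OF G[OF zS, of "c *s v"]] tendsto_mult_left[OF G[OF zS, of v], of c]
    by (simp add: L(1)[OF SU[OF zS]])
  ultimately show "\<exists>L. (\<forall>c v. L (c *s v) = c * L v) \<and> (g has_derivative L) (at z)"
    by auto
qed

section \<open>Separately holomorphic positive kernels are locally bounded\<close>

lemma lborel_integral_translate:
  fixes f :: "'a::euclidean_space \<Rightarrow> real"
  assumes f: "integrable lborel f"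
  shows "integrable lborel (\<lambda>x. f (c + x))" "(LINT x|lborel. f (c + x)) = (LINT x|lborel. f x)"
proof -
  have m: "f \<in> borel_measurable borel" using f by auto
  have "integrable (distr lborel borel ((+) c)) f" using f by (simp add: lborel_distr_plus)
  then show "integrable lborel (\<lambda>x. f (c + x))"
    by (subst (asm) integrable_distr_eq) (use m in auto)
  have "(LINT x|lborel. f x) = (LINT x|distr lborel borel ((+) c). f x)" by (simp only: lborel_distr_plus)
  also have "\<dots> = (LINT x|lborel. f (c + x))" by (rule integral_distr) (use m in auto)
  finally show "(LINT x|lborel. f (c + x)) = (LINT x|lborel. f x)" ..
qed

text \<open>A Taylor coefficient in one variable, on the complex line through \<open>a\<close> in
  the direction \<open>v\<close>. Restricting to lines avoids multi-indices, provided that all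
  estimates are uniform in the unit vector \<open>v\<close>.\<close>

definition coeff :: "complex^'n \<Rightarrow> complex^'n \<Rightarrow> nat \<Rightarrow> (complex^'n \<Rightarrow> complex) \<Rightarrow> complex" where
  "coeff a v m f = (deriv ^^ m) (\<lambda>l. f (a + l *s v)) 0 / fact m"

lemma open_line: "open U \<Longrightarrow> open {l. a + l *s (v :: complex^'n) \<in> U}"
proof -
  assume "open U"
  moreover have "continuous_on UNIV (\<lambda>l. a + l *s v)"
    by (intro continuous_on_add continuous_on_const linear_continuous_on bounded_linear_vector_scalar_mult_left)
  ultimately show ?thesis
    using open_vimage[of U "\<lambda>l. a + l *s v"] by (simp add: vimage_def)
qed

lemma coeff_add:
  assumes "holo_on U f" "holo_on U g" "open U" "a \<in> U"
  shows "coeff a v m (f + g) = coeff a v m f + coeff a v m g"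
proof -
  have "(deriv ^^ m) (\<lambda>l. f (a + l *s v) + g (a + l *s v)) 0
      = (deriv ^^ m) (\<lambda>l. f (a + l *s v)) 0 + (deriv ^^ m) (\<lambda>l. g (a + l *s v)) 0"
    by (rule higher_deriv_add[OF holo_on_line[OF assms(1)] holo_on_line[OF assms(2)] open_line[OF assms(3)]])
      (use assms(4) in auto)
  then show ?thesis by (simp add: coeff_def plus_fun_def add_divide_distrib)
qed

lemma coeff_scale:
  assumes "holo_on U f" "open U" "a \<in> U"
  shows "coeff a v m (cscale c f) = c * coeff a v m f"
proof -
  have "(deriv ^^ m) (\<lambda>l. c * f (a + l *s v)) 0 = c * (deriv ^^ m) (\<lambda>l. f (a + l *s v)) 0"
    by (rule higher_deriv_cmult[OF holo_on_line[OF assms(1)] _ open_line[OF assms(2)]])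
      (use assms(3) in auto)
  then show ?thesis by (simp add: coeff_def cscale_fun_def cscale_complex_def)
qed

lemma line_mem: "norm l \<le> r \<Longrightarrow> norm v = 1 \<Longrightarrow> (a :: complex^'n) + l *s v \<in> cball a r"
  by (simp add: dist_norm norm_cvec_scale)

lemma coeff_bound:
  assumes f: "holo_on U f" and r: "0 < r" "cball a r \<subseteq> U" and v: "norm v = 1"
    and B: "\<And>l. norm l = r \<Longrightarrow> norm (f (a + l *s v)) \<le> B"
  shows "norm (coeff a v m f) \<le> B / r ^ m"
proof -
  have hol: "(\<lambda>l. f (a + l *s v)) holomorphic_on cball 0 r"
  proof (rule holo_on_line[OF f])
    fix l assume "l \<in> cball (0::complex) r"
    then show "a + l *s v \<in> U" using line_mem[OF _ v, of l r a] r by auto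
  qed
  have "norm ((deriv ^^ m) (\<lambda>l. f (a + l *s v)) 0) \<le> fact m * B / r ^ m"
    by (rule Cauchy_inequality[OF holomorphic_on_subset[OF hol] holomorphic_on_imp_continuous_on[OF hol] r(1)])
      (use B in auto)
  then have "norm ((deriv ^^ m) (\<lambda>l. f (a + l *s v)) 0) / fact m \<le> fact m * B / r ^ m / fact m"
    by (rule divide_right_mono) simp
  then show ?thesis by (simp add: coeff_def norm_divide)
qed

lemma coeff_sums:
  assumes f: "holo_on U f" and r: "cball a r \<subseteq> U" and v: "norm v = 1" and l: "norm l < r"
  shows "(\<lambda>m. coeff a v m f * l ^ m) sums f (a + l *s v)"
proof -
  have hol: "(\<lambda>l. f (a + l *s v)) holomorphic_on ball 0 r"
  proof (rule holo_on_line[OF f])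
    fix l assume "l \<in> ball (0::complex) r"
    then show "a + l *s v \<in> U" using line_mem[OF _ v, of l r a] r by auto
  qed
  show ?thesis
    using holomorphic_power_series[OF hol, of l] l by (simp add: coeff_def)
qed

locale holo_kernel_space = hilbert H ip
  for H :: "(complex^'n::finite \<Rightarrow> complex) set" and ip +
  fixes k :: "complex^'n \<Rightarrow> complex^'n \<Rightarrow> complex"
  assumes k_in: "w \<in> Bn \<Longrightarrow> k w \<in> H"
    and reproducing: "f \<in> H \<Longrightarrow> w \<in> Bn \<Longrightarrow> f w = ip f (k w)"
    and k_holo: "w \<in> Bn \<Longrightarrow> holo_on Bn (k w)"
begin

text \<open>Holomorphy is known only for the kernel functions, so Taylor coefficients are taken on
  this subspace, which contains them and is not assumed to be closed.\<close>

definition Hol where "Hol = {f \<in> H. holo_on Bn f}"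

definition kn where "kn z = hnorm ip (k z)"

lemma kn_nonneg: "z \<in> Bn \<Longrightarrow> 0 \<le> kn z"
  by (simp add: kn_def k_in)

lemma k_Hol: "w \<in> Bn \<Longrightarrow> k w \<in> Hol"
  by (simp add: Hol_def k_in k_holo)

lemma Hol_holo: "f \<in> Hol \<Longrightarrow> holo_on Bn f" and Hol_H: "f \<in> Hol \<Longrightarrow> f \<in> H"
  by (simp_all add: Hol_def)

lemma csubspace_Hol: "csubspace Hol"
proof -
  have "0 \<in> Hol" using mem(1) holo_on_0[of Bn] by (simp add: Hol_def zero_fun_def)
  moreover have "f + g \<in> Hol" if "f \<in> Hol" "g \<in> Hol" for f g
    using that mem(2) holo_on_add[of Bn f g] by (simp add: Hol_def plus_fun_def)
  moreover have "cscale c f \<in> Hol" if "f \<in> Hol" for c f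
    using that mem(3)[of f c] holo_on_cmult[of Bn f c] by (simp add: Hol_def cscale_fun_def cscale_complex_def)
  ultimately show ?thesis by (simp add: csubspace_def)
qed

lemma eval_bound: "f \<in> H \<Longrightarrow> z \<in> Bn \<Longrightarrow> norm (f z) \<le> hnorm ip f * kn z"
  using cauchy_schwarz[OF _ k_in] by (simp add: reproducing kn_def)

lemma k_diag: "z \<in> Bn \<Longrightarrow> norm (k z z) = (kn z)\<^sup>2"
  using reproducing[OF k_in, of z z] by (simp add: ip_self k_in kn_def norm_power)

lemma k_sym: "z \<in> Bn \<Longrightarrow> w \<in> Bn \<Longrightarrow> norm (k z w) = norm (k w z)"
  using reproducing[OF k_in, of z w] reproducing[OF k_in, of w z] herm[OF k_in k_in, of z w] by simp

text \<open>Lower semicontinuity: the bound \<open>N\<close> on \<open>kn z\<close> amounts to the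
  evaluation bounds \<open>N * hnorm ip f\<close> for all \<open>f\<close> in \<open>Hol\<close>,
  since \<open>f = k z\<close> already gives \<open>kn z\<close>. Each of these conditions is closed
  because the members of \<open>Hol\<close> are continuous.\<close>

lemma closed_kn_le:
  assumes "cball z0 t \<subseteq> Bn" shows "closed {z \<in> cball z0 t. kn z \<le> N}"
proof (cases "N < 0")
  case True
  then have "{z \<in> cball z0 t. kn z \<le> N} = {}" using kn_nonneg assms by force
  then show ?thesis by (simp only: closed_empty)
next
  case False
  have "{z \<in> cball z0 t. kn z \<le> N} = (\<Inter>f\<in>Hol. {z \<in> cball z0 t. norm (f z) \<le> N * hnorm ip f})"
  proof (intro subset_antisym subsetI INT_I)
    fix z f assume z: "z \<in> {z \<in> cball z0 t. kn z \<le> N}" and f: "f \<in> Hol"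
    then have "z \<in> Bn" using assms by blast
    then have "norm (f z) \<le> hnorm ip f * kn z" using eval_bound f Hol_H by blast
    also have "\<dots> \<le> hnorm ip f * N" using z f Hol_H by (intro mult_left_mono) auto
    finally show "z \<in> {z \<in> cball z0 t. norm (f z) \<le> N * hnorm ip f}" using z by (simp add: mult.commute)
  next
    fix z assume z: "z \<in> (\<Inter>f\<in>Hol. {z \<in> cball z0 t. norm (f z) \<le> N * hnorm ip f})"
    have "0 \<in> Hol" using csubspace_zero[OF csubspace_Hol] .
    then have zc: "z \<in> cball z0 t" using z by blast
    then have zB: "z \<in> Bn" using assms by blast
    have "norm (k z z) \<le> N * kn z" using z k_Hol[OF zB] by (auto simp: kn_def)
    then have "kn z * kn z \<le> N * kn z" by (simp add: k_diag[OF zB] power2_eq_square)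
    then have "kn z \<le> N" using False kn_nonneg[OF zB] by (cases "kn z = 0") (auto dest: mult_right_le_imp_le)
    then show "z \<in> {z \<in> cball z0 t. kn z \<le> N}" using zc by simp
  qed
  moreover have "closed {z \<in> cball z0 t. norm (f z) \<le> N * hnorm ip f}" if "f \<in> Hol" for f
    by (intro continuous_on_closed_Collect_le continuous_intros closed_cball
        continuous_on_subset[OF holo_on_continuous[OF Hol_holo[OF that]] assms])
  ultimately show ?thesis by auto
qed

section \<open>Enlarging the radius of a ball on which the kernel is bounded\<close>

definition kmax where "kmax a \<rho> w = max 1 (SUP z\<in>cball a \<rho>. norm (k w z))"

text \<open>Two bounds for the logarithm of a coefficient multiplied by \<rho>^m, divided by m. The
  first tends to zero for each \<open>w\<close> but is not known to be integrable; the second does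
  not depend on \<open>m\<close> and gives the dominating function. Its constant comes from C^2 /
  r^m, using \<open>C \<ge> 1\<close> and \<open>m \<ge> 1\<close>. The 1 in \<open>kmax\<close> and
  the value 0 off the ball make the function nonnegative everywhere.\<close>

definition logmax where
  "logmax a r \<rho> C m w = (if w \<in> cball a r then min (ln (kmax a \<rho> w) / real m) (2 * ln C + ln (\<rho> / r)) else 0)"

context
  fixes a r \<rho> C
  assumes r: "0 < r" and r\<rho>: "r < \<rho>" and \<rho>: "cball a \<rho> \<subseteq> Bn" and C: "C \<ge> 1"
    and kn_le: "\<And>z. z \<in> cball a r \<Longrightarrow> kn z \<le> C"
begin

lemma ball_sub: "cball a r \<subseteq> Bn"
  using r\<rho> \<rho> by (force simp: subset_eq)

lemma a_in: "a \<in> Bn"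
  using \<rho> r r\<rho> by (meson centre_in_cball less_eq_real_def less_trans subsetD)

lemma k_le_kmax: "w \<in> Bn \<Longrightarrow> z \<in> cball a \<rho> \<Longrightarrow> norm (k w z) \<le> kmax a \<rho> w"
proof -
  assume w: "w \<in> Bn" and z: "z \<in> cball a \<rho>"
  have "compact ((\<lambda>z. norm (k w z)) ` cball a \<rho>)"
    by (intro compact_continuous_image continuous_intros
        continuous_on_subset[OF holo_on_continuous[OF k_holo[OF w]] \<rho>]) simp
  then have "bdd_above ((\<lambda>z. norm (k w z)) ` cball a \<rho>)"
    by (intro bounded_imp_bdd_above compact_imp_bounded)
  then have "norm (k w z) \<le> (SUP z\<in>cball a \<rho>. norm (k w z))" by (rule cSUP_upper[OF z])
  then show ?thesis unfolding kmax_def by (rule max.coboundedI2)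
qed

lemma kmax_ge_1: "1 \<le> kmax a \<rho> w"
  by (simp add: kmax_def)

lemma logmax_bounds: "0 \<le> logmax a r \<rho> C m w" "logmax a r \<rho> C m w \<le> indicator (cball a r) w * (2 * ln C + ln (\<rho> / r))"
  using kmax_ge_1[of w] C r r\<rho> by (auto simp: logmax_def)

text \<open>The supremum in \<open>kmax\<close> runs over uncountably many points. By
  \<open>k_sym\<close> each of its terms is continuous in \<open>w\<close>, so a sublevel set inside
  the ball is an intersection of closed sets. Off the ball the auxiliary \<open>N\<close> is 1, the
  least value of \<open>kmax\<close>.\<close>

lemma logmax_measurable: "logmax a r \<rho> C m \<in> borel_measurable borel"
proof -
  define N where "N w = (if w \<in> cball a r then kmax a \<rho> w else 1)" for w
  have "N \<in> borel_measurable borel"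
  proof (rule borel_measurableI_le)
    fix y
    show "{w \<in> space borel. N w \<le> y} \<in> sets borel"
    proof (cases "y \<ge> 1")
      case False
      then have "\<not> N w \<le> y" for w using kmax_ge_1[of w] by (simp add: N_def)
      then show ?thesis by simp
    next
      case True
      have "{w \<in> space borel. N w \<le> y} = - cball a r \<union> (\<Inter>z\<in>cball a \<rho>. {w \<in> cball a r. norm (k z w) \<le> y})"
      proof (intro set_eqI iffI)
        fix w assume "w \<in> {w \<in> space borel. N w \<le> y}"
        then show "w \<in> - cball a r \<union> (\<Inter>z\<in>cball a \<rho>. {w \<in> cball a r. norm (k z w) \<le> y})"
        proof (cases "w \<in> cball a r")
          case True
          have "norm (k z w) \<le> y" if z: "z \<in> cball a \<rho>" for z
          proof -
            have "w \<in> Bn" "z \<in> Bn" using True z ball_sub \<rho> by blast+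
            then show ?thesis
              using k_le_kmax[of w z] z k_sym[of z w] True \<open>w \<in> {w \<in> space borel. N w \<le> y}\<close>
              by (simp add: N_def)
          qed
          then show ?thesis using True by blast
        qed simp
      next
        fix w assume w: "w \<in> - cball a r \<union> (\<Inter>z\<in>cball a \<rho>. {w \<in> cball a r. norm (k z w) \<le> y})"
        show "w \<in> {w \<in> space borel. N w \<le> y}"
        proof (cases "w \<in> cball a r")
          case True
          have "(SUP z\<in>cball a \<rho>. norm (k w z)) \<le> y"
          proof (rule cSUP_least)
            show "cball a \<rho> \<noteq> {}" using r r\<rho> by simp
            fix z assume z: "z \<in> cball a \<rho>"
            then have "norm (k z w) \<le> y" using w True by blast
            moreover have "w \<in> Bn" "z \<in> Bn" using True z ball_sub \<rho> by blast+
            ultimately show "norm (k w z) \<le> y" using k_sym[of z w] by simp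
          qed
          then show ?thesis using \<open>y \<ge> 1\<close> True by (simp add: N_def kmax_def)
        qed (use \<open>y \<ge> 1\<close> in \<open>simp add: N_def\<close>)
      qed
      moreover have "closed (\<Inter>z\<in>cball a \<rho>. {w \<in> cball a r. norm (k z w) \<le> y})"
        by (intro closed_INT ballI continuous_on_closed_Collect_le continuous_intros closed_cball
            continuous_on_subset[OF holo_on_continuous[OF k_holo] ball_sub]) (use \<rho> in blast)
      ultimately show ?thesis by auto
    qed
  qed
  then have "(\<lambda>w. indicator (cball a r) w * min (ln (N w) / real m) (2 * ln C + ln (\<rho> / r))) \<in> borel_measurable borel"
    by (intro borel_measurable_times borel_measurable_indicator borel_measurable_min borel_measurable_divide
        borel_measurable_ln borel_measurable_const) simp_all
  moreover have "(\<lambda>w. indicator (cball a r) w * min (ln (N w) / real m) (2 * ln C + ln (\<rho> / r))) = logmax a r \<rho> C m"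
    by (auto simp: fun_eq_iff N_def logmax_def)
  ultimately show ?thesis by simp
qed

lemma integrable_ind: "integrable lborel (\<lambda>w :: complex^'n. indicator (cball a r) w * (c::real))"
  using borel_integrable_compact[of "cball a r" "\<lambda>_. c"] by (simp add: if_distrib)

lemma logmax_integrable: "integrable lborel (logmax a r \<rho> C m)"
  by (rule Bochner_Integration.integrable_bound[OF integrable_ind[of "2 * ln C + ln (\<rho> / r)"]])
    (use logmax_measurable logmax_bounds in \<open>auto intro!: AE_I2 intro: order_trans[OF _ abs_ge_self]\<close>)

lemma logmax_tendsto: "(\<lambda>m. LINT w|lborel. logmax a r \<rho> C m w) \<longlonglongrightarrow> 0"
proof -
  have "(\<lambda>m. LINT w|lborel. logmax a r \<rho> C m w) \<longlonglongrightarrow> (LINT (w :: complex^'n)|lborel. 0)"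
  proof (rule integral_dominated_convergence[where w = "\<lambda>w. indicator (cball a r) w * (2 * ln C + ln (\<rho> / r))"])
    show "AE w in lborel. (\<lambda>m. logmax a r \<rho> C m w) \<longlonglongrightarrow> 0"
    proof (rule AE_I2)
      fix w
      have "(\<lambda>m. min (ln (kmax a \<rho> w) / real m) (2 * ln C + ln (\<rho> / r))) \<longlonglongrightarrow> min 0 (2 * ln C + ln (\<rho> / r))"
        by (intro tendsto_intros real_tendsto_divide_at_top[OF tendsto_const] filterlim_real_sequentially)
      then show "(\<lambda>m. logmax a r \<rho> C m w) \<longlonglongrightarrow> 0"
        using C r r\<rho> by (cases "w \<in> cball a r") (simp_all add: logmax_def)
    qed
    show "AE w in lborel. norm (logmax a r \<rho> C m w) \<le> indicator (cball a r) w * (2 * ln C + ln (\<rho> / r))" for m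
      using logmax_bounds by simp
  qed (use logmax_measurable integrable_ind in auto)
  then show ?thesis by simp
qed

text \<open>Cauchy's estimate on radius \<open>r\<close>, where \<open>kn\<close> is at most
  \<open>C\<close>, bounds the functional. That the representer is a norm limit of members of
  \<open>Hol\<close> is recorded because its holomorphy comes from there.\<close>

lemma coeff_functional:
  assumes v: "norm v = 1"
  obtains d where "d \<in> H" "\<And>f. f \<in> Hol \<Longrightarrow> ip f d = coeff a v m f" "hnorm ip d \<le> C / r ^ m"
    "\<And>\<epsilon>. \<epsilon> > 0 \<Longrightarrow> \<exists>f\<in>Hol. hnorm ip (f - d) < \<epsilon>"
proof (rule functional_representation[OF csubspace_Hol, of "\<lambda>f. f" "coeff a v m" "C / r ^ m"])
  show "norm (coeff a v m f) \<le> C / r ^ m * hnorm ip f" if f: "f \<in> Hol" for f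
  proof -
    have "norm (coeff a v m f) \<le> (hnorm ip f * C) / r ^ m"
    proof (rule coeff_bound[OF Hol_holo[OF f] r ball_sub v])
      fix l :: complex assume "norm l = r"
      then have z: "a + l *s v \<in> cball a r" by (intro line_mem v) simp
      then have "norm (f (a + l *s v)) \<le> hnorm ip f * kn (a + l *s v)"
        using eval_bound[OF Hol_H[OF f]] ball_sub by blast
      also have "\<dots> \<le> hnorm ip f * C" using kn_le[OF z] Hol_H[OF f] by (intro mult_left_mono) auto
      finally show "norm (f (a + l *s v)) \<le> hnorm ip f * C" .
    qed
    then show ?thesis by (simp add: mult.commute)
  qed
  show "coeff a v m (f + g) = coeff a v m f + coeff a v m g" if "f \<in> Hol" "g \<in> Hol" for f g
    by (rule coeff_add[OF Hol_holo[OF that(1)] Hol_holo[OF that(2)] open_ball a_in])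
  show "coeff a v m (cscale c f) = c * coeff a v m f" if "f \<in> Hol" for f c
    by (rule coeff_scale[OF Hol_holo[OF that] open_ball a_in])
  fix g assume g: "g \<in> H" "\<And>w. w \<in> Hol \<Longrightarrow> ip w g = coeff a v m w" "hnorm ip g \<le> \<bar>C / r ^ m\<bar>"
    "\<And>\<epsilon>. 0 < \<epsilon> \<Longrightarrow> \<exists>w\<in>Hol. hnorm ip (w - g) < \<epsilon>"
  have "\<bar>C / r ^ m\<bar> = C / r ^ m" using r C by simp
  then show thesis using that g by auto
qed (auto simp: Hol_H)

text \<open>On \<open>cball a r\<close> norm convergence is uniform because \<open>kn\<close> is
  bounded by \<open>C\<close>. This supplies the continuity of \<open>d\<close> and its holomorphy
  along lines inside this ball.\<close>

lemma Hol_limit_uniform: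
  assumes d: "d \<in> H" and appr: "\<And>\<epsilon>. \<epsilon> > 0 \<Longrightarrow> \<exists>f\<in>Hol. hnorm ip (f - d) < \<epsilon>"
  obtains f where "\<And>n::nat. f n \<in> Hol" "uniform_limit (cball a r) f d sequentially"
proof -
  obtain f where f: "\<And>n::nat. f n \<in> Hol" and lim: "(\<lambda>n. hnorm ip (f n - d)) \<longlonglongrightarrow> 0"
    using approx_seq[of Hol "\<lambda>f. f", OF _ d appr] Hol_H by blast
  have "uniform_limit (cball a r) f d sequentially"
  proof (rule uniform_limit_bound[OF _ lim])
    fix n z assume z: "z \<in> cball a r"
    have fH: "f n - d \<in> H" by (rule mem(5)[OF Hol_H[OF f] d])
    have "norm ((f n - d) z) \<le> hnorm ip (f n - d) * kn z"
      by (rule eval_bound[OF fH]) (use z ball_sub in blast)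
    also have "\<dots> \<le> hnorm ip (f n - d) * C"
      by (rule mult_left_mono[OF kn_le[OF z] hnorm_ge_0[OF fH]])
    finally show "dist (f n z) (d z) \<le> C * hnorm ip (f n - d)" by (simp add: dist_norm mult.commute)
  qed
  with f show thesis using that by blast
qed

text \<open>The conjugate of \<open>d w\<close> is the m-th coefficient of \<open>k w\<close>, and
  Cauchy's estimate for \<open>k w\<close> on the larger radius \<rho> gives the first entry of
  \<open>logmax\<close>. The second entry comes from the norm of \<open>d\<close> and the bound on
  \<open>kn w\<close>.\<close>

lemma coeff_functional_upper:
  assumes d: "d \<in> H" "\<And>f. f \<in> Hol \<Longrightarrow> ip f d = coeff a v m f" "hnorm ip d \<le> C / r ^ m"
    and v: "norm v = 1" and m: "m > 0" and w: "w \<in> cball a r"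
  shows "norm (d w) \<le> exp (real m * logmax a r \<rho> C m w - real m * ln \<rho>)"
proof -
  have wB: "w \<in> Bn" using w ball_sub by blast
  have \<rho>0: "\<rho> > 0" using r r\<rho> by simp
  have "norm (d w) = norm (coeff a v m (k w))"
    using reproducing[OF d(1) wB] herm[OF k_in[OF wB] d(1)] d(2)[OF k_Hol[OF wB]] by simp
  also have "\<dots> \<le> kmax a \<rho> w / \<rho> ^ m"
    using coeff_bound[OF k_holo[OF wB] \<rho>0 \<rho> v] k_le_kmax[OF wB line_mem[OF _ v]] by auto
  also have "\<dots> = exp (ln (kmax a \<rho> w) - real m * ln \<rho>)"
    using kmax_ge_1[of w] \<rho>0 by (simp add: exp_diff exp_of_nat_mult)
  finally have 1: "norm (d w) \<le> exp (ln (kmax a \<rho> w) - real m * ln \<rho>)" .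
  have "norm (d w) \<le> hnorm ip d * kn w" by (rule eval_bound[OF d(1) wB])
  also have "\<dots> \<le> C / r ^ m * C"
    using d(3) kn_le[OF w] kn_nonneg[OF wB] d(1) C r by (intro mult_mono) auto
  also have "\<dots> = exp (ln C + ln C - real m * ln r)"
    unfolding exp_diff exp_add exp_of_nat_mult using C r by simp
  also have "\<dots> \<le> exp (real m * (2 * ln C + ln (\<rho> / r)) - real m * ln \<rho>)"
  proof -
    have "1 * ln C \<le> real m * ln C" using m C by (intro mult_right_mono) auto
    then show ?thesis using r \<rho>0 by (simp add: ln_div algebra_simps)
  qed
  finally have 2: "norm (d w) \<le> exp (real m * (2 * ln C + ln (\<rho> / r)) - real m * ln \<rho>)" .
  show ?thesis
  proof (cases "ln (kmax a \<rho> w) / real m \<le> 2 * ln C + ln (\<rho> / r)")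
    case True
    then have "real m * logmax a r \<rho> C m w = ln (kmax a \<rho> w)" using w m by (simp add: logmax_def min_def)
    then show ?thesis using 1 by simp
  next
    case False
    then have "logmax a r \<rho> C m w = 2 * ln C + ln (\<rho> / r)" using w by (simp add: logmax_def min_def)
    then show ?thesis using 2 by simp
  qed
qed

text \<open>Hartogs' lemma. The bounds \<open>N w / \<rho> ^ m\<close>, where nothing is known about the integrability of \<open>N\<close>, and \<open>C\<^sup>2 / r ^ m\<close> are combined in
  \<open>logmax\<close>, whose integral tends to zero; the area mean makes the estimate uniform in \<open>w0\<close> and \<open>v\<close>.\<close>

lemma coeff_functional_mean:
  assumes d: "d \<in> H" "\<And>f. f \<in> Hol \<Longrightarrow> ip f d = coeff a v m f" "hnorm ip d \<le> C / r ^ m"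
    "\<And>\<epsilon>. \<epsilon> > 0 \<Longrightarrow> \<exists>f\<in>Hol. hnorm ip (f - d) < \<epsilon>"
    and v: "norm v = 1" and m: "m > 0" and r': "r' < r" and w0: "w0 \<in> cball a r'"
  shows "norm (d w0) \<le> exp (real m * ((LINT w|lborel. logmax a r \<rho> C m w) / measure lborel (cball (0::complex^'n) (r - r')) - ln \<rho>))"
proof (cases "d w0 = 0")
  case False
  obtain f where f: "\<And>n::nat. f n \<in> Hol" and lim: "uniform_limit (cball a r) f d sequentially"
    using Hol_limit_uniform[OF d(1,4)] by blast
  \<comment> \<open>The largest radius for which the ball around every admissible \<open>w0\<close>
    stays inside \<open>cball a r\<close>.\<close>
  define s where "s = r - r'"
  define V where "V = measure lborel (cball (0::complex^'n) s)"
  define I where "I = (LINT w|lborel. logmax a r \<rho> C m w)"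
  have s: "s > 0" using r' by (simp add: s_def)
  have V: "V > 0" using s by (simp add: V_def content_cball_pos)
  have sub: "w0 + x \<in> cball a r" if "x \<in> cball 0 s" for x
    using that w0 dist_triangle[of a "w0 + x" w0] by (simp add: s_def dist_norm)
  have contd: "continuous_on (cball a r) d"
    by (rule uniform_limit_theorem[OF always_eventually lim])
      (auto intro: continuous_on_subset[OF holo_on_continuous[OF Hol_holo[OF f]] ball_sub])
  define h where "h x = d (w0 + x)" for x
  \<comment> \<open>The cut-off at \<rho>^(-m) keeps \<open>F\<close> continuous at zeros of
    \<open>h\<close>. It is harmless, since \<open>logmax\<close> is nonnegative and the upper bound
    for \<open>F\<close> is never below \<open>- real m * ln \<rho>\<close>.\<close>
  define F where "F x = ln (max (norm (h x)) (exp (- real m * ln \<rho>)))" for x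
  have conth: "continuous_on (cball 0 s) h"
    unfolding h_def by (rule continuous_on_compose2[OF contd]) (intro continuous_intros, use sub in blast)
  have pos: "0 < max (norm (h x)) (exp (- real m * ln \<rho>))" for x
    by (rule less_le_trans[OF exp_gt_zero max.cobounded2])
  have contF: "continuous_on (cball 0 s) F"
    unfolding F_def using pos by (intro continuous_intros conth) (metis less_irrefl)
  have F_le: "F x \<le> real m * logmax a r \<rho> C m (w0 + x) - real m * ln \<rho>" if x: "x \<in> cball 0 s" for x
  proof -
    have "norm (h x) \<le> exp (real m * logmax a r \<rho> C m (w0 + x) - real m * ln \<rho>)"
      unfolding h_def by (rule coeff_functional_upper[OF d(1-3) v m sub[OF x]])
    moreover have "exp (- real m * ln \<rho>) \<le> exp (real m * logmax a r \<rho> C m (w0 + x) - real m * ln \<rho>)"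
      using logmax_bounds(1)[of m "w0 + x"] by simp
    ultimately show ?thesis
      unfolding F_def using ln_mono[OF _ pos[of x]] by (metis ln_exp max.bounded_iff)
  qed
  have hol: "continuous_on (cball 0 1) (\<lambda>l. h (l *s x))" "(\<lambda>l. h (l *s x)) holomorphic_on ball 0 1"
    if x: "x \<in> cball 0 s" for x
  proof -
    have mem: "w0 + l *s x \<in> cball a r" if "l \<in> cball 0 1" for l :: complex
      using that x line_mem_cball[of l x s 0] by (intro sub) simp
    have "(\<lambda>l. f n (w0 + l *s x)) holomorphic_on cball 0 1" for n
      by (rule holo_on_line[OF Hol_holo[OF f]]) (use mem ball_sub in blast)
    then have "\<forall>\<^sub>F n in sequentially. continuous_on (cball 0 1) (\<lambda>l. f n (w0 + l *s x)) \<and> (\<lambda>l. f n (w0 + l *s x)) holomorphic_on ball 0 1"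
      by (intro always_eventually allI conjI holomorphic_on_imp_continuous_on)
        (auto intro: holomorphic_on_subset[OF _ ball_subset_cball])
    moreover have "uniform_limit (cball 0 1) (\<lambda>n l. f n (w0 + l *s x)) (\<lambda>l. d (w0 + l *s x)) sequentially"
      by (rule uniform_limit_compose'[OF lim]) (use mem in auto)
    ultimately show "continuous_on (cball 0 1) (\<lambda>l. h (l *s x))" "(\<lambda>l. h (l *s x)) holomorphic_on ball 0 1"
      unfolding h_def using holomorphic_uniform_limit[of 0 1 "\<lambda>n l. f n (w0 + l *s x)" sequentially] by auto
  qed
  have "ln (norm (h 0)) * V \<le> (LINT x|lborel. indicator (cball 0 s) x *\<^sub>R F x)"
    unfolding V_def
  proof (rule log_submean[OF contF s hol(2) hol(1)])
    show "norm (h x) \<le> exp (F x)" for x using pos[of x] by (simp add: F_def)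
    show "h 0 \<noteq> 0" using False by (simp add: h_def)
  qed auto
  \<comment> \<open>Nonnegativity of \<open>logmax\<close> allows integration over the whole space,
    which removes the dependence on \<open>w0\<close>.\<close>
  also have "\<dots> \<le> (LINT x|lborel. real m * logmax a r \<rho> C m (w0 + x) - indicator (cball 0 s) x * (real m * ln \<rho>))"
  proof (rule integral_mono)
    show "integrable lborel (\<lambda>x. indicator (cball 0 s) x *\<^sub>R F x)"
      using borel_integrable_compact[OF compact_cball contF] by (simp add: if_distrib indicator_def)
    show "integrable lborel (\<lambda>x. real m * logmax a r \<rho> C m (w0 + x) - indicator (cball 0 s) x * (real m * ln \<rho>))"
      using borel_integrable_compact[of "cball (0::complex^'n) s" "\<lambda>_. real m * ln \<rho>"]
      by (intro Bochner_Integration.integrable_diff integrable_mult_right lborel_integral_translate(1) logmax_integrable)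
        (simp add: if_distrib indicator_def)
    show "indicator (cball 0 s) x *\<^sub>R F x \<le> real m * logmax a r \<rho> C m (w0 + x) - indicator (cball 0 s) x * (real m * ln \<rho>)" for x
      using F_le[of x] logmax_bounds(1)[of m "w0 + x"] by (simp add: indicator_def)
  qed
  also have "\<dots> = real m * I - V * (real m * ln \<rho>)"
  proof -
    have tr: "(LINT x|lborel. logmax a r \<rho> C m (w0 + x)) = I"
      unfolding I_def by (rule lborel_integral_translate(2)[OF logmax_integrable])
    have i1: "integrable lborel (\<lambda>x. real m * logmax a r \<rho> C m (w0 + x))"
      by (intro integrable_mult_right lborel_integral_translate(1) logmax_integrable)
    have i2: "integrable lborel (\<lambda>x :: complex^'n. indicator (cball 0 s) x * (real m * ln \<rho>))"
      using borel_integrable_compact[of "cball (0::complex^'n) s" "\<lambda>_. real m * ln \<rho>"] by (simp add: if_distrib indicator_def)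
    show ?thesis
      unfolding Bochner_Integration.integral_diff[OF i1 i2]
      by (simp add: V_def tr)
  qed
  finally have "ln (norm (d w0)) * V \<le> real m * (I / V - ln \<rho>) * V"
    using V by (simp add: h_def algebra_simps)
  then have "ln (norm (d w0)) \<le> real m * (I / V - ln \<rho>)"
    using V by (rule mult_right_le_imp_le)
  then have "exp (ln (norm (d w0))) \<le> exp (real m * (I / V - ln \<rho>))" by simp
  then show ?thesis using False by (simp add: I_def V_def s_def)
qed simp

text \<open>Here positivity of the kernel enters: the squared norm of \<open>d\<close> is the \<open>m\<close>-th Taylor coefficient of the function
  \<open>d\<close> itself, which gains the factor \<open>1 / r' ^ m\<close>.\<close>

lemma coeff_functional_norm:
  assumes d: "d \<in> H" "\<And>f. f \<in> Hol \<Longrightarrow> ip f d = coeff a v m f" "hnorm ip d \<le> C / r ^ m"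
    "\<And>\<epsilon>. \<epsilon> > 0 \<Longrightarrow> \<exists>f\<in>Hol. hnorm ip (f - d) < \<epsilon>"
    and v: "norm v = 1" and m: "m > 0" and r': "0 < r'" "r' < r"
  shows "(hnorm ip d)\<^sup>2 \<le> (exp ((LINT w|lborel. logmax a r \<rho> C m w) / measure lborel (cball (0::complex^'n) (r - r'))) / (\<rho> * r')) ^ m"
proof -
  define q where "q = exp ((LINT w|lborel. logmax a r \<rho> C m w) / measure lborel (cball (0::complex^'n) (r - r')))"
  have \<rho>0: "\<rho> > 0" using r r\<rho> by simp
  have dw: "norm (d w) \<le> (q / \<rho>) ^ m" if w: "w \<in> cball a r'" for w
    using coeff_functional_mean[OF d v m r'(2) w] \<rho>0
    by (simp add: q_def exp_of_nat_mult exp_diff)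
  obtain f where f: "\<And>n::nat. f n \<in> Hol" and fd: "(\<lambda>n. hnorm ip (f n - d)) \<longlonglongrightarrow> 0"
    using approx_seq[of Hol "\<lambda>f. f", OF _ d(1,4)] Hol_H by blast
  have fH: "f n - d \<in> H" for n by (rule mem(5)[OF Hol_H[OF f] d(1)])
  \<comment> \<open>The identity of \<open>ip f d\<close> with a coefficient is available only for
    \<open>f\<close> in \<open>Hol\<close>, so \<open>ip d d\<close> is reached through the
    approximants \<open>f n\<close>; the error \<open>hnorm ip (f n - d) * C\<close> tends to
    zero.\<close>
  have "norm (ip d (f n)) \<le> ((q / \<rho>) ^ m + hnorm ip (f n - d) * C) / r' ^ m" for n
  proof -
    have sub: "cball a r' \<subseteq> Bn" using ball_sub r'(2) by (force simp: subset_eq)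
    have "norm (coeff a v m (f n)) \<le> ((q / \<rho>) ^ m + hnorm ip (f n - d) * C) / r' ^ m"
    proof (rule coeff_bound[OF Hol_holo[OF f] r'(1) sub v])
      fix l :: complex assume "norm l = r'"
      then have z: "a + l *s v \<in> cball a r'" by (intro line_mem v) simp
      then have zr: "a + l *s v \<in> cball a r" using r'(2) by simp
      have "norm (f n (a + l *s v)) \<le> norm (d (a + l *s v)) + norm ((f n - d) (a + l *s v))"
        using norm_triangle_ineq[of "d (a + l *s v)" "(f n - d) (a + l *s v)"] by simp
      also have "\<dots> \<le> (q / \<rho>) ^ m + hnorm ip (f n - d) * kn (a + l *s v)"
        using z sub by (intro add_mono dw eval_bound[OF fH]) auto
      also have "\<dots> \<le> (q / \<rho>) ^ m + hnorm ip (f n - d) * C"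
        by (rule add_left_mono[OF mult_left_mono[OF kn_le[OF zr] hnorm_ge_0[OF fH]]])
      finally show "norm (f n (a + l *s v)) \<le> (q / \<rho>) ^ m + hnorm ip (f n - d) * C" .
    qed
    then show ?thesis
      using d(2)[OF f] herm[OF Hol_H[OF f[of n]] d(1)] by simp
  qed
  moreover have "(\<lambda>n. ip d (f n)) \<longlonglongrightarrow> ip d d"
    by (rule tendsto_ip_right) (use f Hol_H d fd in auto)
  then have "(\<lambda>n. norm (ip d (f n))) \<longlonglongrightarrow> norm (ip d d)" by (rule tendsto_norm)
  moreover have "(\<lambda>n. ((q / \<rho>) ^ m + hnorm ip (f n - d) * C) / r' ^ m) \<longlonglongrightarrow> ((q / \<rho>) ^ m + 0 * C) / r' ^ m"
    using r' by (intro tendsto_intros fd) auto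
  ultimately have "norm (ip d d) \<le> ((q / \<rho>) ^ m + 0 * C) / r' ^ m"
    by (intro tendsto_le[OF sequentially_bot]) auto
  then show ?thesis
    using d(1) by (simp add: ip_self norm_power q_def power_divide power_mult_distrib)
qed

text \<open>By \<open>coeff_functional_norm\<close> and \<open>logmax_tendsto\<close>, the norm of
  the m-th coefficient functional times s^m decays geometrically when s^2 < \<rho> r', with
  constants \<open>B\<close> that do not depend on the direction \<open>v\<close>. Summing the
  Taylor series of \<open>k z\<close> at \<open>z\<close> itself bounds \<open>kn z\<close> squared
  by \<open>kn z * suminf B\<close>, and one factor cancels.\<close>

lemma kn_bounded_geometric_mean:
  assumes s: "0 < s" "s\<^sup>2 < r * \<rho>"
  obtains M where "\<And>z. z \<in> cball a s \<Longrightarrow> kn z \<le> M"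
proof -
  have \<rho>0: "\<rho> > 0" using r r\<rho> by simp
  have s\<rho>: "s < \<rho>"
  proof (rule power2_less_imp_less)
    have "r * \<rho> \<le> \<rho> * \<rho>" using r\<rho> \<rho>0 by simp
    then show "s\<^sup>2 < \<rho>\<^sup>2" using s(2) by (simp add: power2_eq_square)
  qed (use \<rho>0 in simp)
  \<comment> \<open>The midpoint of s^2/\<rho> and r: below \<open>r\<close> there is room for area
    means, and s^2 < \<rho> r' still holds.\<close>
  define r' where "r' = (s\<^sup>2 / \<rho> + r) / 2"
  have sr: "s\<^sup>2 / \<rho> < r" using s(2) \<rho>0 by (simp add: field_simps)
  have s2: "s\<^sup>2 / \<rho> > 0" using s(1) \<rho>0 by simp
  have r': "0 < r'" "r' < r" "s\<^sup>2 / \<rho> < r'" using sr s2 unfolding r'_def by (auto simp: field_simps)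
  define V where "V = measure lborel (cball (0::complex^'n) (r - r'))"
  define q where "q m = exp ((LINT w|lborel. logmax a r \<rho> C m w) / V) * s\<^sup>2 / (\<rho> * r')" for m
  have V: "V > 0" using r' by (simp add: V_def content_cball_pos)
  have "q \<longlonglongrightarrow> exp (0 / V) * s\<^sup>2 / (\<rho> * r')"
    unfolding q_def using V \<rho>0 r' by (intro tendsto_intros logmax_tendsto) auto
  moreover have "exp (0 / V) * s\<^sup>2 / (\<rho> * r') < 1"
    using r' \<rho>0 by (simp add: field_simps)
  then obtain b where b: "exp (0 / V) * s\<^sup>2 / (\<rho> * r') < b" "b < 1" using dense by blast
  ultimately have "\<forall>\<^sub>F m in sequentially. q m < b" using order_tendstoD(2)[OF _ b(1)] by blast
  then obtain m0 where m0: "\<And>m. m \<ge> m0 \<Longrightarrow> q m < b" by (auto simp: eventually_sequentially)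
  have q0: "q m \<ge> 0" for m using \<rho>0 r' by (simp add: q_def)
  have b0: "b > 0" using m0[of m0] q0[of m0] by simp
  \<comment> \<open>The crude bound is used up to and including \<open>m0\<close>; with
    \<open>Suc m0\<close> the refined estimate is applied only to positive \<open>m\<close>, as it
    requires, even if \<open>m0\<close> is 0.\<close>
  define B where "B m = (if m < Suc m0 then s ^ m * (C / r ^ m) else (sqrt b) ^ m)" for m
  have "sqrt b < 1" using b by simp
  then have "summable (\<lambda>m. (sqrt b) ^ m)" using b0 by (intro summable_geometric) simp
  then have sumB: "summable B"
    by (rule summable_comparison_test_ev[rotated])
      (auto simp: B_def eventually_sequentially b0 less_imp_le intro!: exI[of _ "Suc m0"])
  have coeff_le: "norm (coeff a v m f) * s ^ m \<le> hnorm ip f * B m" if v: "norm v = 1" and f: "f \<in> Hol" for v m f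
  proof -
    obtain d where d: "d \<in> H" "\<And>f. f \<in> Hol \<Longrightarrow> ip f d = coeff a v m f" "hnorm ip d \<le> C / r ^ m"
      "\<And>\<epsilon>. \<epsilon> > 0 \<Longrightarrow> \<exists>f\<in>Hol. hnorm ip (f - d) < \<epsilon>"
      using coeff_functional[OF v] by blast
    have "hnorm ip d * s ^ m \<le> B m"
    proof (cases "m < Suc m0")
      case True
      have "hnorm ip d * s ^ m \<le> C / r ^ m * s ^ m" using d(3) s(1) by (intro mult_right_mono) auto
      then show ?thesis using True by (simp add: B_def mult.commute)
    next
      case False
      have "(hnorm ip d * s ^ m)\<^sup>2 = (hnorm ip d)\<^sup>2 * (s\<^sup>2) ^ m"
        by (simp add: power_mult_distrib power2_eq_square)
      also have "\<dots> \<le> (exp ((LINT w|lborel. logmax a r \<rho> C m w) / V) / (\<rho> * r')) ^ m * (s\<^sup>2) ^ m"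
        unfolding V_def using False
        by (intro mult_right_mono coeff_functional_norm[OF d v _ r'(1,2)]) auto
      also have "\<dots> = q m ^ m" by (simp add: q_def power_mult_distrib power_divide)
      also have "\<dots> \<le> b ^ m" using m0[of m] q0[of m] False by (intro power_mono) auto
      also have "\<dots> = ((sqrt b) ^ m)\<^sup>2" using b0 by (simp flip: power_mult_distrib add: power2_eq_square)
      finally have "hnorm ip d * s ^ m \<le> (sqrt b) ^ m"
        by (rule power2_le_imp_le) (use b0 in simp)
      then show ?thesis using False by (simp add: B_def)
    qed
    moreover have "norm (coeff a v m f) \<le> hnorm ip f * hnorm ip d"
      using cauchy_schwarz[OF Hol_H[OF f] d(1)] d(2)[OF f] by simp
    then have "norm (coeff a v m f) * s ^ m \<le> hnorm ip f * hnorm ip d * s ^ m"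
      using s(1) by (intro mult_right_mono) auto
    ultimately show ?thesis
      using mult_left_mono[of "hnorm ip d * s ^ m" "B m" "hnorm ip f"] Hol_H[OF f]
      by (simp add: mult.assoc)
  qed
  have "kn z \<le> suminf B" if z: "z \<in> cball a s" for z
  proof -
    have zB: "z \<in> Bn" using z s\<rho> \<rho> by (force simp: subset_eq)
    obtain l v where lv: "norm v = 1" "norm l \<le> s" "z = a + l *s v"
    proof (cases "z = a")
      case True
      show thesis
        by (rule that[of "axis undefined 1" 0]) (use True s in \<open>auto simp: norm_axis_1\<close>)
    next
      case False
      show thesis
      proof (rule that[of "of_real (1 / norm (z - a)) *s (z - a)" "of_real (norm (z - a))"])
        show "norm (of_real (1 / norm (z - a)) *s (z - a)) = 1"
          unfolding norm_cvec_scale using False by (simp add: norm_divide)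
      qed (use z False in \<open>auto simp: dist_norm norm_minus_commute\<close>)
    qed
    have sums: "(\<lambda>m. coeff a v m (k z) * l ^ m) sums k z z"
      using coeff_sums[OF k_holo[OF zB] \<rho> lv(1), of l] lv s\<rho> by simp
    have le: "norm (coeff a v m (k z) * l ^ m) \<le> kn z * B m" for m
    proof -
      have "norm (coeff a v m (k z) * l ^ m) \<le> norm (coeff a v m (k z)) * s ^ m"
        using lv(2) by (simp add: norm_mult norm_power mult_left_mono power_mono)
      also have "\<dots> \<le> kn z * B m" using coeff_le[OF lv(1) k_Hol[OF zB]] by (simp add: kn_def)
      finally show ?thesis .
    qed
    have "(kn z)\<^sup>2 = norm (\<Sum>m. coeff a v m (k z) * l ^ m)"
      using k_diag[OF zB] sums by (simp add: sums_iff)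
    also have "\<dots> \<le> (\<Sum>m. kn z * B m)"
      by (rule norm_suminf_le[OF le]) (intro summable_mult sumB)
    also have "\<dots> = kn z * suminf B" by (rule suminf_mult[OF sumB])
    finally have "kn z * kn z \<le> kn z * suminf B" by (simp add: power2_eq_square)
    moreover have "suminf B \<ge> 0"
      by (rule suminf_nonneg[OF sumB]) (use s r C b0 in \<open>auto simp: B_def\<close>)
    ultimately show ?thesis
      using kn_nonneg[OF zB] by (cases "kn z = 0") (auto dest: mult_left_le_imp_le)
  qed
  then show thesis using that by blast
qed

end

text \<open>The supremum \<sigma> of the admissible radii replaces an iteration. If \<sigma> stayed
  below \<open>1 - norm a\<close>, then with \<rho> halfway between them and an admissible
  \<open>r\<close> so close to \<sigma> that \<sigma>^2 < r \<rho>, the geometric mean step would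
  give an admissible radius above \<sigma>.\<close>

lemma kn_bounded_cball:
  assumes a: "a \<in> Bn" and r0: "r0 > 0" "\<And>z. z \<in> cball a r0 \<Longrightarrow> kn z \<le> N" and s: "s < 1 - norm a"
  shows "\<exists>M. \<forall>z\<in>cball a s. kn z \<le> M"
proof -
  define R where "R = 1 - norm a"
  have R: "R > 0" using a by (simp add: R_def)
  have cball_sub: "cball a t \<subseteq> Bn" if "t < R" for t
  proof
    fix z assume "z \<in> cball a t"
    then show "z \<in> Bn" using that norm_triangle_sub[of z a] by (simp add: R_def dist_norm norm_minus_commute)
  qed
  define T where "T = {t. 0 < t \<and> t < R \<and> (\<exists>M. \<forall>z\<in>cball a t. kn z \<le> M)}"
  have T_bdd: "bdd_above T" by (rule bdd_aboveI[of _ R]) (simp add: T_def)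
  have "\<forall>z\<in>cball a (min r0 (R / 2)). kn z \<le> N" using r0(2) by simp
  then have "min r0 (R / 2) \<in> T" using r0(1) R by (auto simp: T_def)
  then have T_ne: "T \<noteq> {}" by blast
  show ?thesis
  proof (rule ccontr)
    assume neg: "\<not> ?thesis"
    have T_le: "t \<le> s" if "t \<in> T" for t
    proof (rule ccontr)
      assume "\<not> t \<le> s"
      then have "cball a s \<subseteq> cball a t" by auto
      then show False using that neg by (auto simp: T_def)
    qed
    define \<sigma> where "\<sigma> = Sup T"
    have \<sigma>s: "\<sigma> \<le> s" unfolding \<sigma>_def using T_ne T_le by (rule cSup_least)
    have \<sigma>0: "\<sigma> > 0"
      unfolding \<sigma>_def using cSup_upper[OF \<open>min r0 (R / 2) \<in> T\<close> T_bdd] r0(1) R by simp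
    have sR: "s < R" using s by (simp add: R_def)
    define \<rho> where "\<rho> = (\<sigma> + R) / 2"
    have \<rho>: "\<sigma> < \<rho>" "\<rho> < R" using \<sigma>s sR by (auto simp: \<rho>_def)
    have "\<sigma>\<^sup>2 / \<rho> < \<sigma>" using \<rho> \<sigma>0 by (simp add: power2_eq_square divide_less_eq)
    then obtain r where r: "r \<in> T" "\<sigma>\<^sup>2 / \<rho> < r"
      unfolding \<sigma>_def using less_cSupD[OF T_ne] by blast
    have r_le: "r \<le> \<sigma>" unfolding \<sigma>_def by (rule cSup_upper[OF r(1) T_bdd])
    obtain M where M: "\<And>z. z \<in> cball a r \<Longrightarrow> kn z \<le> M" and r_pos: "0 < r"
      using r(1) unfolding T_def by blast
    have lt: "\<sigma> < sqrt (r * \<rho>)"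
      using r(2) \<rho> \<sigma>0 by (intro real_less_rsqrt) (simp add: field_simps)
    define t where "t = (\<sigma> + min (sqrt (r * \<rho>)) R) / 2"
    have t: "\<sigma> < t" "t < sqrt (r * \<rho>)" "t < R"
      using lt \<rho> by (auto simp: t_def)
    have "t\<^sup>2 < (sqrt (r * \<rho>))\<^sup>2"
      using t \<sigma>0 by (intro power_strict_mono) auto
    then have t2: "t\<^sup>2 < r * \<rho>" using r_pos \<rho> \<sigma>0 by simp
    obtain M' where "\<And>z. z \<in> cball a t \<Longrightarrow> kn z \<le> M'"
      by (rule kn_bounded_geometric_mean[OF r_pos, of \<rho> a "max M 1" t])
        (use r_le \<rho> cball_sub M t2 t \<sigma>0 in \<open>auto simp: le_max_iff_disj\<close>)
    then have "\<forall>z\<in>cball a t. kn z \<le> M'" by blast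
    then have "t \<in> T" using t \<sigma>0 by (auto simp: T_def)
    then show False using cSup_upper[OF _ T_bdd, of t] t(1) by (simp add: \<sigma>_def)
  qed
qed

theorem kn_locally_bounded:
  assumes z0: "z0 \<in> Bn"
  obtains t M where "t > 0" "cball z0 t \<subseteq> Bn" "\<And>z. z \<in> cball z0 t \<Longrightarrow> kn z \<le> M"
proof -
  \<comment> \<open>A centre \<open>a\<close> within \<open>t\<close> of \<open>z0\<close> satisfies
    \<open>1 - norm a \<ge> 3 * t\<close>, so the radius \<open>2 * t\<close> is allowed around
    \<open>a\<close>, and this ball covers \<open>cball z0 t\<close>.\<close>
  define t where "t = (1 - norm z0) / 4"
  have t: "t > 0" using z0 by (simp add: t_def)
  have sub: "cball z0 t \<subseteq> Bn"
  proof
    fix z assume "z \<in> cball z0 t"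
    then show "z \<in> Bn" using t norm_triangle_sub[of z z0] by (simp add: t_def dist_norm norm_minus_commute)
  qed
  obtain a r N where a: "r > 0" "cball a r \<subseteq> cball z0 t" "\<And>z. z \<in> cball a r \<Longrightarrow> kn z \<le> N"
    using baire_bounded[OF t closed_kn_le[OF sub]] that by metis
  have "a \<in> cball a r" using a(1) by simp
  then have az: "a \<in> cball z0 t" using a(2) by blast
  then have aB: "a \<in> Bn" using sub by blast
  have na: "norm a \<le> norm z0 + t" using az norm_triangle_sub[of a z0] by (simp add: dist_norm norm_minus_commute)
  have "2 * t < 1 - norm a" using na t unfolding t_def by argo
  then obtain M where M: "\<And>z. z \<in> cball a (2 * t) \<Longrightarrow> kn z \<le> M"
    using kn_bounded_cball[OF aB a(1,3), of "2 * t"] by blast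
  have "kn z \<le> M" if "z \<in> cball z0 t" for z
  proof (rule M)
    show "z \<in> cball a (2 * t)" using that az dist_triangle[of a z z0] by (simp add: dist_commute)
  qed
  with t sub show thesis using that by blast
qed

end

section \<open>Invariant subspaces\<close>

lemma holo_on_sum: "finite F \<Longrightarrow> (\<And>i. i \<in> F \<Longrightarrow> holo_on U (f i)) \<Longrightarrow> holo_on U (\<lambda>z. \<Sum>i\<in>F. f i z)"
  by (induction F rule: finite_induct) (auto simp: holo_on_0 holo_on_add)

theorem theorem2p3:
  fixes Es :: "'e::cvec set" and ipEs :: "'e \<Rightarrow> 'e \<Rightarrow> complex"
    and K :: "complex^'n::finite \<Rightarrow> complex^'n \<Rightarrow> complex"
    and HK :: "(complex^'n \<Rightarrow> complex) set"
    and ipK :: "(complex^'n \<Rightarrow> complex) \<Rightarrow> (complex^'n \<Rightarrow> complex) \<Rightarrow> complex"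
    and HKE :: "(complex^'n \<Rightarrow> 'e) set"
    and ipKE :: "(complex^'n \<Rightarrow> 'e) \<Rightarrow> (complex^'n \<Rightarrow> 'e) \<Rightarrow> complex"
    and S :: "(complex^'n \<Rightarrow> 'e) set"
    and ipS :: "(complex^'n \<Rightarrow> 'e) \<Rightarrow> (complex^'n \<Rightarrow> 'e) \<Rightarrow> complex"
  assumes Es: "hilbert_space Es ipEs"
    and K_pos: "pos_kernel Bn K"
    and K_holo: "\<forall>w\<in>Bn. holo_on Bn (\<lambda>z. K z w)"
    and K_antiholo: "\<forall>z\<in>Bn. holo_on Bn (\<lambda>w. cnj (K z w))"
    and HK: "analytic_hilbert_space K HK ipK"
    and HKE: "vrkhs Bn K Es ipEs HKE ipKE"
    and S_hilb: "hilbert_space S ipS"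
    and S_sub: "S \<subseteq> HKE"
    and S_contr: "\<forall>f\<in>S. hnorm ipKE f \<le> hnorm ipS f"
    and S_inv: "\<forall>j. \<forall>f\<in>S. Mz j f \<in> S"
    and R_row: "row_contraction S ipS (\<lambda>j. Mz j)"
  shows "pure_row_contraction S ipS (\<lambda>j. Mz j) \<and>
         (\<exists>(E :: (complex^'n \<Rightarrow> 'e) set) ipE HE ipHE \<Theta>.
            hilbert_space E ipE \<and>
            vrkhs Bn DA_kernel E ipE HE ipHE \<and>
            contractive_multiplier E ipE HE ipHE Es ipEs HKE ipKE \<Theta> \<and>
            S = mult_op \<Theta> ` HE)"
proof -
  interpret Es: hilbert Es ipEs using Es by (simp add: hilbert_space_iff)
  interpret S: hilbert S ipS using S_hilb by (simp add: hilbert_space_iff)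
  interpret KE: hilbert HKE ipKE using HKE by (simp add: vrkhs_def hilbert_space_iff)
  have HKv: "vrkhs Bn K UNIV ip_C HK ipK" using HK by (simp add: analytic_hilbert_space_def)
  interpret HKi: hilbert HK ipK using HKv by (simp add: vrkhs_def hilbert_space_iff)
  interpret k: holo_kernel_space HK ipK "\<lambda>w. kfun Bn K w 1"
  proof
    show "kfun Bn K w 1 \<in> HK" if "w \<in> Bn" for w using HKv that by (simp add: vrkhs_def)
    show "f w = ipK f (kfun Bn K w 1)" if "f \<in> HK" "w \<in> Bn" for f w
    proof -
      have "ip_C (f w) 1 = ipK f (kfun Bn K w 1)" using HKv that by (simp add: vrkhs_def)
      then show ?thesis by (simp add: ip_C_def)
    qed
    show "holo_on Bn (kfun Bn K w 1)" if "w \<in> Bn" for w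
      by (rule holo_on_cong[OF open_ball _ K_holo[rule_format, OF that]])
        (simp add: kfun_def cscale_complex_def)
  qed
  have k_diag: "norm (K z z) = (k.kn z)\<^sup>2" if "z \<in> Bn" for z
    using k.k_diag[OF that] that by (simp add: kfun_def cscale_complex_def)
  have KE_k: "kfun Bn K w e \<in> HKE" if "w \<in> Bn" "e \<in> Es" for w e
    using HKE that by (simp add: vrkhs_def)
  have KE_rep: "ipEs (f w) e = ipKE f (kfun Bn K w e)" if "f \<in> HKE" "w \<in> Bn" "e \<in> Es" for f w e
    using HKE that by (simp add: vrkhs_def)
  \<comment> \<open>The kernel is scalar times the identity, so evaluation on \<open>HKE\<close> is
    controlled by the scalar function \<open>kn\<close> and the Hartogs argument is needed only for
    scalar functions.\<close>
  have KE_norm: "hnorm ipKE (kfun Bn K w e) \<le> k.kn w * hnorm ipEs e" if we: "w \<in> Bn" "e \<in> Es" for w e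
  proof (rule power2_le_imp_le)
    have "(hnorm ipKE (kfun Bn K w e))\<^sup>2 = norm (ipKE (kfun Bn K w e) (kfun Bn K w e))"
      using KE_k[OF we] by (simp add: KE.ip_self norm_power)
    also have "\<dots> = norm (K w w * ipEs e e)"
      using KE_rep[OF KE_k[OF we] we] we by (simp add: kfun_def Es.ip_scale_left)
    also have "\<dots> = (k.kn w * hnorm ipEs e)\<^sup>2"
      using we by (simp add: norm_mult k_diag Es.ip_self norm_power power_mult_distrib)
    finally show "(hnorm ipKE (kfun Bn K w e))\<^sup>2 \<le> (k.kn w * hnorm ipEs e)\<^sup>2" by simp
  qed (use we k.kn_nonneg in simp)
  interpret KEe: eval_space HKE ipKE Es ipEs Bn k.kn
  proof
    show "f z \<in> Es" if "f \<in> HKE" "z \<in> Bn" for f z using HKE that by (simp add: vrkhs_def)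
    show "f z = 0" if "f \<in> HKE" "z \<notin> Bn" for f z using HKE that by (simp add: vrkhs_def)
    show "norm (ipEs (f z) e) \<le> k.kn z * hnorm ipEs e * hnorm ipKE f"
      if f: "f \<in> HKE" and ze: "z \<in> Bn" "e \<in> Es" for f z e
    proof -
      have "norm (ipEs (f z) e) \<le> hnorm ipKE f * hnorm ipKE (kfun Bn K z e)"
        using KE.cauchy_schwarz[OF f KE_k[OF ze]] KE_rep[OF f ze] by simp
      also have "\<dots> \<le> hnorm ipKE f * (k.kn z * hnorm ipEs e)"
        using KE_norm[OF ze] f by (intro mult_left_mono) auto
      finally show ?thesis by (simp add: mult_ac)
    qed
  qed (rule k.kn_nonneg)
  \<comment> \<open>Paired with \<open>e\<close>, a combination of kernel functions is a finite
    linear combination of the functions \<open>\<lambda>z. K z w\<close>. Local boundedness of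
    \<open>kn\<close> makes norm approximation locally uniform, so holomorphy survives the
    limit.\<close>
  have KE_holo: "holo_on Bn (\<lambda>z. ipEs (f z) e)" if f: "f \<in> HKE" and e: "e \<in> Es" for f e
  proof -
    have s_eq: "KEe.rker w e' = kfun Bn K w e'" if "w \<in> Bn" "e' \<in> Es" for w e'
      using that KE_k KE_rep by (intro KEe.rker_eqI) auto
    obtain \<phi> where \<phi>: "\<And>n::nat. \<phi> n \<in> Fin Bn Es"
      and lim: "(\<lambda>n. hnorm ipKE (KEe.comb (\<phi> n) - f)) \<longlonglongrightarrow> 0"
      using KE.approx_seq[of "Fin Bn Es" KEe.comb, OF _ f KEe.comb_dense[OF f]] KEe.comb_in by blast
    have p_eq: "ipEs (KEe.comb (\<phi> n) z) e = (\<Sum>w\<in>supp (\<phi> n). ipEs (\<phi> n w) e * K z w)" if z: "z \<in> Bn" for n z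
    proof -
      have mem: "w \<in> Bn" "\<phi> n w \<in> Es" if "w \<in> supp (\<phi> n)" for w
        using that \<phi>[of n] by (auto simp: Fin_def)
      have "ipEs (KEe.comb (\<phi> n) z) e = ipKE (KEe.comb (\<phi> n)) (KEe.rker z e)"
        using KEe.rker_props(2)[OF z e KEe.comb_in[OF \<phi>]] by simp
      also have "\<dots> = (\<Sum>w\<in>supp (\<phi> n). ipKE (KEe.rker w (\<phi> n w)) (KEe.rker z e))"
        unfolding KEe.comb_def fsum_def
        by (rule KE.ip_sum_left) (auto intro!: KEe.rker_props(1) mem z e)
      also have "\<dots> = (\<Sum>w\<in>supp (\<phi> n). ipEs (\<phi> n w) e * K z w)"
      proof (rule sum.cong[OF refl])
        fix w assume w: "w \<in> supp (\<phi> n)"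
        have "ipKE (KEe.rker w (\<phi> n w)) (KEe.rker z e) = ipEs (kfun Bn K w (\<phi> n w) z) e"
          using KEe.rker_swap[OF mem(1)[OF w] z mem(2)[OF w] e] s_eq[OF mem[OF w]] by simp
        also have "\<dots> = ipEs (\<phi> n w) e * K z w"
          using z mem[OF w] e by (simp add: kfun_def Es.ip_scale_left)
        finally show "ipKE (KEe.rker w (\<phi> n w)) (KEe.rker z e) = ipEs (\<phi> n w) e * K z w" .
      qed
      finally show ?thesis .
    qed
    show ?thesis
    proof (rule holo_on_uniform_limit)
      fix n
      show "holo_on Bn (\<lambda>z. ipEs (KEe.comb (\<phi> n) z) e)"
      proof (rule holo_on_cong[OF open_ball p_eq[symmetric]])
        show "holo_on Bn (\<lambda>z. \<Sum>w\<in>supp (\<phi> n). ipEs (\<phi> n w) e * K z w)"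
          using \<phi>[of n] K_holo by (intro holo_on_sum holo_on_cmult) (auto simp: Fin_def)
      qed
    next
      fix z0 :: "complex^'n" assume "z0 \<in> Bn"
      then obtain t M where t: "t > 0" "cball z0 t \<subseteq> Bn" and M: "\<And>z. z \<in> cball z0 t \<Longrightarrow> k.kn z \<le> M"
        using k.kn_locally_bounded by blast
      have "uniform_limit (cball z0 t) (\<lambda>n z. ipEs (KEe.comb (\<phi> n) z) e) (\<lambda>z. ipEs (f z) e) sequentially"
      proof (rule uniform_limit_bound[OF _ lim])
        fix n z assume z: "z \<in> cball z0 t"
        have zB: "z \<in> Bn" using z t by blast
        have d: "KEe.comb (\<phi> n) - f \<in> HKE" by (rule KE.mem(5)[OF KEe.comb_in[OF \<phi>] f])
        have "dist (ipEs (KEe.comb (\<phi> n) z) e) (ipEs (f z) e) = norm (ipEs ((KEe.comb (\<phi> n) - f) z) e)"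
          using KEe.S_range(1)[OF KEe.comb_in[OF \<phi>[of n]] zB] KEe.S_range(1)[OF f zB] e
          by (simp add: dist_norm Es.ip_diff_left)
        also have "\<dots> \<le> k.kn z * hnorm ipEs e * hnorm ipKE (KEe.comb (\<phi> n) - f)"
          by (rule KEe.eval[OF d zB e])
        also have "\<dots> \<le> M * hnorm ipEs e * hnorm ipKE (KEe.comb (\<phi> n) - f)"
          using M[OF z] e by (intro mult_right_mono KE.hnorm_ge_0[OF d]) auto
        finally show "dist (ipEs (KEe.comb (\<phi> n) z) e) (ipEs (f z) e)
            \<le> M * hnorm ipEs e * hnorm ipKE (KEe.comb (\<phi> n) - f)" .
      qed
      with t show "\<exists>t>0. cball z0 t \<subseteq> Bn \<and>
          uniform_limit (cball z0 t) (\<lambda>n z. ipEs (KEe.comb (\<phi> n) z) e) (\<lambda>z. ipEs (f z) e) sequentially"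
        by blast
    qed
  qed
  interpret R: row_space S ipS Es ipEs k.kn
  proof
    show "f z \<in> Es" if "f \<in> S" "z \<in> Bn" for f z using that S_sub by (intro KEe.S_range(1)) auto
    show "f z = 0" if "f \<in> S" "z \<notin> Bn" for f z using that S_sub by (intro KEe.S_range(2)) auto
    show "norm (ipEs (f z) e) \<le> k.kn z * hnorm ipEs e * hnorm ipS f"
      if f: "f \<in> S" and ze: "z \<in> Bn" "e \<in> Es" for f z e
    proof -
      have "norm (ipEs (f z) e) \<le> k.kn z * hnorm ipEs e * hnorm ipKE f"
        using KEe.eval[OF _ ze] f S_sub by blast
      also have "\<dots> \<le> k.kn z * hnorm ipEs e * hnorm ipS f"
        using S_contr f k.kn_nonneg[OF ze(1)] ze(2) by (intro mult_left_mono) auto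
      finally show ?thesis .
    qed
  qed ((rule k.kn_nonneg R_row | assumption)+)
  obtain E :: "(complex^'n \<Rightarrow> 'e) set" and ipE HE ipHE where E: "hilbert_space E ipE"
    and HE: "vrkhs Bn DA_kernel E ipE HE ipHE" and ES: "E \<subseteq> S"
    and bnd: "\<And>z. z \<in> Bn \<Longrightarrow> bounded_op E ipE Es ipEs (\<lambda>f. f z)"
    and contr: "\<And>f. f \<in> HE \<Longrightarrow> hnorm ipS (mult_op (\<lambda>z f. f z) f) \<le> hnorm ipHE f"
    and onto: "S = mult_op (\<lambda>z f. f z) ` HE"
    by (rule R.model) blast
  have "contractive_multiplier E ipE HE ipHE Es ipEs HKE ipKE (\<lambda>z f. f z)"
    unfolding contractive_multiplier_def
  proof (intro conjI ballI)
    show "bounded_op E ipE Es ipEs (\<lambda>f. f z)" if "z \<in> Bn" for z :: "complex^'n" by (rule bnd[OF that])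
    \<comment> \<open>Here the inclusion of \<open>E\<close> in \<open>S\<close> is used: it makes
      \<open>f\<close> an element of \<open>HKE\<close>, to which \<open>KE_holo\<close>
      applies.\<close>
    show "holo_on Bn (\<lambda>z. ipEs (f z) e)" if "f \<in> E" "e \<in> Es" for f e
      using KE_holo[OF _ that(2)] that(1) ES S_sub by blast
    fix f assume f: "f \<in> HE"
    then have fS: "mult_op (\<lambda>z f. f z) f \<in> S" using onto by blast
    then show "mult_op (\<lambda>z f. f z) f \<in> HKE" using S_sub by blast
    show "hnorm ipKE (mult_op (\<lambda>z f. f z) f) \<le> hnorm ipHE f"
      using S_contr fS contr[OF f] by (meson order_trans)
  qed
  with E HE onto R.pure show ?thesis by blast
qed

end
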